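(* Let $\mathcal{H}$ and $\mathcal{G}_i$, $i=1,\ldots,m$, be real Hilbert spaces, $f\in\Gamma(\mathcal{H})$, and $h:\mathcal{H}\to\mathbb{R}$ convex and differentiable with $\mu$-Lipschitzian gradient for some $\mu>0$. Let $z\in\mathcal{H}$ and, for every $i\in\{1,\ldots,m\}$, let $r_i\in\mathcal{G}_i$, let $g_i,l_i\in\Gamma(\mathcal{G}_i)$ with $l_i$ being $\nu_i^{-1}$-strongly convex for some $\nu_i>0$, and let $L_i:\mathcal{H}\to\mathcal{G}_i$ be a nonzero linear continuous operator. Suppose that $$z\in\operatorname{ran}\Big(\partial f+\sum_{i=1}^m L_i^*(\partial g_i\,\square\,\partial l_i)(L_i\cdot-r_i)+\nabla h\Big)$$ and that each $g_i$ is Lipschitz continuous on $\mathcal{G}_i$, $i=1,\ldots,m$. Let $x_0\in\mathcal{H}$, $(v_{1,0},\ldots,v_{m,0})\in\mathcal{G}_1\times\cdots\times\mathcal{G}_m$, $\beta=\max\{\mu,\nu_1,\ldots,\nu_m\}+\sqrt{\sum_{i=1}^m\|L_i\|^2}$, $\varepsilon\in\big(0,\frac{1}{\beta+1}\big)$, let $(\gamma_n)_{n\ge0}$ be a nondecreasing sequence in $\big[\varepsilon,\frac{1-\varepsilon}{\beta}\big]$, and define for all $n\ge0$ (and all $i=1,\ldots,m$) $$\begin{aligned} p_{1,n}&=\operatorname{Prox}_{\gamma_n f}\Big(x_n-\gamma_n\Big(\nabla h(x_n)+\sum_{i=1}^mL_i^*v_{i,n}-z\Big)\Big),\\ p_{2,i,n}&=\operatorname{Prox}_{\gamma_n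 g_i^*}\big(v_{i,n}+\gamma_n(L_ix_n-\nabla l_i^*(v_{i,n})-r_i)\big),\\ v_{i,n+1}&=\gamma_nL_i(p_{1,n}-x_n)+\gamma_n\big(\nabla l_i^*(v_{i,n})-\nabla l_i^*(p_{2,i,n})\big)+p_{2,i,n},\\ x_{n+1}&=\gamma_n\sum_{i=1}^mL_i^*(v_{i,n}-p_{2,i,n})+\gamma_n\big(\nabla h(x_n)-\nabla h(p_{1,n})\big)+p_{1,n}. \end{aligned}$$ Then $(p_{1,n})_{n\ge0}$ converges weakly to an optimal solution $\overline{x}$ of $$(P)\quad\inf_{x\in\mathcal{H}}\Big\{f(x)+\sum_{i=1}^m (g_i\,\square\, l_i)(L_ix-r_i)+h(x)-\langle x,z\rangle\Big\}$$ and is bounded, and for any bounded, convex and closed set $B_1\subset\mathcal{H}$ containing $(p_{1,n})_{n\ge0}$, and for the (bounded) set $B_2=\operatorname{dom}g_1^*\times\cdots\times\operatorname{dom}g_m^*$, the averages $x^N:=\frac1N\sum_{n=0}^{N-1}p_{1,n}$ satisfy $$F(x^N)+G(\boldsymbol{L}x^N-\boldsymbol{r})-F(\overline{x})-G(\boldsymbol{L}\overline{x}-\boldsymbol{r})\le\frac{C(B_1,B_2)}{N}\qquad\forall N\ge1,$$ where $$C(B_1,B_2)=\sup_{(x,v_1,\ldots,v_m)\in B_1\times B_2}\Big\{\frac{\|x_0-x\|^2}{2\gamma_0}+\sum_{i=1}^m\frac{\|v_{i,0}-v_i\|^2}{2\gamma_0}\Big\}.$$ In particular, the values of the objective of $(P)$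 at $(x^N)_{N\ge1}$ converge with rate $\mathcal{O}(1/N)$.
   Context: $\Gamma(\mathcal{H})$ is the set of proper, convex, lower semicontinuous functions $\mathcal{H}\to\overline{\mathbb{R}}=\mathbb{R}\cup\{\pm\infty\}$. $\operatorname{dom}f=\{x:f(x)<+\infty\}$; $f^*(p)=\sup_x\{\langle p,x\rangle-f(x)\}$ is the conjugate; $\partial f$ the convex subdifferential; $L_i^*$ the adjoint of $L_i$. For functions, $(f\,\square\,g)(x)=\inf_y\{f(y)+g(x-y)\}$ is the infimal convolution; for set-valued operators, $M_1\,\square\,M_2=(M_1^{-1}+M_2^{-1})^{-1}$ is the parallel sum, where $M^{-1}(u)=\{x: u\in Mx\}$. $\operatorname{ran}M=\{u:\exists x,\ u\in Mx\}$. $\operatorname{Prox}_{\gamma f}(x)$ is the unique minimizer of $y\mapsto f(y)+\frac{1}{2\gamma}\|y-x\|^2$. Since $l_i$ is $\nu_i^{-1}$-strongly convex, $l_i^*$ is everywhere differentiable with $\nu_i$-Lipschitzian gradient. Notation: $\boldsymbol{L}x=(L_1x,\ldots,L_mx)$, $\boldsymbol{r}=(r_1,\ldots,r_m)$, $F(x)=f(x)+h(x)-\langle x,z\rangle$, $G(\boldsymbol{y})=\sum_{i=1}^m(g_i\,\square\,l_i)(y_i)$ for $\boldsymbol{y}=(y_1,\ldots,y_m)\in\mathcal{G}_1\times\cdots\times\mathcal{G}_m$; thus the objective of $(P)$ is $F(x)+G(\boldsymbol{L}x-\boldsymbol{r})$. *)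

theory Defs
  imports "HOL-Analysis.Analysis" "HOL-Library.Landau_Symbols"
begin

text \<open>
  A real Hilbert space is rendered either as a type of sorts \<open>real_inner\<close> and \<open>complete_space\<close>, or as
  a complete linear subspace \<open>S\<close> of some \<open>real_inner\<close> type. The second form is what allows a finite
  family of Hilbert spaces that differ from index to index: every such family embeds isometrically
  in its direct sum. Functions on \<open>S\<close> are functions on the ambient type of which only the values on
  \<open>S\<close> are used; \<open>S = UNIV\<close> covers the first form.
\<close>

definition hilbert_subspace :: "'a::real_inner set \<Rightarrow> bool" where
  "hilbert_subspace S \<longleftrightarrow> subspace S \<and> complete S"

text \<open>The inequality below reads \<open>\<infinity> + (-\<infinity>)\<close> as \<open>\<infinity>\<close>, which is how \<open>ereal\<close> addition behaves.\<close>

definition econvex_on :: "'a::real_vector set \<Rightarrow> ('a \<Rightarrow> ereal) \<Rightarrow> bool" where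
  "econvex_on S f \<longleftrightarrow> (\<forall>x\<in>S. \<forall>y\<in>S. \<forall>t::real. 0 < t \<and> t < 1 \<longrightarrow>
     f (t *\<^sub>R x + (1 - t) *\<^sub>R y) \<le> ereal t * f x + ereal (1 - t) * f y)"

definition proper_on :: "'a set \<Rightarrow> ('a \<Rightarrow> ereal) \<Rightarrow> bool" where
  "proper_on S f \<longleftrightarrow> (\<forall>x\<in>S. f x \<noteq> -\<infinity>) \<and> (\<exists>x\<in>S. f x < \<infinity>)"

definition lsc_on :: "'a::topological_space set \<Rightarrow> ('a \<Rightarrow> ereal) \<Rightarrow> bool" where
  "lsc_on S f \<longleftrightarrow> (\<forall>x\<in>S. f x \<le> Liminf (at x within S) f)"

definition Gamma_on :: "'a::real_normed_vector set \<Rightarrow> ('a \<Rightarrow> ereal) set" where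
  "Gamma_on S = {f. proper_on S f \<and> econvex_on S f \<and> lsc_on S f}"

definition strongly_convex_on :: "'a::real_normed_vector set \<Rightarrow> real \<Rightarrow> ('a \<Rightarrow> ereal) \<Rightarrow> bool" where
  "strongly_convex_on S c f \<longleftrightarrow> econvex_on S (\<lambda>x. f x - ereal (c / 2 * (norm x)\<^sup>2))"

definition elipschitz_on :: "'a::metric_space set \<Rightarrow> ('a \<Rightarrow> ereal) \<Rightarrow> bool" where
  "elipschitz_on S f \<longleftrightarrow>
     (\<forall>x\<in>S. \<bar>f x\<bar> \<noteq> \<infinity>) \<and> (\<exists>K. K-lipschitz_on S (\<lambda>x. real_of_ereal (f x)))"

definition dom_on :: "'a set \<Rightarrow> ('a \<Rightarrow> ereal) \<Rightarrow> 'a set" where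
  "dom_on S f = {x \<in> S. f x < \<infinity>}"

definition conjugate_on :: "'a::real_inner set \<Rightarrow> ('a \<Rightarrow> ereal) \<Rightarrow> 'a \<Rightarrow> ereal" where
  "conjugate_on S f p = (SUP x\<in>S. ereal (inner p x) - f x)"

definition infconv_on :: "'a::real_vector set \<Rightarrow> ('a \<Rightarrow> ereal) \<Rightarrow> ('a \<Rightarrow> ereal) \<Rightarrow> 'a \<Rightarrow> ereal" where
  "infconv_on S f g x = (INF y\<in>S. f y + g (x - y))"

text \<open>Set-valued operators are functions into sets; an operator on \<open>S\<close> is empty outside \<open>S\<close>.\<close>

definition subdiff_on :: "'a::real_inner set \<Rightarrow> ('a \<Rightarrow> ereal) \<Rightarrow> 'a \<Rightarrow> 'a set" where
  "subdiff_on S f x =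
     {u. x \<in> S \<and> u \<in> S \<and> \<bar>f x\<bar> \<noteq> \<infinity> \<and> (\<forall>y\<in>S. f x + ereal (inner u (y - x)) \<le> f y)}"

definition op_inv :: "('a \<Rightarrow> 'b set) \<Rightarrow> 'b \<Rightarrow> 'a set" where
  "op_inv M u = {x. u \<in> M x}"

definition op_ran :: "('a \<Rightarrow> 'b set) \<Rightarrow> 'b set" where
  "op_ran M = {u. \<exists>x. u \<in> M x}"

text \<open>The sum of two sets is the Minkowski sum of \<open>Set_Algebras\<close>.\<close>

definition parallel_sum :: "('a \<Rightarrow> 'b::ab_group_add set) \<Rightarrow> ('a::ab_group_add \<Rightarrow> 'b set) \<Rightarrow> 'a \<Rightarrow> 'b set" where
  "parallel_sum M1 M2 = op_inv (\<lambda>u. op_inv M1 u + op_inv M2 u)"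

definition gradient_on :: "'a::real_inner set \<Rightarrow> ('a \<Rightarrow> real) \<Rightarrow> 'a \<Rightarrow> 'a" where
  "gradient_on S \<phi> x = (THE D. D \<in> S \<and> (\<phi> has_derivative (\<lambda>k. inner k D)) (at x within S))"

definition prox_on :: "'a::real_inner set \<Rightarrow> real \<Rightarrow> ('a \<Rightarrow> ereal) \<Rightarrow> 'a \<Rightarrow> 'a" where
  "prox_on S \<gamma> f x =
     (THE y. is_arg_min (\<lambda>y. f y + ereal (1 / (2 * \<gamma>) * (norm (y - x))\<^sup>2)) (\<lambda>y. y \<in> S) y)"

definition weakly_converges_to :: "(nat \<Rightarrow> 'a::real_inner) \<Rightarrow> 'a \<Rightarrow> bool" where
  "weakly_converges_to X l \<longleftrightarrow> (\<forall>u. (\<lambda>n. inner (X n) u) \<longlonglongrightarrow> inner l u)"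

end

theory Submission
  imports Defs
begin

text \<open>
  Write \<open>p n = (p1 n, p2 n)\<close> for the primal and dual proximal points, \<open>x n\<close> for the pair of
  primal and dual iterates, and
  \<open>Lag(x, v) = f x + h x - \<langle>x, z\<rangle> + \<Sum> (\<langle>L\<^sub>i x - r\<^sub>i, v\<^sub>i\<rangle> - g\<^sub>i\<^sup>*(v\<^sub>i) - l\<^sub>i\<^sup>*(v\<^sub>i))\<close>. A saddle point of \<open>Lag\<close> is
  a zero of \<open>A + B\<close> in \<open>\<H> \<oplus> \<G>\<^sub>1 \<oplus> \<dots> \<oplus> \<G>\<^sub>m\<close>, where \<open>A\<close> collects \<open>\<partial>f\<close> and the \<open>\<partial>g\<^sub>i\<^sup>*\<close>, shifted by \<open>z\<close> and \<open>r\<^sub>i\<close>, and \<open>B\<close>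
  collects \<open>\<nabla>h\<close>, the \<open>\<nabla>l\<^sub>i\<^sup>*\<close> and the skew coupling through the \<open>L\<^sub>i\<close>; \<open>B\<close> is monotone and
  \<open>\<beta>\<close>-Lipschitz. The algorithm is Tseng's forward-backward-forward iteration for this splitting, and
  the residual \<open>e n = (x n - x (n + 1)) / \<gamma> n\<close> (the constant \<open>residual\<close>) belongs to \<open>(A + B) (p n)\<close>. Everything rests on one
  inequality (\<open>energy\<close>), valid for every point \<open>q\<close>:
  \<open>2 \<gamma>\<^sub>n \<langle>e n, p n - q\<rangle> + \<parallel>x (n + 1) - q\<parallel>\<^sup>2 + \<epsilon> \<parallel>x n - p n\<parallel>\<^sup>2 \<le> \<parallel>x n - q\<parallel>\<^sup>2\<close>.

  If \<open>q\<close> is a zero of \<open>A + B\<close>, the inner product is nonnegative by monotonicity. The iterates are then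
  Fejer monotone, \<open>x n - p n\<close> and \<open>e n\<close> tend to \<open>0\<close>, and Opial's argument together with the maximality
  of \<open>A + B\<close> gives weak convergence (\<open>weak_convergence\<close>). Weak sequential compactness is replaced by
  a point common to the closed convex hulls of all tails (\<open>bounded_sequence_asymptotic_point\<close>). Such
  a point lies in every closed convex set containing the sequence, so the limit is in \<open>B\<^sub>1\<close>.

  If \<open>q = (xbar, v)\<close> is arbitrary, \<open>\<langle>e n, p n - q\<rangle>\<close> bounds the gap \<open>Lag(p1 n, v) - Lag(xbar, p2 n)\<close>
  (\<open>gap_le_residual\<close>). Summation over \<open>n < N\<close> telescopes because \<open>\<gamma>\<close> is nondecreasing, and convexity of \<open>Lag\<close> in
  the first argument passes to the average \<open>x\<^sup>N\<close>. It remains to recover the objective at \<open>x\<^sup>N\<close> as a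
  supremum of \<open>Lag(x\<^sup>N, v)\<close> over \<open>v\<close> in the product of the \<open>dom g\<^sub>i\<^sup>*\<close>. This is conjugate duality for
  \<open>g\<^sub>i \<box> l\<^sub>i\<close>, obtained up to an error \<open>\<delta>\<close> from one proximal step (\<open>infconv_on_approx_dual\<close>). The sets
  \<open>dom g\<^sub>i\<^sup>*\<close> are bounded since \<open>g\<^sub>i\<close> is Lipschitz, which makes the constant finite.

  The convex analysis reduces to the existence of proximal points
  (\<open>prox_objective_has_minimizer\<close>): the Riesz representation, the gradient of the conjugate of a
  strongly convex function and the duality step are all applications of it.
\<close>

section \<open>Proximal points in a complete subspace\<close>

lemma eventually_lsc_on:
  assumes "lsc_on S \<phi>" "p \<in> S" "\<And>n. y n \<in> S" "y \<longlonglongrightarrow> p" "a < \<phi> p"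
  shows "\<forall>\<^sub>F n in sequentially. a < \<phi> (y n)"
proof -
  have "\<forall>\<^sub>F w in at p within S. a < \<phi> w"
    using assms(1,2,5) unfolding lsc_on_def le_Liminf_iff by blast
  then have "\<forall>\<^sub>F w in nhds p. w \<noteq> p \<longrightarrow> w \<in> S \<longrightarrow> a < \<phi> w"
    unfolding eventually_at_filter .
  then have "\<forall>\<^sub>F n in sequentially. y n \<noteq> p \<longrightarrow> y n \<in> S \<longrightarrow> a < \<phi> (y n)"
    using assms(4) filterlim_iff by blast
  then show ?thesis
    by (rule eventually_mono) (use assms in auto)
qed

lemma lsc_onI:
  assumes "\<And>p a. p \<in> S \<Longrightarrow> a < \<phi> p \<Longrightarrow> \<forall>\<^sub>F w in nhds p. w \<in> S \<longrightarrow> a < \<phi> w"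
  shows "lsc_on S \<phi>"
  unfolding lsc_on_def le_Liminf_iff eventually_at_filter
proof (intro ballI allI impI)
  fix p a assume "p \<in> S" "a < \<phi> p"
  from assms[OF this] show "\<forall>\<^sub>F w in nhds p. w \<noteq> p \<longrightarrow> w \<in> S \<longrightarrow> a < \<phi> w"
    by (rule eventually_mono) simp
qed

text \<open>
  A lower bound that is linear in the norm is dominated by every positive quadratic term. It holds
  for affine functions and also for Lipschitz functions, so that no subgradient has to be known
  before a proximal point is constructed.
\<close>

definition norm_minorized_on :: "'a::real_normed_vector set \<Rightarrow> ('a \<Rightarrow> ereal) \<Rightarrow> bool" where
  "norm_minorized_on S \<phi> \<longleftrightarrow> (\<exists>c K. \<forall>y\<in>S. ereal (- c - K * norm y) \<le> \<phi> y)"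

lemma norm_diff_midpoint:
  fixes a b x :: "'a::real_inner"
  shows "(norm ((1/2) *\<^sub>R a + (1/2) *\<^sub>R b - x))\<^sup>2
       = ((norm (a - x))\<^sup>2 + (norm (b - x))\<^sup>2) / 2 - (norm (a - b))\<^sup>2 / 4"
  unfolding power2_norm_eq_inner
  by (simp add: inner_simps inner_commute field_simps)

text \<open>
  A minimizing sequence is Cauchy because the quadratic term gains a fixed multiple of
  \<open>\<parallel>y\<^sub>n - y\<^sub>k\<parallel>\<^sup>2\<close> at midpoints; lower semicontinuity makes its limit a minimizer. No weak
  compactness enters.
\<close>

lemma prox_objective_has_minimizer:
  fixes S :: "'a::real_inner set"
  assumes S: "hilbert_subspace S" and \<phi>: "\<phi> \<in> Gamma_on S" and mi: "norm_minorized_on S \<phi>"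
    and s: "0 < s"
  obtains p where "p \<in> S" "\<bar>\<phi> p\<bar> \<noteq> \<infinity>"
    "\<And>y. y \<in> S \<Longrightarrow> \<phi> p + ereal (s * (norm (p - x))\<^sup>2) \<le> \<phi> y + ereal (s * (norm (y - x))\<^sup>2)"
proof -
  have sub: "subspace S" and cpl: "complete S"
    using S by (auto simp: hilbert_subspace_def)
  have proper: "\<And>y. y \<in> S \<Longrightarrow> \<phi> y \<noteq> -\<infinity>" and conv: "econvex_on S \<phi>" and lsc: "lsc_on S \<phi>"
    using \<phi> by (auto simp: Gamma_on_def proper_on_def)
  obtain y0 where y0: "y0 \<in> S" "\<phi> y0 < \<infinity>"
    using \<phi> by (auto simp: Gamma_on_def proper_on_def)
  obtain c K0 where cK0: "\<And>y. y \<in> S \<Longrightarrow> ereal (- c - K0 * norm y) \<le> \<phi> y"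
    using mi by (auto simp: norm_minorized_on_def)
  define K where "K = \<bar>K0\<bar>"
  define q where "q y = \<phi> y + ereal (s * (norm (y - x))\<^sup>2)" for y
  define B where "B = - c - K * norm x - K\<^sup>2 / (4 * s)"
  have B_le: "ereal B \<le> q y" if "y \<in> S" for y
  proof -
    define d where "d = norm (y - x)"
    have "norm y \<le> norm x + d"
      unfolding d_def using norm_triangle_sub[of y x] by simp
    moreover have "K0 * norm y \<le> K * norm y"
      unfolding K_def by (simp add: mult_right_mono)
    ultimately have 1: "K0 * norm y \<le> K * norm x + K * d"
      using mult_left_mono[of "norm y" "norm x + d" K] by (simp add: K_def distrib_left)
    have "0 \<le> (2 * s * d - K)\<^sup>2 / (4 * s)"
      using s by simp
    also have "\<dots> = s * d\<^sup>2 - K * d + K\<^sup>2 / (4 * s)"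
      using s by (simp add: power2_eq_square field_simps)
    finally have "B \<le> - c - K0 * norm y + s * d\<^sup>2"
      using 1 unfolding B_def by linarith
    then have "ereal B \<le> ereal (- c - K0 * norm y) + ereal (s * d\<^sup>2)"
      by simp
    also have "\<dots> \<le> q y"
      unfolding q_def d_def using cK0[OF that] by (rule add_right_mono)
    finally show ?thesis .
  qed
  define I where "I = (INF y\<in>S. q y)"
  have "ereal B \<le> I"
    unfolding I_def by (rule INF_greatest) (rule B_le)
  moreover have "I < \<infinity>"
  proof -
    have "I \<le> q y0" unfolding I_def using y0 by (intro INF_lower) auto
    also have "q y0 < \<infinity>" unfolding q_def using y0 by auto
    finally show ?thesis .
  qed
  ultimately obtain i where i: "I = ereal i"
    by (cases I) auto
  have i_le: "ereal i \<le> q y" if "y \<in> S" for y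
    unfolding i[symmetric] I_def using that by (rule INF_lower)
  have "\<exists>y\<in>S. q y < ereal (i + 1 / real (Suc n))" for n
  proof -
    have "I < ereal (i + 1 / real (Suc n))" by (simp add: i)
    then show ?thesis unfolding I_def INF_less_iff .
  qed
  then obtain y where y: "\<And>n. y n \<in> S" "\<And>n. q (y n) < ereal (i + 1 / real (Suc n))"
    by metis
  define a where "a n = real_of_ereal (\<phi> (y n))" for n
  have a: "\<phi> (y n) = ereal (a n)" for n
  proof -
    have "\<phi> (y n) \<noteq> \<infinity>" using y(2)[of n] by (auto simp: q_def)
    with proper[OF y(1)] show ?thesis unfolding a_def by (cases "\<phi> (y n)") auto
  qed
  have a_less: "a n + s * (norm (y n - x))\<^sup>2 < i + 1 / real (Suc n)" for n
    using y(2)[of n] by (simp add: q_def a)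
  have gap: "s * (norm (y n - y k))\<^sup>2 \<le> 2 * (1 / real (Suc n) + 1 / real (Suc k))" for n k
  proof -
    define w where "w = (1/2) *\<^sub>R y n + (1/2) *\<^sub>R y k"
    have w: "w \<in> S"
      unfolding w_def using sub y(1) by (simp add: subspace_add subspace_scale)
    have "\<phi> w \<le> ereal (1/2) * \<phi> (y n) + ereal (1 - 1/2) * \<phi> (y k)"
      using conv[unfolded econvex_on_def, rule_format, of "y n" "y k" "1/2"] y(1)
      unfolding w_def by simp
    then have "\<phi> w \<le> ereal ((a n + a k) / 2)"
      by (simp add: a field_simps)
    then have "q w \<le> ereal ((a n + a k) / 2 + s * (norm (w - x))\<^sup>2)"
      unfolding q_def by (metis add_right_mono plus_ereal.simps(1))
    then have "i \<le> (a n + a k) / 2 + s * (norm (w - x))\<^sup>2"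
      using i_le[OF w] order_trans by fastforce
    also have "(norm (w - x))\<^sup>2
        = ((norm (y n - x))\<^sup>2 + (norm (y k - x))\<^sup>2) / 2 - (norm (y n - y k))\<^sup>2 / 4"
      unfolding w_def by (rule norm_diff_midpoint)
    finally have "4 * i \<le> 2 * (a n + s * (norm (y n - x))\<^sup>2) + 2 * (a k + s * (norm (y k - x))\<^sup>2)
        - s * (norm (y n - y k))\<^sup>2"
      by (simp add: field_simps)
    then show ?thesis using a_less[of n] a_less[of k] by simp
  qed
  have "Cauchy y"
  proof (rule metric_CauchyI)
    fix e :: real assume e: "0 < e"
    obtain M where M: "inverse (real (Suc M)) < s * e\<^sup>2 / 4"
      using reals_Archimedean[of "s * e\<^sup>2 / 4"] s e by auto
    have "dist (y n) (y k) < e" if "n \<ge> M" "k \<ge> M" for n k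
    proof -
      have "1 / real (Suc n) \<le> inverse (real (Suc M))" "1 / real (Suc k) \<le> inverse (real (Suc M))"
        using that by (auto simp: divide_inverse intro!: le_imp_inverse_le)
      then have "2 * (1 / real (Suc n) + 1 / real (Suc k)) \<le> 2 * (inverse (real (Suc M)) + inverse (real (Suc M)))"
        by (intro mult_left_mono add_mono) auto
      also have "\<dots> < s * e\<^sup>2" using M by simp
      finally have "s * (norm (y n - y k))\<^sup>2 < s * e\<^sup>2"
        using gap[of n k] by linarith
      then have "(norm (y n - y k))\<^sup>2 < e\<^sup>2" using s by simp
      then show ?thesis using e by (simp add: dist_norm power_less_imp_less_base)
    qed
    then show "\<exists>M. \<forall>n\<ge>M. \<forall>k\<ge>M. dist (y n) (y k) < e" by blast
  qed
  then obtain p where p: "p \<in> S" "y \<longlonglongrightarrow> p"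
    using cpl y(1) unfolding complete_def by blast
  have lim: "(\<lambda>n. i + 1 / real (Suc n) - s * (norm (y n - x))\<^sup>2) \<longlonglongrightarrow> i + 0 - s * (norm (p - x))\<^sup>2"
    by (intro tendsto_intros p LIMSEQ_Suc[OF lim_1_over_n])
  have "\<phi> p \<le> ereal (i - s * (norm (p - x))\<^sup>2)"
  proof (rule ccontr)
    assume "\<not> ?thesis"
    then obtain b where b: "i - s * (norm (p - x))\<^sup>2 < b" "ereal b < \<phi> p"
      using ereal_dense2[of "ereal (i - s * (norm (p - x))\<^sup>2)" "\<phi> p"] by (auto simp: not_le)
    have "\<forall>\<^sub>F n in sequentially. ereal b < \<phi> (y n)"
      by (rule eventually_lsc_on[OF lsc p(1) y(1) p(2) b(2)])
    then have "\<forall>\<^sub>F n in sequentially. b \<le> i + 1 / real (Suc n) - s * (norm (y n - x))\<^sup>2"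
    proof (rule eventually_mono)
      fix n assume "ereal b < \<phi> (y n)"
      then have "b < a n" by (simp add: a)
      then show "b \<le> i + 1 / real (Suc n) - s * (norm (y n - x))\<^sup>2" using a_less[of n] by linarith
    qed
    then have "b \<le> i + 0 - s * (norm (p - x))\<^sup>2"
      using tendsto_lowerbound[OF lim] by simp
    with b(1) show False by simp
  qed
  then have "q p \<le> ereal (i - s * (norm (p - x))\<^sup>2) + ereal (s * (norm (p - x))\<^sup>2)"
    unfolding q_def by (rule add_right_mono)
  then have qp: "q p \<le> ereal i" by simp
  show thesis
  proof (rule that[OF p(1)])
    show "\<bar>\<phi> p\<bar> \<noteq> \<infinity>" using proper[OF p(1)] qp by (cases "\<phi> p") (auto simp: q_def)
    show "\<phi> p + ereal (s * (norm (p - x))\<^sup>2) \<le> \<phi> w + ereal (s * (norm (w - x))\<^sup>2)" if "w \<in> S" for w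
      using order_trans[OF qp i_le[OF that]] by (simp add: q_def)
  qed
qed

lemma nonneg_if_affine_nonneg_near_0:
  fixes \<alpha> \<kappa> :: real
  assumes "\<And>t. 0 < t \<Longrightarrow> t < 1 \<Longrightarrow> 0 \<le> \<alpha> + t * \<kappa>"
  shows "0 \<le> \<alpha>"
proof -
  have "((\<lambda>t. \<alpha> + t * \<kappa>) \<longlongrightarrow> \<alpha> + 0 * \<kappa>) (at_right 0)"
    by (intro tendsto_intros)
  moreover have "\<forall>\<^sub>F t in at_right 0. 0 \<le> \<alpha> + t * \<kappa>"
    unfolding eventually_at_right_field by (rule exI[of _ 1]) (use assms in auto)
  ultimately have "0 \<le> \<alpha> + 0 * \<kappa>"
    by (intro tendsto_lowerbound) auto
  then show ?thesis by simp
qed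

text \<open>
  Fermat's rule. On the segment from \<open>p\<close> to \<open>y\<close> convexity bounds \<open>\<phi>\<close> linearly in the parameter \<open>t\<close>, and
  the quadratic differs from its linearization at \<open>p\<close> only by a term of order \<open>t\<^sup>2\<close>.
\<close>

lemma minimizer_plus_quadratic_imp_subgradient:
  fixes S :: "'a::real_inner set"
  assumes sub: "subspace S" and conv: "econvex_on S \<phi>" and p: "p \<in> S" "\<bar>\<phi> p\<bar> \<noteq> \<infinity>"
    and min: "\<And>y. y \<in> S \<Longrightarrow>
      \<phi> p + ereal (c / 2 * (norm (p - x))\<^sup>2) \<le> \<phi> y + ereal (c / 2 * (norm (y - x))\<^sup>2)"
    and y: "y \<in> S"
  shows "\<phi> p + ereal (c * inner (x - p) (y - p)) \<le> \<phi> y"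
proof -
  obtain a where a: "\<phi> p = ereal a" using p by auto
  show ?thesis
  proof (cases "\<phi> y")
    case (real b)
    have "0 \<le> (b - a - c * inner (x - p) (y - p)) + t * (c / 2 * (norm (y - p))\<^sup>2)"
      if t: "0 < t" "t < 1" for t
    proof -
      define w where "w = t *\<^sub>R y + (1 - t) *\<^sub>R p"
      have w: "w \<in> S" unfolding w_def using sub y p by (simp add: subspace_add subspace_scale)
      have "\<phi> w \<le> ereal t * \<phi> y + ereal (1 - t) * \<phi> p"
        using conv y p t unfolding econvex_on_def w_def by blast
      then have "\<phi> w \<le> ereal (t * b + (1 - t) * a)" by (simp add: a real)
      then have "\<phi> w + ereal (c / 2 * (norm (w - x))\<^sup>2)
          \<le> ereal (t * b + (1 - t) * a + c / 2 * (norm (w - x))\<^sup>2)"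
        by (metis add_right_mono plus_ereal.simps(1))
      from order_trans[OF min[OF w] this]
      have 1: "a + c / 2 * (norm (p - x))\<^sup>2 \<le> t * b + (1 - t) * a + c / 2 * (norm (w - x))\<^sup>2"
        by (simp add: a)
      have "(norm (w - x))\<^sup>2 = (norm (p - x))\<^sup>2 - 2 * t * inner (x - p) (y - p) + t\<^sup>2 * (norm (y - p))\<^sup>2"
        unfolding w_def power2_norm_eq_inner
        by (simp add: inner_simps inner_commute power2_eq_square algebra_simps)
      then have "c / 2 * (norm (w - x))\<^sup>2 = c / 2 * (norm (p - x))\<^sup>2
          - t * (c * inner (x - p) (y - p)) + t * (t * (c / 2 * (norm (y - p))\<^sup>2))"
        by (simp only:) (simp add: field_simps power2_eq_square)
      with 1 have "0 \<le> t * ((b - a - c * inner (x - p) (y - p)) + t * (c / 2 * (norm (y - p))\<^sup>2))"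
        by (simp add: algebra_simps)
      then show ?thesis using t by (simp add: zero_le_mult_iff)
    qed
    from nonneg_if_affine_nonneg_near_0[OF this] show ?thesis by (simp add: a real)
  next
    case MInf
    then show ?thesis using min[OF y] by (simp add: a)
  qed simp
qed

text \<open>
  The subgradient inequality leaves a margin of \<open>\<parallel>y - p\<parallel>\<^sup>2 / (2 \<gamma>)\<close> in the proximal objective, so \<open>p\<close>
  is its only minimizer and the definite description is determined.
\<close>

lemma subdiff_imp_prox_on:
  fixes S :: "'a::real_inner set"
  assumes \<gamma>: "0 < \<gamma>" and sd: "(1 / \<gamma>) *\<^sub>R (x - p) \<in> subdiff_on S \<phi> p"
  shows "prox_on S \<gamma> \<phi> x = p"
proof -
  have p: "p \<in> S" using sd by (simp add: subdiff_on_def)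
  obtain a where a: "\<phi> p = ereal a" using sd by (auto simp: subdiff_on_def)
  define q where "q y = \<phi> y + ereal (1 / (2 * \<gamma>) * (norm (y - x))\<^sup>2)" for y
  have strict: "q p < q y" if y: "y \<in> S" "y \<noteq> p" for y
  proof -
    have "ereal (a + inner ((1 / \<gamma>) *\<^sub>R (x - p)) (y - p)) \<le> \<phi> y"
      using sd y unfolding subdiff_on_def by (simp add: a)
    then have 1: "ereal (a + inner ((1 / \<gamma>) *\<^sub>R (x - p)) (y - p) + 1 / (2 * \<gamma>) * (norm (y - x))\<^sup>2) \<le> q y"
      unfolding q_def by (metis add_right_mono plus_ereal.simps(1))
    have "(norm (y - x))\<^sup>2 = (norm (p - x))\<^sup>2 - 2 * inner (x - p) (y - p) + (norm (y - p))\<^sup>2"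
      unfolding power2_norm_eq_inner by (simp add: inner_simps inner_commute algebra_simps)
    then have "a + inner ((1 / \<gamma>) *\<^sub>R (x - p)) (y - p) + 1 / (2 * \<gamma>) * (norm (y - x))\<^sup>2
        = a + 1 / (2 * \<gamma>) * (norm (p - x))\<^sup>2 + 1 / (2 * \<gamma>) * (norm (y - p))\<^sup>2"
      using \<gamma> by (simp only: inner_scaleR_left) (simp add: field_simps)
    moreover have "0 < 1 / (2 * \<gamma>) * (norm (y - p))\<^sup>2" using \<gamma> y by simp
    ultimately have "q p < ereal (a + inner ((1 / \<gamma>) *\<^sub>R (x - p)) (y - p) + 1 / (2 * \<gamma>) * (norm (y - x))\<^sup>2)"
      by (simp add: q_def a)
    with 1 show ?thesis by (rule less_le_trans[rotated])
  qed
  show ?thesis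
    unfolding prox_on_def q_def[symmetric]
  proof (rule the_equality)
    show "is_arg_min q (\<lambda>y. y \<in> S) p"
      unfolding is_arg_min_def using p strict by (metis less_asym less_irrefl)
    show "y = p" if "is_arg_min q (\<lambda>y. y \<in> S) y" for y
      using that strict p unfolding is_arg_min_def by blast
  qed
qed

lemma prox_on_subdiff:
  fixes S :: "'a::real_inner set"
  assumes S: "hilbert_subspace S" and \<phi>: "\<phi> \<in> Gamma_on S" and mi: "norm_minorized_on S \<phi>"
    and \<gamma>: "0 < \<gamma>" and x: "x \<in> S"
  shows "(1 / \<gamma>) *\<^sub>R (x - prox_on S \<gamma> \<phi> x) \<in> subdiff_on S \<phi> (prox_on S \<gamma> \<phi> x)"
proof -
  have sub: "subspace S" using S by (simp add: hilbert_subspace_def)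
  have conv: "econvex_on S \<phi>" using \<phi> by (simp add: Gamma_on_def)
  obtain p where p: "p \<in> S" "\<bar>\<phi> p\<bar> \<noteq> \<infinity>" and
    min: "\<And>y. y \<in> S \<Longrightarrow> \<phi> p + ereal ((1 / \<gamma>) / 2 * (norm (p - x))\<^sup>2)
        \<le> \<phi> y + ereal ((1 / \<gamma>) / 2 * (norm (y - x))\<^sup>2)"
    using prox_objective_has_minimizer[OF S \<phi> mi, of "(1 / \<gamma>) / 2" x] \<gamma> by auto
  have "(1 / \<gamma>) *\<^sub>R (x - p) \<in> subdiff_on S \<phi> p"
    unfolding subdiff_on_def
    using minimizer_plus_quadratic_imp_subgradient[OF sub conv p min] p x sub
    by (auto simp: subspace_diff subspace_scale)
  with subdiff_imp_prox_on[OF \<gamma> this] show ?thesis by simp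
qed

lemma subdiff_on_memD:
  assumes "u \<in> subdiff_on S \<phi> p"
  shows "p \<in> S" "u \<in> S" "\<bar>\<phi> p\<bar> \<noteq> \<infinity>"
  using assms by (auto simp: subdiff_on_def)

lemma subdiff_on_monotone:
  assumes "u \<in> subdiff_on S \<phi> p" "w \<in> subdiff_on S \<phi> q"
  shows "0 \<le> inner (u - w) (p - q)"
proof -
  obtain a b where ab: "\<phi> p = ereal a" "\<phi> q = ereal b"
    using assms by (auto simp: subdiff_on_def)
  have "\<phi> p + ereal (inner u (q - p)) \<le> \<phi> q" "\<phi> q + ereal (inner w (p - q)) \<le> \<phi> p"
    using assms by (auto simp: subdiff_on_def)
  then show ?thesis by (simp add: ab inner_simps)
qed

lemma subdiff_on_imp_norm_minorized:
  assumes "u \<in> subdiff_on S \<phi> p"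
  shows "norm_minorized_on S \<phi>"
proof -
  obtain a where a: "\<phi> p = ereal a" using assms by (auto simp: subdiff_on_def)
  have "ereal (- (inner u p - a) - norm u * norm y) \<le> \<phi> y" if "y \<in> S" for y
  proof -
    have "- (norm u * norm y) \<le> inner u y"
      using Cauchy_Schwarz_ineq2[of u y] by linarith
    then have "ereal (- (inner u p - a) - norm u * norm y) \<le> \<phi> p + ereal (inner u (y - p))"
      by (simp add: a inner_simps)
    also have "\<dots> \<le> \<phi> y" using assms that by (simp add: subdiff_on_def)
    finally show ?thesis .
  qed
  then show ?thesis unfolding norm_minorized_on_def by blast
qed

section \<open>Conjugates and subgradients\<close>

lemma conjugate_on_ge: "y \<in> S \<Longrightarrow> ereal (inner p y) - g y \<le> conjugate_on S g p"
  unfolding conjugate_on_def by (rule SUP_upper)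

lemma conjugate_on_le:
  "(\<And>y. y \<in> S \<Longrightarrow> ereal (inner p y) - g y \<le> c) \<Longrightarrow> conjugate_on S g p \<le> c"
  unfolding conjugate_on_def by (rule SUP_least)

lemma conjugate_on_eq:
  assumes "u \<in> subdiff_on S g y"
  shows "conjugate_on S g u = ereal (inner u y) - g y"
proof (rule antisym)
  obtain b where b: "g y = ereal b" using assms by (auto simp: subdiff_on_def)
  show "conjugate_on S g u \<le> ereal (inner u y) - g y"
  proof (rule conjugate_on_le)
    fix w assume "w \<in> S"
    then have "ereal (b + inner u (w - y)) \<le> g w" using assms by (simp add: subdiff_on_def b)
    then show "ereal (inner u w) - g w \<le> ereal (inner u y) - g y"
      by (cases "g w") (auto simp: b inner_simps)
  qed
  show "ereal (inner u y) - g y \<le> conjugate_on S g u"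
    using assms by (intro conjugate_on_ge) (simp add: subdiff_on_def)
qed

lemma subdiff_on_conjugate:
  assumes "u \<in> subdiff_on S g y"
  shows "y \<in> subdiff_on S (conjugate_on S g) u"
proof -
  obtain b where b: "g y = ereal b" using assms by (auto simp: subdiff_on_def)
  have yS: "y \<in> S" "u \<in> S" using assms by (auto simp: subdiff_on_def)
  have "ereal (inner u y - b) + ereal (inner y (w - u)) \<le> conjugate_on S g w" for w
    using conjugate_on_ge[OF yS(1), of w g] by (simp add: b inner_simps inner_commute)
  then show ?thesis
    unfolding subdiff_on_def using conjugate_on_eq[OF assms] yS by (simp add: b)
qed

lemma conjugate_on_Gamma:
  fixes S :: "'a::real_inner set"
  assumes g: "proper_on S g" and u: "u \<in> subdiff_on S g y"
  shows "conjugate_on S g \<in> Gamma_on S"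
proof -
  obtain b where b: "g y = ereal b" using u by (auto simp: subdiff_on_def)
  have yS: "y \<in> S" "u \<in> S" using u by (auto simp: subdiff_on_def)
  have nm: "conjugate_on S g p \<noteq> -\<infinity>" for p
    using conjugate_on_ge[OF yS(1), of p g] by (auto simp: b)
  have "econvex_on S (conjugate_on S g)"
    unfolding econvex_on_def
  proof (intro ballI allI impI, rule conjugate_on_le)
    fix p q w and t :: real assume t: "0 < t \<and> t < 1" and w: "w \<in> S"
    have "ereal (inner p w) - g w \<le> conjugate_on S g p" "ereal (inner q w) - g w \<le> conjugate_on S g q"
      using w by (auto intro: conjugate_on_ge)
    moreover have "g w \<noteq> -\<infinity>" using g w by (auto simp: proper_on_def)
    ultimately show "ereal (inner (t *\<^sub>R p + (1 - t) *\<^sub>R q) w) - g w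
        \<le> ereal t * conjugate_on S g p + ereal (1 - t) * conjugate_on S g q"
    proof (cases "g w")
      case (real d)
      show ?thesis
      proof (cases "conjugate_on S g p = \<infinity> \<or> conjugate_on S g q = \<infinity>")
        case True
        with nm[of p] nm[of q] t
        have "ereal t * conjugate_on S g p + ereal (1 - t) * conjugate_on S g q = \<infinity>"
          by (cases "conjugate_on S g p"; cases "conjugate_on S g q") auto
        then show ?thesis by (simp only: ereal_less_eq(1))
      next
        case False
        with nm[of p] nm[of q] obtain a c where ac: "conjugate_on S g p = ereal a" "conjugate_on S g q = ereal c"
          by (cases "conjugate_on S g p"; cases "conjugate_on S g q") auto
        have "inner p w - d \<le> a" "inner q w - d \<le> c"
          using conjugate_on_ge[OF w, of p g] conjugate_on_ge[OF w, of q g] by (auto simp: real ac)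
        then have "t * (inner p w - d) + (1 - t) * (inner q w - d) \<le> t * a + (1 - t) * c"
          using t by (intro add_mono mult_left_mono) auto
        then show ?thesis by (simp add: real ac inner_simps algebra_simps)
      qed
    qed auto
  qed
  moreover have "lsc_on S (conjugate_on S g)"
  proof (rule lsc_onI)
    fix p and a :: ereal assume "p \<in> S" and a: "a < conjugate_on S g p"
    then obtain w where w: "w \<in> S" "a < ereal (inner p w) - g w"
      unfolding conjugate_on_def less_SUP_iff by blast
    have "((\<lambda>q. ereal (inner q w) - g w) \<longlongrightarrow> ereal (inner p w) - g w) (nhds p)"
    proof (cases "g w")
      case (real d)
      have "((\<lambda>q. ereal (inner q w - d)) \<longlongrightarrow> ereal (inner p w - d)) (nhds p)"
        by (intro tendsto_intros lim_ereal[THEN iffD2] filterlim_ident)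
      then show ?thesis by (simp add: real)
    qed auto
    from order_tendstoD(1)[OF this w(2)]
    show "\<forall>\<^sub>F q in nhds p. q \<in> S \<longrightarrow> a < conjugate_on S g q"
      by (rule eventually_mono) (use conjugate_on_ge[OF w(1)] less_le_trans in blast)
  qed
  moreover have "proper_on S (conjugate_on S g)"
    unfolding proper_on_def using nm yS conjugate_on_eq[OF u] by (auto simp: b intro!: bexI[of _ u])
  ultimately show ?thesis by (simp add: Gamma_on_def)
qed

text \<open>
  Along the ray through \<open>w\<close>, the linear functional grows at rate \<open>\<parallel>w\<parallel>\<^sup>2\<close> and \<open>g\<close> at rate at most
  \<open>K \<parallel>w\<parallel>\<close>.
\<close>

lemma norm_le_Lipschitz_const_if_dom_conjugate:
  fixes S :: "'a::real_inner set"
  assumes S: "subspace S" and K: "K-lipschitz_on S (\<lambda>x. real_of_ereal (g x))"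
    and fin: "\<And>x. x \<in> S \<Longrightarrow> \<bar>g x\<bar> \<noteq> \<infinity>" and w: "w \<in> dom_on S (conjugate_on S g)"
  shows "norm w \<le> K"
proof (rule ccontr)
  assume "\<not> norm w \<le> K"
  then have big: "K < norm w" by simp
  have K0: "0 \<le> K" using K by (rule lipschitz_on_nonneg)
  have wS: "w \<in> S" and lt: "conjugate_on S g w < \<infinity>" using w by (auto simp: dom_on_def)
  have zS: "0 \<in> S" using S by (rule subspace_0)
  define \<rho> where "\<rho> = (\<lambda>x. real_of_ereal (g x))"
  have \<rho>: "g x = ereal (\<rho> x)" if "x \<in> S" for x using fin[OF that] by (simp add: \<rho>_def ereal_real)
  have "conjugate_on S g w \<noteq> -\<infinity>"
    using conjugate_on_ge[OF zS, of w g] by (auto simp: \<rho>[OF zS])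
  with lt obtain c where c: "conjugate_on S g w = ereal c" by (cases "conjugate_on S g w") auto
  define e where "e = norm w * (norm w - K)"
  have e: "0 < e" unfolding e_def using big K0 by (intro mult_pos_pos) auto
  have bound: "t * e \<le> c + \<rho> 0" if "0 \<le> t" for t
  proof -
    have tS: "t *\<^sub>R w \<in> S" using S wS by (rule subspace_scale)
    have "inner w (t *\<^sub>R w) - \<rho> (t *\<^sub>R w) \<le> c"
      using conjugate_on_ge[OF tS, of w g] by (simp add: \<rho>[OF tS] c)
    moreover have "\<rho> (t *\<^sub>R w) - \<rho> 0 \<le> K * norm (t *\<^sub>R w)"
      using lipschitz_onD[OF K tS zS] by (simp add: \<rho>_def dist_real_def)
    ultimately show ?thesis
      using that by (simp add: e_def power2_norm_eq_inner[symmetric] algebra_simps power2_eq_square)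
  qed
  have "0 \<le> c + \<rho> 0" using bound[of 0] by simp
  then have "((c + \<rho> 0 + 1) / e) * e \<le> c + \<rho> 0" using e by (intro bound) simp
  then show False using e by simp
qed

section \<open>Gradients\<close>

text \<open>
  Derivatives within a subspace are unique: two candidates \<open>D, E \<in> S\<close> are compared on the line in
  direction \<open>E - D\<close>, which stays in \<open>S\<close>.
\<close>

lemma gradient_on_eqI:
  fixes S :: "'a::real_inner set"
  assumes S: "subspace S" and x: "x \<in> S" and D: "D \<in> S"
    and der: "(\<phi> has_derivative (\<lambda>k. inner k D)) (at x within S)"
  shows "gradient_on S \<phi> x = D"
  unfolding gradient_on_def
proof (rule the_equality)
  show "E = D" if "E \<in> S \<and> (\<phi> has_derivative (\<lambda>k. inner k E)) (at x within S)" for E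
  proof -
    define d where "d = E - D"
    have d: "d \<in> S" unfolding d_def using S D that by (simp add: subspace_diff)
    have line: "((\<lambda>t. \<phi> (x + t *\<^sub>R d)) has_derivative (\<lambda>t. inner (t *\<^sub>R d) F)) (at (0::real))"
      if F: "(\<phi> has_derivative (\<lambda>k. inner k F)) (at x within S)" for F
    proof (rule has_derivative_in_compose[where g=\<phi> and f="\<lambda>t. x + t *\<^sub>R d"])
      show "((\<lambda>t. x + t *\<^sub>R d) has_derivative (\<lambda>t. t *\<^sub>R d)) (at 0)"
        by (auto intro!: derivative_eq_intros)
      have "range (\<lambda>t. x + t *\<^sub>R d) \<subseteq> S" using S x d by (auto simp: subspace_add subspace_scale)
      then show "(\<phi> has_derivative (\<lambda>k. inner k F)) (at (x + 0 *\<^sub>R d) within range (\<lambda>t. x + t *\<^sub>R d))"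
        using F by (simp add: has_derivative_subset)
    qed
    have "(\<lambda>t. inner (t *\<^sub>R d) E) = (\<lambda>t::real. inner (t *\<^sub>R d) D)"
      using has_derivative_unique[OF line line] that der by blast
    then have "inner d E = inner d D" by (metis scaleR_one)
    then have "inner d d = 0" by (simp add: d_def inner_simps)
    then show ?thesis by (simp add: d_def)
  qed
qed (use assms in auto)

text \<open>
  The Riesz representation theorem: the representing vector of \<open>\<phi>\<close> is the minimizer of
  \<open>y \<mapsto> \<parallel>y\<parallel>\<^sup>2 / 2 - \<phi> y\<close>.
\<close>

lemma riesz_representation:
  fixes \<phi> :: "'a::{real_inner, complete_space} \<Rightarrow> real"
  assumes "bounded_linear \<phi>"
  obtains D where "\<And>k. \<phi> k = inner k D"
proof -
  interpret bounded_linear \<phi> by fact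
  define q where "q = (\<lambda>y. ereal (- \<phi> y))"
  have UN: "hilbert_subspace (UNIV :: 'a set)"
    by (simp add: hilbert_subspace_def complete_UNIV)
  have conv: "econvex_on UNIV q"
    by (auto simp: econvex_on_def q_def add diff scaleR algebra_simps)
  have "lsc_on UNIV q"
  proof (rule lsc_onI)
    fix p :: 'a and a assume a: "a < q p"
    have "(q \<longlongrightarrow> q p) (nhds p)"
      unfolding q_def by (intro lim_ereal[THEN iffD2] tendsto_intros tendsto filterlim_ident)
    from order_tendstoD(1)[OF this a] show "\<forall>\<^sub>F w in nhds p. w \<in> UNIV \<longrightarrow> a < q w" by simp
  qed
  then have G: "q \<in> Gamma_on UNIV"
    using conv by (simp add: Gamma_on_def proper_on_def q_def)
  have m: "norm_minorized_on UNIV q"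
  proof -
    have "- 0 - onorm \<phi> * norm y \<le> - \<phi> y" for y
      using onorm[OF assms, of y] by simp
    then show ?thesis unfolding norm_minorized_on_def q_def by (metis ereal_less_eq(3))
  qed
  obtain p where fin: "\<bar>q p\<bar> \<noteq> \<infinity>" and
    min: "\<And>y. y \<in> UNIV \<Longrightarrow> q p + ereal (1 / 2 * (norm (p - 0))\<^sup>2) \<le> q y + ereal (1 / 2 * (norm (y - 0))\<^sup>2)"
    using prox_objective_has_minimizer[OF UN G m, of "1/2" 0] by auto
  have le: "\<phi> (y - p) \<le> inner p (y - p)" for y
    using minimizer_plus_quadratic_imp_subgradient[OF subspace_UNIV conv UNIV_I fin min UNIV_I, of y]
    by (simp add: q_def diff inner_simps)
  have le': "\<phi> k \<le> inner p k" for k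
    using le[of "p + k"] by simp
  have "\<phi> k = inner k p" for k
    using le'[of k] le'[of "- k"] by (simp add: neg inner_commute)
  then show thesis by (rule that)
qed

lemma inner_adjoint:
  fixes A :: "'a::{real_inner, complete_space} \<Rightarrow> 'b::real_inner"
  assumes "bounded_linear A"
  shows "inner x (adjoint A y) = inner (A x) y"
proof -
  have "\<exists>D. \<forall>x. inner (A x) y = inner x D" for y
    by (metis riesz_representation[OF bounded_linear_compose[OF bounded_linear_inner_left[of y] assms]])
  then have "\<exists>B. \<forall>x y. inner (A x) y = inner x (B y)" by metis
  from someI_ex[OF this] show ?thesis unfolding adjoint_def by metis
qed

lemma has_derivative_gradient_on_UNIV:
  fixes h :: "'a::{real_inner, complete_space} \<Rightarrow> real"
  assumes "h differentiable (at y)"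
  shows "(h has_derivative (\<lambda>k. inner k (gradient_on UNIV h y))) (at y)"
proof -
  obtain h' where h': "(h has_derivative h') (at y)"
    using assms unfolding differentiable_def by blast
  obtain D where "\<And>k. h' k = inner k D"
    using riesz_representation[OF has_derivative_bounded_linear[OF h']] by blast
  then have "(h has_derivative (\<lambda>k. inner k D)) (at y)" using h' by (metis (no_types, lifting) ext)
  with gradient_on_eqI[OF subspace_UNIV UNIV_I UNIV_I this] show ?thesis by simp
qed

lemma convex_above_gradient:
  fixes h :: "'a::{real_inner, complete_space} \<Rightarrow> real"
  assumes conv: "convex_on UNIV h" and diff: "h differentiable (at x)"
  shows "h x + inner (gradient_on UNIV h x) (y - x) \<le> h y"
proof -
  define \<rho> where "\<rho> = (\<lambda>t::real. h (x + t *\<^sub>R (y - x)))"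
  have "convex_on UNIV \<rho>"
  proof (rule convex_onI)
    fix t a b :: real assume t: "0 < t" "t < 1"
    have e: "x + ((1 - t) *\<^sub>R a + t *\<^sub>R b) *\<^sub>R (y - x)
        = (1 - t) *\<^sub>R (x + a *\<^sub>R (y - x)) + t *\<^sub>R (x + b *\<^sub>R (y - x))"
      by (simp add: algebra_simps)
    show "\<rho> ((1 - t) *\<^sub>R a + t *\<^sub>R b) \<le> (1 - t) * \<rho> a + t * \<rho> b"
      unfolding \<rho>_def e using convex_onD[OF conv] t by simp
  qed simp
  moreover have "(\<rho> has_derivative (\<lambda>t. inner (t *\<^sub>R (y - x)) (gradient_on UNIV h x))) (at 0)"
    unfolding \<rho>_def
    by (rule has_derivative_compose[where g=h and f="\<lambda>t. x + t *\<^sub>R (y - x)"])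
      (use has_derivative_gradient_on_UNIV[OF diff] in \<open>auto intro!: derivative_eq_intros\<close>)
  then have "(\<rho> has_field_derivative inner (gradient_on UNIV h x) (y - x)) (at 0)"
    unfolding has_field_derivative_def by (simp add: inner_commute mult.commute[of _ "inner _ _"])
  ultimately have "inner (gradient_on UNIV h x) (y - x) * (1 - 0) \<le> \<rho> 1 - \<rho> 0"
    by (intro convex_on_imp_above_tangent[where A=UNIV]) auto
  then show ?thesis by (simp add: \<rho>_def)
qed

text \<open>
  For a strongly convex \<open>l\<close> the relation \<open>v \<in> \<partial>l(y)\<close> says that \<open>y\<close> is a proximal point of the convex
  function \<open>k = l - c/2 \<parallel>\<cdot>\<parallel>\<^sup>2\<close>. Existence, uniqueness and Lipschitz dependence of \<open>y\<close> on \<open>v\<close> are thus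
  properties of resolvents of \<open>\<partial>k\<close>, and the map \<open>v \<mapsto> y\<close> is the gradient of \<open>l\<^sup>*\<close>.
\<close>

lemma subdiff_on_minus_quadratic:
  fixes S :: "'a::real_inner set"
  assumes S: "subspace S" and sc: "strongly_convex_on S c l"
    and v: "v \<in> subdiff_on S l p"
  shows "v - c *\<^sub>R p \<in> subdiff_on S (\<lambda>y. l y - ereal (c / 2 * (norm y)\<^sup>2)) p" (is "_ \<in> subdiff_on S ?k p")
proof (cases "c = 0")
  case True
  then show ?thesis using v by (simp add: zero_ereal_def[symmetric])
next
  case False
  obtain a where a: "l p = ereal a" using v by (auto simp: subdiff_on_def)
  have pS: "p \<in> S" "v \<in> S" using v by (auto simp: subdiff_on_def)
  have min: "?k p + ereal (c / 2 * (norm (p - (1 / c) *\<^sub>R v))\<^sup>2)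
      \<le> ?k y + ereal (c / 2 * (norm (y - (1 / c) *\<^sub>R v))\<^sup>2)" if y: "y \<in> S" for y
  proof -
    have sq: "c / 2 * (norm (w - (1 / c) *\<^sub>R v))\<^sup>2
        = c / 2 * (norm w)\<^sup>2 - inner v w + c / 2 * (norm ((1 / c) *\<^sub>R v))\<^sup>2" for w
      using False unfolding power2_norm_eq_inner
      by (simp add: inner_simps inner_commute field_simps)
    have "ereal (a + inner v (y - p)) \<le> l y" using v y by (simp add: subdiff_on_def a)
    then show ?thesis
      unfolding sq by (cases "l y") (auto simp: a inner_simps)
  qed
  have "?k p + ereal (c * inner ((1 / c) *\<^sub>R v - p) (y - p)) \<le> ?k y" if y: "y \<in> S" for y
    by (rule minimizer_plus_quadratic_imp_subgradient[OF S _ pS(1) _ min y])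
      (use sc in \<open>auto simp: strongly_convex_on_def a\<close>)
  moreover have "c * inner ((1 / c) *\<^sub>R v - p) w = inner (v - c *\<^sub>R p) w" for w
    using False by (simp add: inner_simps algebra_simps)
  ultimately show ?thesis
    unfolding subdiff_on_def using pS S by (auto simp: a subspace_diff subspace_scale)
qed

lemma subdiff_on_plus_quadratic:
  fixes S :: "'a::real_inner set"
  assumes S: "subspace S" and c: "0 \<le> c"
    and w: "w \<in> subdiff_on S (\<lambda>y. l y - ereal (c / 2 * (norm y)\<^sup>2)) p"
  shows "w + c *\<^sub>R p \<in> subdiff_on S l p"
proof -
  obtain a where a: "l p = ereal a" using w by (cases "l p") (auto simp: subdiff_on_def)
  have pS: "p \<in> S" "w \<in> S" using w by (auto simp: subdiff_on_def)
  have "ereal (a + inner (w + c *\<^sub>R p) (y - p)) \<le> l y" if y: "y \<in> S" for y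
  proof -
    have 1: "ereal (a - c / 2 * (norm p)\<^sup>2 + inner w (y - p)) \<le> l y - ereal (c / 2 * (norm y)\<^sup>2)"
      using w y by (simp add: subdiff_on_def a)
    have "0 \<le> c / 2 * (norm (y - p))\<^sup>2" using c by simp
    also have "(norm (y - p))\<^sup>2 = (norm y)\<^sup>2 - (norm p)\<^sup>2 - 2 * inner p (y - p)"
      unfolding power2_norm_eq_inner by (simp add: inner_simps inner_commute)
    finally have 2: "c * inner p (y - p) \<le> c / 2 * (norm y)\<^sup>2 - c / 2 * (norm p)\<^sup>2"
      by (simp add: field_simps)
    show ?thesis
    proof (cases "l y")
      case (real b)
      then have "a - c / 2 * (norm p)\<^sup>2 + inner w (y - p) \<le> b - c / 2 * (norm y)\<^sup>2"
        using 1 by simp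
      with 2 show ?thesis by (simp only: real ereal_less_eq(3) inner_add_left inner_scaleR_left)
    qed (use 1 in auto)
  qed
  then show ?thesis
    unfolding subdiff_on_def using pS S by (auto simp: a subspace_add subspace_scale)
qed

lemma minus_quadratic_in_Gamma:
  fixes S :: "'a::real_inner set"
  assumes l: "l \<in> Gamma_on S" and sc: "strongly_convex_on S c l"
  shows "(\<lambda>y. l y - ereal (c / 2 * (norm y)\<^sup>2)) \<in> Gamma_on S" (is "?k \<in> _")
proof -
  have proper: "proper_on S l" and lsc: "lsc_on S l" using l by (auto simp: Gamma_on_def)
  have "proper_on S ?k"
    unfolding proper_on_def
  proof (intro conjI ballI)
    show "?k y \<noteq> -\<infinity>" if "y \<in> S" for y
      using proper that by (cases "l y") (auto simp: proper_on_def)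
    obtain y where "y \<in> S" "l y < \<infinity>" using proper by (auto simp: proper_on_def)
    then show "\<exists>y\<in>S. ?k y < \<infinity>" by (intro bexI[of _ y]; cases "l y") auto
  qed
  moreover have "lsc_on S ?k"
  proof (rule lsc_onI)
    fix p and a :: ereal assume p: "p \<in> S" and a: "a < ?k p"
    define s where "s = (\<lambda>y::'a. c / 2 * (norm y)\<^sup>2)"
    obtain d where d: "a < ereal d" "ereal d < ?k p"
      using ereal_dense2[OF a] by auto
    have lp: "ereal (d + s p) < l p"
      using d(2) by (cases "l p") (auto simp: s_def)
    then obtain b where b: "ereal (d + s p) < ereal b" "ereal b < l p"
      using ereal_dense2[OF lp] by auto
    have "\<forall>\<^sub>F w in at p within S. ereal b < l w"
      using lsc p b(2) unfolding lsc_on_def le_Liminf_iff by blast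
    then have 1: "\<forall>\<^sub>F w in nhds p. w \<in> S \<longrightarrow> ereal b < l w"
      unfolding eventually_at_filter by (rule eventually_mono) (use b in auto)
    have "(s \<longlongrightarrow> s p) (nhds p)"
      unfolding s_def by (intro tendsto_intros filterlim_ident)
    then have 2: "\<forall>\<^sub>F w in nhds p. s w < b - d"
      by (rule order_tendstoD(2)) (use b in simp)
    from 1 2 show "\<forall>\<^sub>F w in nhds p. w \<in> S \<longrightarrow> a < ?k w"
    proof (eventually_elim, intro impI)
      fix w assume w: "w \<in> S \<longrightarrow> ereal b < l w" "s w < b - d" "w \<in> S"
      then have "ereal d < ?k w" by (cases "l w") (auto simp: s_def)
      with d(1) show "a < ?k w" by (rule less_trans)
    qed
  qed
  ultimately show ?thesis using sc by (simp add: Gamma_on_def strongly_convex_on_def)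
qed

lemma has_derivative_withinI_quadratic:
  fixes \<phi> :: "'a::real_inner \<Rightarrow> real"
  assumes K: "0 \<le> K"
    and bound: "\<And>w. w \<in> S \<Longrightarrow> \<bar>\<phi> w - \<phi> v - inner (w - v) D\<bar> \<le> K * (norm (w - v))\<^sup>2"
  shows "(\<phi> has_derivative (\<lambda>k. inner k D)) (at v within S)"
proof (rule has_derivativeI_sandwich[where e=1 and H="\<lambda>w. K * norm (w - v)"])
  show "bounded_linear (\<lambda>k. inner k D)" by (rule bounded_linear_inner_left)
  show "norm (\<phi> w - \<phi> v - inner (w - v) D) / norm (w - v) \<le> K * norm (w - v)"
    if "w \<in> S" "w \<noteq> v" for w
    using bound[OF that(1)] that(2) by (simp add: divide_le_eq power2_eq_square mult.assoc)
  have "((\<lambda>w. K * norm (w - v)) \<longlongrightarrow> K * norm (v - v)) (at v within S)"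
    by (intro tendsto_intros)
  then show "((\<lambda>w. K * norm (w - v)) \<longlongrightarrow> 0) (at v within S)" by simp
qed simp

lemma gradient_conjugate_strongly_convex:
  fixes S :: "'a::real_inner set" and l :: "'a \<Rightarrow> ereal"
  defines "T \<equiv> gradient_on S (\<lambda>w. real_of_ereal (conjugate_on S l w))"
  assumes S: "hilbert_subspace S" and l: "l \<in> Gamma_on S" and c: "0 < c"
    and sc: "strongly_convex_on S c l" and u0: "u0 \<in> subdiff_on S l y0"
  shows subdiff_on_gradient_conjugate: "v \<in> S \<Longrightarrow> v \<in> subdiff_on S l (T v)"
    and gradient_conjugate_eqI: "v \<in> subdiff_on S l y \<Longrightarrow> T v = y"
    and gradient_conjugate_Lipschitz: "v \<in> S \<Longrightarrow> w \<in> S \<Longrightarrow> norm (T v - T w) \<le> norm (v - w) / c"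
proof -
  have sub: "subspace S" using S by (simp add: hilbert_subspace_def)
  define k where "k = (\<lambda>y. l y - ereal (c / 2 * (norm y)\<^sup>2))"
  define R where "R = (\<lambda>v. prox_on S (1 / c) k ((1 / c) *\<^sub>R v))"
  have kG: "k \<in> Gamma_on S" unfolding k_def by (rule minus_quadratic_in_Gamma[OF l sc])
  have mi: "norm_minorized_on S k"
    unfolding k_def by (rule subdiff_on_imp_norm_minorized[OF subdiff_on_minus_quadratic[OF sub sc u0]])
  have scale: "(1 / (1 / c)) *\<^sub>R ((1 / c) *\<^sub>R v - p) = v - c *\<^sub>R p" for v p :: 'a
    using c by (simp add: scaleR_diff_right)
  have Rk: "v - c *\<^sub>R R v \<in> subdiff_on S k (R v)" if "v \<in> S" for v
    using prox_on_subdiff[OF S kG mi, of "1/c" "(1/c) *\<^sub>R v"] c sub that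
    unfolding R_def scale by (simp add: subspace_scale)
  have R1: "v \<in> subdiff_on S l (R v)" if "v \<in> S" for v
    using subdiff_on_plus_quadratic[OF sub less_imp_le[OF c] Rk[OF that, unfolded k_def]] by simp
  have R2: "R v = y" if "v \<in> subdiff_on S l y" for v y
    unfolding R_def
  proof (rule subdiff_imp_prox_on)
    show "(1 / (1 / c)) *\<^sub>R ((1 / c) *\<^sub>R v - y) \<in> subdiff_on S k y"
      unfolding scale k_def by (rule subdiff_on_minus_quadratic[OF sub sc that])
  qed (use c in simp)
  have R3: "norm (R v - R w) \<le> norm (v - w) / c" if "v \<in> S" "w \<in> S" for v w
  proof -
    define d where "d = R v - R w"
    have "0 \<le> inner ((v - c *\<^sub>R R v) - (w - c *\<^sub>R R w)) d"
      unfolding d_def by (rule subdiff_on_monotone[OF Rk[OF that(1)] Rk[OF that(2)]])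
    also have "\<dots> = inner (v - w) d - c * (norm d)\<^sup>2"
      unfolding d_def power2_norm_eq_inner by (simp add: inner_simps algebra_simps)
    finally have "c * (norm d)\<^sup>2 \<le> norm (v - w) * norm d"
      using norm_cauchy_schwarz[of "v - w" d] by linarith
    then have "c * norm d \<le> norm (v - w)"
      by (cases "d = 0") (auto simp: power2_eq_square)
    then show ?thesis using c by (simp add: d_def field_simps)
  qed
  have T: "T v = R v" if v: "v \<in> S" for v
    unfolding T_def
  proof (rule gradient_on_eqI[OF sub v])
    show "R v \<in> S" using R1[OF v] by (rule subdiff_on_memD)
    define co where "co = (\<lambda>w. real_of_ereal (conjugate_on S l w))"
    have co: "conjugate_on S l w = ereal (co w)" if "w \<in> S" for w
      using subdiff_on_memD(3)[OF subdiff_on_conjugate[OF R1[OF that]]]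
      by (simp add: co_def ereal_real)
    have above: "co u + inner (R u) (w - u) \<le> co w" if "u \<in> S" "w \<in> S" for u w
      using subdiff_on_conjugate[OF R1[OF that(1)]] that by (simp add: subdiff_on_def co)
    have "\<bar>co w - co v - inner (w - v) (R v)\<bar> \<le> 1 / c * (norm (w - v))\<^sup>2" if w: "w \<in> S" for w
    proof -
      have "co w - co v - inner (w - v) (R v) \<le> inner (R w - R v) (w - v)"
        using above[OF w v] by (simp add: inner_simps inner_commute)
      also have "\<dots> \<le> norm (R w - R v) * norm (w - v)" by (rule norm_cauchy_schwarz)
      also have "\<dots> \<le> (norm (w - v) / c) * norm (w - v)" by (intro mult_right_mono R3 w v) simp
      finally show ?thesis
        using above[OF v w] by (simp add: power2_eq_square inner_commute)
    qed
    then show "(co has_derivative (\<lambda>k. inner k (R v))) (at v within S)"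
      using c by (intro has_derivative_withinI_quadratic[where K="1/c"]) auto
  qed
  show "v \<in> S \<Longrightarrow> v \<in> subdiff_on S l (T v)" using R1 T by simp
  show "T v = y" if "v \<in> subdiff_on S l y" using R2[OF that] T subdiff_on_memD(2)[OF that] by simp
  show "v \<in> S \<Longrightarrow> w \<in> S \<Longrightarrow> norm (T v - T w) \<le> norm (v - w) / c" using R3 T by simp
qed

section \<open>Duality for infimal convolutions\<close>

lemma infconv_on_le: "u \<in> S \<Longrightarrow> infconv_on S g l y \<le> g u + l (y - u)"
  unfolding infconv_on_def by (rule INF_lower)

lemma infconv_on_ge_subgradients:
  fixes S :: "'a::real_inner set"
  assumes S: "subspace S"
    and u: "u \<in> subdiff_on S g y1" "u \<in> subdiff_on S l y2"
    and ab: "g y1 = ereal a" "l y2 = ereal b" and y: "y \<in> S"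
  shows "ereal (a + b + inner u (y - (y1 + y2))) \<le> infconv_on S g l y"
  unfolding infconv_on_def
proof (rule INF_greatest)
  fix w assume w: "w \<in> S"
  have "ereal (a + inner u (w - y1)) \<le> g w" "ereal (b + inner u (y - w - y2)) \<le> l (y - w)"
    using u w subspace_diff[OF S y w] by (auto simp: subdiff_on_def ab)
  from add_mono[OF this] show "ereal (a + b + inner u (y - (y1 + y2))) \<le> g w + l (y - w)"
    by (simp add: inner_simps algebra_simps)
qed

text \<open>
  This is \<open>(g \<box> l)\<^sup>* = g\<^sup>* + l\<^sup>*\<close> at a subgradient of \<open>g \<box> l\<close>, in the direction that the duality step needs. The
  reason is that \<open>(g \<box> l) (u + w) \<le> g u + l w\<close> for all \<open>u\<close> and \<open>w\<close>.
\<close>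

lemma conjugate_on_infconv:
  fixes S :: "'a::real_inner set"
  assumes S: "subspace S" and g: "proper_on S g" and l: "proper_on S l" and vS: "v \<in> S"
    and v: "v \<in> subdiff_on S (infconv_on S g l) p" and p: "infconv_on S g l p = ereal r"
  obtains a b where "conjugate_on S g v = ereal a" "conjugate_on S l v = ereal b"
    "a + b \<le> inner v p - r"
proof -
  have le: "(inner v u - d) + (inner v w - e) \<le> inner v p - r"
    if "u \<in> S" "w \<in> S" "g u = ereal d" "l w = ereal e" for u w d e
  proof -
    have "ereal (r + inner v (u + w - p)) \<le> infconv_on S g l (u + w)"
      using v subspace_add[OF S that(1,2)] by (simp add: subdiff_on_def p)
    also have "\<dots> \<le> ereal (d + e)"
      using infconv_on_le[OF that(1), of g l "u + w"] that by simp
    finally show ?thesis by (simp add: inner_simps)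
  qed
  have fin: "\<exists>d. k w = ereal d" if "proper_on S k" "w \<in> S" "k w < \<infinity>" for k w
    using that by (cases "k w") (auto simp: proper_on_def)
  obtain u0 d0 where u0: "u0 \<in> S" "g u0 = ereal d0"
    using g fin[OF g] unfolding proper_on_def by blast
  obtain w0 e0 where w0: "w0 \<in> S" "l w0 = ereal e0"
    using l fin[OF l] unfolding proper_on_def by blast
  have gle: "conjugate_on S g v \<le> ereal (inner v p - r - (inner v w - e))"
    if "w \<in> S" "l w = ereal e" for w e
  proof (rule conjugate_on_le)
    fix u assume u: "u \<in> S"
    show "ereal (inner v u) - g u \<le> ereal (inner v p - r - (inner v w - e))"
      using le[OF u that(1) _ that(2)] g u by (cases "g u") (force simp: proper_on_def)+
  qed
  have "conjugate_on S g v \<noteq> -\<infinity>" "conjugate_on S g v \<noteq> \<infinity>"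
    using conjugate_on_ge[OF u0(1), of v g] gle[OF w0] by (auto simp: u0)
  then obtain a where a: "conjugate_on S g v = ereal a" by (cases "conjugate_on S g v") auto
  have lle: "conjugate_on S l v \<le> ereal (inner v p - r - a)"
  proof (rule conjugate_on_le)
    fix w assume w: "w \<in> S"
    show "ereal (inner v w) - l w \<le> ereal (inner v p - r - a)"
      using gle[OF w] l w by (cases "l w") (force simp: proper_on_def a)+
  qed
  have "conjugate_on S l v \<noteq> -\<infinity>" using conjugate_on_ge[OF w0(1), of v l] by (auto simp: w0)
  with lle obtain b where b: "conjugate_on S l v = ereal b" by (cases "conjugate_on S l v") auto
  show thesis using that[OF a b] lle by (simp add: b)
qed

lemma infconv_on_econvex:
  fixes S :: "'a::real_inner set"
  assumes S: "subspace S" and g: "econvex_on S g" "proper_on S g" and l: "econvex_on S l" "proper_on S l"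
    and \<rho>: "\<And>y. y \<in> S \<Longrightarrow> infconv_on S g l y = ereal (\<rho> y)"
  shows "econvex_on S (infconv_on S g l)"
  unfolding econvex_on_def
proof (intro ballI allI impI)
  fix x y and t :: real assume xy: "x \<in> S" "y \<in> S" and t: "0 < t \<and> t < 1"
  define w where "w = t *\<^sub>R x + (1 - t) *\<^sub>R y"
  have wS: "w \<in> S" unfolding w_def using S xy by (simp add: subspace_add subspace_scale)
  have near: "\<exists>u\<in>S. \<exists>a b. g u = ereal a \<and> l (y - u) = ereal b \<and> a + b < \<rho> y + e"
    if "0 < e" "y \<in> S" for e y
  proof -
    have "infconv_on S g l y < ereal (\<rho> y + e)" using that by (simp add: \<rho>)
    then obtain u where u: "u \<in> S" "g u + l (y - u) < ereal (\<rho> y + e)"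
      unfolding infconv_on_def INF_less_iff by blast
    moreover have "g u \<noteq> -\<infinity>" "l (y - u) \<noteq> -\<infinity>"
      using g l u subspace_diff[OF S that(2) u(1)] by (auto simp: proper_on_def)
    ultimately show ?thesis by (intro bexI[of _ u]; cases "g u"; cases "l (y - u)") auto
  qed
  have "\<rho> w \<le> t * \<rho> x + (1 - t) * \<rho> y"
  proof (rule field_le_epsilon)
    fix e :: real assume e: "0 < e"
    obtain u a b where u: "u \<in> S" "g u = ereal a" "l (x - u) = ereal b" "a + b < \<rho> x + e"
      using near[OF e xy(1)] by blast
    obtain u' a' b' where u': "u' \<in> S" "g u' = ereal a'" "l (y - u') = ereal b'" "a' + b' < \<rho> y + e"
      using near[OF e xy(2)] by blast
    define s where "s = t *\<^sub>R u + (1 - t) *\<^sub>R u'"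
    have sS: "s \<in> S" unfolding s_def using S u u' by (simp add: subspace_add subspace_scale)
    have "ereal (\<rho> w) \<le> g s + l (w - s)" using infconv_on_le[OF sS, of g l w] by (simp add: \<rho>[OF wS])
    also have "\<dots> \<le> (ereal t * g u + ereal (1 - t) * g u') + (ereal t * l (x - u) + ereal (1 - t) * l (y - u'))"
    proof (rule add_mono)
      show "g s \<le> ereal t * g u + ereal (1 - t) * g u'"
        using g(1) u u' t unfolding econvex_on_def s_def by blast
      have "w - s = t *\<^sub>R (x - u) + (1 - t) *\<^sub>R (y - u')" by (simp add: w_def s_def algebra_simps)
      then show "l (w - s) \<le> ereal t * l (x - u) + ereal (1 - t) * l (y - u')"
        using l(1)[unfolded econvex_on_def, rule_format, of "x - u" "y - u'" t] u u' xy t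
          subspace_diff[OF S] by simp
    qed
    finally have "\<rho> w \<le> t * (a + b) + (1 - t) * (a' + b')" by (simp add: u u' algebra_simps)
    also have "\<dots> \<le> t * (\<rho> x + e) + (1 - t) * (\<rho> y + e)"
      using u(4) u'(4) t by (intro add_mono[OF mult_left_mono mult_left_mono]) auto
    finally show "\<rho> w \<le> t * \<rho> x + (1 - t) * \<rho> y + e" by (simp add: algebra_simps)
  qed
  then show "infconv_on S g l (t *\<^sub>R x + (1 - t) *\<^sub>R y)
      \<le> ereal t * infconv_on S g l x + ereal (1 - t) * infconv_on S g l y"
    using wS xy by (simp add: \<rho> w_def[symmetric])
qed

text \<open>Shifting the point inserted into \<open>g\<close> by \<open>x - y\<close> leaves the argument of \<open>l\<close> unchanged.\<close>

lemma infconv_on_Lipschitz: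
  fixes S :: "'a::real_inner set"
  assumes S: "subspace S" and K: "K-lipschitz_on S (\<lambda>x. real_of_ereal (g x))"
    and fin: "\<And>x. x \<in> S \<Longrightarrow> \<bar>g x\<bar> \<noteq> \<infinity>" and xy: "x \<in> S" "y \<in> S"
  shows "infconv_on S g l x \<le> infconv_on S g l y + ereal (K * norm (x - y))"
proof -
  have "infconv_on S g l x - ereal (K * norm (x - y)) \<le> infconv_on S g l y"
    unfolding infconv_on_def[of S g l y]
  proof (rule INF_greatest)
    fix u assume u: "u \<in> S"
    define u' where "u' = u + (x - y)"
    have u'S: "u' \<in> S" unfolding u'_def using S xy u by (simp add: subspace_add subspace_diff)
    have "real_of_ereal (g u') \<le> real_of_ereal (g u) + K * norm (x - y)"
      using lipschitz_onD[OF K u'S u] by (simp add: dist_real_def dist_norm u'_def)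
    then have "g u' \<le> g u + ereal (K * norm (x - y))"
      using fin[OF u] fin[OF u'S] by (cases "g u"; cases "g u'") auto
    have "infconv_on S g l x \<le> g u' + l (x - u')" by (rule infconv_on_le[OF u'S])
    also have "x - u' = y - u" by (simp add: u'_def)
    also have "g u' + l (y - u) \<le> (g u + ereal (K * norm (x - y))) + l (y - u)"
      by (rule add_right_mono) fact
    also have "\<dots> = (g u + l (y - u)) + ereal (K * norm (x - y))" by (simp add: ac_simps)
    finally show "infconv_on S g l x - ereal (K * norm (x - y)) \<le> g u + l (y - u)"
      by (simp add: ereal_minus_le)
  qed
  then show ?thesis by (simp add: ereal_minus_le)
qed

lemma fenchel_young_infconv:
  fixes S :: "'a::real_inner set"
  assumes S: "subspace S" and g: "proper_on S g" and l: "proper_on S l" and y: "y \<in> S"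
    and ab: "conjugate_on S g v = ereal a" "conjugate_on S l v = ereal b"
  shows "ereal (inner y v - a - b) \<le> infconv_on S g l y"
  unfolding infconv_on_def
proof (rule INF_greatest)
  fix u assume u: "u \<in> S"
  have yu: "y - u \<in> S" using S y u by (rule subspace_diff)
  have "ereal (inner v u) - g u \<le> ereal a" "ereal (inner v (y - u)) - l (y - u) \<le> ereal b"
    using conjugate_on_ge[OF u, of v g] conjugate_on_ge[OF yu, of v l] by (auto simp: ab)
  moreover have "g u \<noteq> -\<infinity>" "l (y - u) \<noteq> -\<infinity>" using g l u yu by (auto simp: proper_on_def)
  ultimately show "ereal (inner y v - a - b) \<le> g u + l (y - u)"
    by (cases "g u"; cases "l (y - u)") (auto simp: inner_simps inner_commute)
qed

text \<open>
  The inequality \<open>\<psi> \<le> \<psi>\<^sup>*\<^sup>*\<close> for \<open>\<psi> = g \<box> l\<close>, up to an arbitrary error and with an explicit dual point. If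
  \<open>p\<close> is the proximal point of \<open>y\<close> with parameter \<open>t\<close>, then \<open>v = (y - p)/t\<close> is a subgradient of
  \<open>\<psi>\<close> at \<open>p\<close>, and \<open>\<psi> p\<close> differs from \<open>\<psi> y\<close> by at most \<open>t K\<^sup>2\<close> because \<open>\<psi>\<close> inherits the Lipschitz
  constant \<open>K\<close> of \<open>g\<close>. This avoids separation theorems and qualification conditions.
\<close>

lemma infconv_on_approx_dual:
  fixes S :: "'a::real_inner set"
  assumes S: "hilbert_subspace S" and g: "g \<in> Gamma_on S" and l: "l \<in> Gamma_on S"
    and lip: "elipschitz_on S g"
    and u: "u \<in> subdiff_on S g y1" "u \<in> subdiff_on S l y2"
    and y: "y \<in> S"
  shows infconv_on_finite: "\<bar>infconv_on S g l y\<bar> \<noteq> \<infinity>"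
    and "0 < \<delta> \<Longrightarrow> \<exists>v\<in>S. \<exists>a b. conjugate_on S g v = ereal a \<and> conjugate_on S l v = ereal b
      \<and> infconv_on S g l y \<le> ereal (inner y v - a - b + \<delta>)"
proof -
  have sub: "subspace S" using S by (simp add: hilbert_subspace_def)
  have pg: "econvex_on S g" "proper_on S g" and pl: "econvex_on S l" "proper_on S l"
    using g l by (auto simp: Gamma_on_def)
  obtain K where gfin: "\<And>x. x \<in> S \<Longrightarrow> \<bar>g x\<bar> \<noteq> \<infinity>" and K: "K-lipschitz_on S (\<lambda>x. real_of_ereal (g x))"
    using lip by (auto simp: elipschitz_on_def)
  have K0: "0 \<le> K" using K by (rule lipschitz_on_nonneg)
  define \<psi> where "\<psi> = infconv_on S g l"
  obtain a1 b1 where ab1: "g y1 = ereal a1" "l y2 = ereal b1"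
    using u by (auto simp: subdiff_on_def)
  have low: "ereal (a1 + b1 + inner u (w - (y1 + y2))) \<le> \<psi> w" if "w \<in> S" for w
    unfolding \<psi>_def by (rule infconv_on_ge_subgradients[OF sub u ab1 that])
  have y2S: "y2 \<in> S" using u(2) by (rule subdiff_on_memD)
  have fin: "\<bar>\<psi> w\<bar> \<noteq> \<infinity>" if w: "w \<in> S" for w
  proof -
    have wS: "w - y2 \<in> S" using sub w y2S by (rule subspace_diff)
    have "\<psi> w \<le> g (w - y2) + l y2"
      using infconv_on_le[OF wS, of g l w] by (simp add: \<psi>_def)
    with low[OF w] gfin[OF wS] show ?thesis
      by (cases "\<psi> w"; cases "g (w - y2)") (auto simp: ab1)
  qed
  then show "\<bar>infconv_on S g l y\<bar> \<noteq> \<infinity>" using y by (simp add: \<psi>_def)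
  define \<rho> where "\<rho> = (\<lambda>w. real_of_ereal (\<psi> w))"
  have \<rho>: "\<psi> w = ereal (\<rho> w)" if "w \<in> S" for w using fin[OF that] by (simp add: \<rho>_def ereal_real)
  have lip\<rho>: "\<rho> w \<le> \<rho> w' + K * norm (w - w')" if "w \<in> S" "w' \<in> S" for w w'
    using infconv_on_Lipschitz[OF sub K gfin that, of l] by (simp add: \<psi>_def[symmetric] \<rho> that)
  have "lsc_on S \<psi>"
  proof (rule lsc_onI)
    fix p and a :: ereal assume p: "p \<in> S" and a: "a < \<psi> p"
    have "((\<lambda>w. ereal (\<rho> p - K * norm (p - w))) \<longlongrightarrow> ereal (\<rho> p - K * norm (p - p))) (nhds p)"
      by (intro lim_ereal[THEN iffD2] tendsto_intros filterlim_ident)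
    then have "\<forall>\<^sub>F w in nhds p. a < ereal (\<rho> p - K * norm (p - w))"
      by (rule order_tendstoD(1)) (use a p in \<open>simp add: \<rho>\<close>)
    then show "\<forall>\<^sub>F w in nhds p. w \<in> S \<longrightarrow> a < \<psi> w"
    proof (rule eventually_mono, intro impI)
      fix w assume aw: "a < ereal (\<rho> p - K * norm (p - w))" and w: "w \<in> S"
      note aw
      also have "ereal (\<rho> p - K * norm (p - w)) \<le> \<psi> w" using lip\<rho>[OF p w] by (simp add: \<rho> w)
      finally show "a < \<psi> w" .
    qed
  qed
  moreover have "proper_on S \<psi>"
    unfolding proper_on_def using \<rho> y by (auto intro!: bexI[of _ y])
  moreover have "econvex_on S \<psi>"
    using infconv_on_econvex[OF sub pg pl, of \<rho>] \<rho> unfolding \<psi>_def by blast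
  ultimately have \<psi>G: "\<psi> \<in> Gamma_on S" by (simp add: Gamma_on_def)
  have mi: "norm_minorized_on S \<psi>"
  proof -
    have "ereal (- (inner u (y1 + y2) - a1 - b1) - norm u * norm w) \<le> \<psi> w" if "w \<in> S" for w
      using Cauchy_Schwarz_ineq2[of u w] low[OF that] by (simp add: \<rho>[OF that] inner_simps)
    then show ?thesis unfolding norm_minorized_on_def by blast
  qed
  show "\<exists>v\<in>S. \<exists>a b. conjugate_on S g v = ereal a \<and> conjugate_on S l v = ereal b
      \<and> infconv_on S g l y \<le> ereal (inner y v - a - b + \<delta>)" if \<delta>: "0 < \<delta>"
  proof -
    (* the loss t K^2 of the proximal step has to stay below \<delta> *)
    define t where "t = \<delta> / (K\<^sup>2 + 1)"
    have K2: "0 < K\<^sup>2 + 1" by (simp add: add_nonneg_pos)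
    have t: "0 < t" "t * K\<^sup>2 \<le> \<delta>"
      unfolding t_def using \<delta> K2 by (auto simp: field_simps)
    define p where "p = prox_on S t \<psi> y"
    define v where "v = (1 / t) *\<^sub>R (y - p)"
    have v: "v \<in> subdiff_on S \<psi> p"
      unfolding v_def p_def by (rule prox_on_subdiff[OF S \<psi>G mi t(1) y])
    have pS: "p \<in> S" "v \<in> S" using v by (auto simp: subdiff_on_def)
    have pv: "p + v \<in> S" using sub pS by (rule subspace_add)
    have yp: "y - p = t *\<^sub>R v" using t by (simp add: v_def)
    have "\<rho> p + inner v v \<le> \<rho> (p + v)"
      using v pv pS unfolding subdiff_on_def by (force simp: \<rho>)
    also have "\<dots> \<le> \<rho> p + K * norm v" using lip\<rho>[OF pv pS(1)] by simp
    finally have "norm v * norm v \<le> K * norm v"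
      by (simp add: power2_norm_eq_inner[symmetric] power2_eq_square)
    then have vK: "norm v \<le> K" using K0 by (cases "v = 0") auto
    obtain a b where ab: "conjugate_on S g v = ereal a" "conjugate_on S l v = ereal b"
      "a + b \<le> inner v p - \<rho> p"
      using conjugate_on_infconv[OF sub pg(2) pl(2) pS(2), folded \<psi>_def, OF v \<rho>[OF pS(1)]] by blast
    have "\<rho> y \<le> \<rho> p + K * (t * norm v)" using lip\<rho>[OF y pS(1)] t by (simp add: yp)
    also have "K * (t * norm v) \<le> K * (t * K)" using vK K0 t by (intro mult_left_mono) auto
    also have "K * (t * K) \<le> \<delta>" using t(2) by (simp add: power2_eq_square ac_simps)
    also have "\<rho> p \<le> inner v p - a - b" using ab(3) by simp
    also have "inner v p \<le> inner y v"
    proof -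
      have "inner y v = inner v p + t * inner v v"
        using yp by (metis add_diff_cancel_left' diff_add_cancel inner_add_left inner_commute inner_scaleR_left add.commute)
      then show ?thesis using t by simp
    qed
    finally have "\<rho> y \<le> inner y v - a - b + \<delta>" by simp
    then show ?thesis using ab pS(2) \<rho>[OF y] unfolding \<psi>_def by auto
  qed
qed

section \<open>Weak limits without weak compactness\<close>

text \<open>
  Almost-minimal points for the norm form a Cauchy sequence, by the parallelogram identity at
  midpoints.
\<close>

lemma nested_closed_convex_nonempty_Inter:
  fixes C :: "nat \<Rightarrow> 'a::real_inner set"
  assumes S: "complete S" and CS: "\<And>n. C n \<subseteq> S"
    and closed: "\<And>n. closed (C n)" and convex: "\<And>n. convex (C n)" and ne: "\<And>n. C n \<noteq> {}"
    and dec: "decseq C" and bdd: "bounded (C 0)"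
  shows "\<exists>c. \<forall>n. c \<in> C n"
proof -
  define d where "d n = (INF y\<in>C n. norm y)" for n
  have bb: "bdd_below (norm ` C n)" for n by (intro bdd_belowI2[where m=0]) simp
  have d_le: "d n \<le> norm y" if "y \<in> C n" for n y
    unfolding d_def by (rule cINF_lower[OF bb that])
  have sub: "C k \<subseteq> C n" if "n \<le> k" for n k using dec that by (rule decseqD)
  obtain M where M: "\<And>y. y \<in> C 0 \<Longrightarrow> norm y \<le> M" using bdd by (auto simp: bounded_iff)
  have "incseq d"
    unfolding incseq_def d_def using sub bb ne by (intro allI impI cINF_superset_mono) auto
  moreover have "d n \<le> M" for n
    using ne[of n] d_le[of _ n] M sub[of 0 n] by fastforce
  ultimately obtain L where L: "d \<longlonglongrightarrow> L" using incseq_convergent[of d M] by blast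
  have "\<exists>y\<in>C n. norm y < d n + 1 / real (Suc n)" for n
  proof -
    have "(INF y\<in>C n. norm y) < d n + 1 / real (Suc n)" by (simp add: d_def)
    then show ?thesis by (simp only: cINF_less_iff[OF ne bb])
  qed
  then obtain y where y: "\<And>n. y n \<in> C n" "\<And>n. norm (y n) < d n + 1 / real (Suc n)" by metis
  define a where "a n = (d n + 1 / real (Suc n))\<^sup>2" for n
  have aL: "a \<longlonglongrightarrow> L\<^sup>2"
  proof -
    have "a \<longlonglongrightarrow> (L + 0)\<^sup>2" unfolding a_def by (intro tendsto_intros L LIMSEQ_Suc[OF lim_1_over_n])
    then show ?thesis by simp
  qed
  have dL: "(\<lambda>n. (d n)\<^sup>2) \<longlonglongrightarrow> L\<^sup>2" by (intro tendsto_intros L)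
  have d0: "0 \<le> d n" for n unfolding d_def using ne by (intro cINF_greatest) auto
  have gap: "(norm (y n - y k))\<^sup>2 \<le> 2 * a n + 2 * a k - 4 * (d n)\<^sup>2" if "n \<le> k" for n k
  proof -
    define w where "w = (1/2) *\<^sub>R y n + (1/2) *\<^sub>R y k"
    have "w \<in> C n"
      unfolding w_def using y(1)[of n] y(1)[of k] sub[OF that] by (intro convexD[OF convex]) auto
    then have "(d n)\<^sup>2 \<le> (norm w)\<^sup>2" using d0 d_le by (intro power_mono) auto
    moreover have "(norm (y n - y k))\<^sup>2 = 2 * (norm (y n))\<^sup>2 + 2 * (norm (y k))\<^sup>2 - 4 * (norm w)\<^sup>2"
      unfolding w_def power2_norm_eq_inner by (simp add: inner_simps inner_commute)
    moreover have "(norm (y j))\<^sup>2 \<le> a j" for j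
      unfolding a_def using less_imp_le[OF y(2)] by (rule power_mono) simp
    ultimately show ?thesis by (smt (verit))
  qed
  have "Cauchy y"
  proof (rule metric_CauchyI)
    fix e :: real assume e: "0 < e"
    have "\<forall>\<^sub>F n in sequentially. \<bar>a n - L\<^sup>2\<bar> < e\<^sup>2 / 8" "\<forall>\<^sub>F n in sequentially. \<bar>(d n)\<^sup>2 - L\<^sup>2\<bar> < e\<^sup>2 / 8"
      using tendstoD[OF aL, of "e\<^sup>2/8"] tendstoD[OF dL, of "e\<^sup>2/8"] e by (auto simp: dist_real_def)
    then have "\<forall>\<^sub>F n in sequentially. \<bar>a n - L\<^sup>2\<bar> < e\<^sup>2 / 8 \<and> \<bar>(d n)\<^sup>2 - L\<^sup>2\<bar> < e\<^sup>2 / 8"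
      by (rule eventually_conj)
    then obtain N where N: "\<And>n. n \<ge> N \<Longrightarrow> \<bar>a n - L\<^sup>2\<bar> < e\<^sup>2 / 8 \<and> \<bar>(d n)\<^sup>2 - L\<^sup>2\<bar> < e\<^sup>2 / 8"
      unfolding eventually_sequentially by blast
    have *: "dist (y n) (y k) < e" if "n \<ge> N" "n \<le> k" for n k
    proof -
      have "(norm (y n - y k))\<^sup>2 < e\<^sup>2"
        using gap[OF that(2)] N[OF that(1)] N[OF order_trans[OF that]] by linarith
      then show ?thesis using e by (simp add: dist_norm power_less_imp_less_base)
    qed
    have "dist (y n) (y k) < e" if "n \<ge> N" "k \<ge> N" for n k
      using *[of n k] *[of k n] that by (cases "n \<le> k") (auto simp: dist_commute)
    then show "\<exists>M. \<forall>n\<ge>M. \<forall>k\<ge>M. dist (y n) (y k) < e" by blast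
  qed
  then obtain c where c: "y \<longlonglongrightarrow> c"
    using S y(1) CS unfolding complete_def by (metis subsetD)
  have "c \<in> C n" for n
  proof (rule Lim_in_closed_set[OF closed _ _ c])
    show "\<forall>\<^sub>F k in sequentially. y k \<in> C n"
      using y(1) sub unfolding eventually_sequentially by blast
  qed simp
  then show ?thesis by blast
qed

text \<open>
  The point \<open>c\<close> lies in the closed convex hull of every tail. For the purposes of Opial's argument
  it replaces a weak cluster point: every closed convex property that holds eventually along the
  sequence holds at \<open>c\<close>.
\<close>

lemma bounded_sequence_asymptotic_point:
  fixes X :: "nat \<Rightarrow> 'a::real_inner"
  assumes S: "hilbert_subspace S" and X: "\<And>n. X n \<in> S" and bdd: "bounded (range X)"
  obtains c where "c \<in> S"
    "\<And>D. closed D \<Longrightarrow> convex D \<Longrightarrow> \<forall>\<^sub>F n in sequentially. X n \<in> D \<Longrightarrow> c \<in> D"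
proof -
  have sub: "subspace S" and cpl: "complete S" using S by (auto simp: hilbert_subspace_def)
  define C where "C n = closure (convex hull (X ` {n..}))" for n
  have least: "C n \<subseteq> D" if "closed D" "convex D" "\<And>k. k \<ge> n \<Longrightarrow> X k \<in> D" for n D
    unfolding C_def using that by (intro closure_minimal hull_minimal) auto
  have "\<exists>c. \<forall>n. c \<in> C n"
  proof (rule nested_closed_convex_nonempty_Inter[OF cpl])
    show CS: "C n \<subseteq> S" for n
      using X by (intro least complete_imp_closed cpl subspace_imp_convex sub)
    show "decseq C"
      unfolding decseq_def C_def by (intro allI impI closure_mono hull_mono image_mono) auto
    show "bounded (C 0)" unfolding C_def using bdd
      by (intro bounded_closure bounded_convex_hull) (auto simp: atLeast_0)
  qed (auto simp: C_def convex_closure)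
  then obtain c where c: "\<And>n. c \<in> C n" by blast
  show thesis
  proof (rule that)
    show D: "c \<in> D" if cD: "closed D" "convex D" and ev: "\<forall>\<^sub>F n in sequentially. X n \<in> D" for D
    proof -
      obtain n where "\<And>k. k \<ge> n \<Longrightarrow> X k \<in> D" using ev by (auto simp: eventually_sequentially)
      from least[OF cD this] c show ?thesis by blast
    qed
    show "c \<in> S"
      using X by (intro D complete_imp_closed cpl subspace_imp_convex sub) auto
  qed
qed

section \<open>Tseng's forward-backward-forward iteration\<close>

locale tseng_iteration =
  fixes S :: "'a::real_inner set" and A :: "'a \<Rightarrow> 'a set" and B :: "'a \<Rightarrow> 'a" and \<beta> \<epsilon> :: real
    and \<gamma> :: "nat \<Rightarrow> real" and x p :: "nat \<Rightarrow> 'a"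
  assumes S: "hilbert_subspace S"
    and A_mem: "\<And>a q. a \<in> A q \<Longrightarrow> q \<in> S \<and> a \<in> S"
    and A_mono: "\<And>a b q w. a \<in> A q \<Longrightarrow> b \<in> A w \<Longrightarrow> 0 \<le> inner (a - b) (q - w)"
    and A_resolvent: "\<And>t w. 0 < t \<Longrightarrow> w \<in> S \<Longrightarrow> \<exists>q. (1 / t) *\<^sub>R (w - q) \<in> A q"
    and B_mem: "\<And>q. q \<in> S \<Longrightarrow> B q \<in> S"
    and B_mono: "\<And>q w. q \<in> S \<Longrightarrow> w \<in> S \<Longrightarrow> 0 \<le> inner (B q - B w) (q - w)"
    and B_Lipschitz: "\<And>q w. q \<in> S \<Longrightarrow> w \<in> S \<Longrightarrow> norm (B q - B w) \<le> \<beta> * norm (q - w)"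
    and \<beta>: "0 < \<beta>" and \<epsilon>: "0 < \<epsilon>"
    and \<gamma>: "\<And>n. \<epsilon> \<le> \<gamma> n" "\<And>n. \<gamma> n * \<beta> \<le> 1 - \<epsilon>"
    and x0: "x 0 \<in> S"
    and p_step: "\<And>n. x n \<in> S \<Longrightarrow> (1 / \<gamma> n) *\<^sub>R (x n - p n) - B (x n) \<in> A (p n)"
    and x_step: "\<And>n. x (Suc n) = p n + \<gamma> n *\<^sub>R (B (x n) - B (p n))"
begin

lemma sub: "subspace S" and cpl: "complete S"
  using S by (auto simp: hilbert_subspace_def)

lemma \<gamma>_pos: "0 < \<gamma> n"
  using \<gamma>(1)[of n] \<epsilon> by simp

lemma x_mem: "x n \<in> S"
proof (induction n)
  case (Suc n)
  have "p n \<in> S" using A_mem p_step[OF Suc] by blast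
  then show ?case
    unfolding x_step using Suc sub B_mem by (simp add: subspace_add subspace_diff subspace_scale)
qed (rule x0)

lemma p_mem: "p n \<in> S"
  using A_mem p_step[OF x_mem] by blast

text \<open>
  An element of \<open>(A + B) (p n)\<close>. Being a difference of consecutive iterates, it has inner products
  that telescope.
\<close>

definition residual :: "nat \<Rightarrow> 'a" where
  "residual n = (1 / \<gamma> n) *\<^sub>R (x n - x (Suc n))"

lemma residual_in_A: "residual n - B (p n) \<in> A (p n)"
proof -
  have "residual n - B (p n) = (1 / \<gamma> n) *\<^sub>R (x n - p n) - B (x n)"
    unfolding residual_def x_step using \<gamma>_pos[of n] by (simp add: algebra_simps)
  then show ?thesis using p_step[OF x_mem, of n] by simp
qed

lemma correction_le: "norm (x (Suc n) - p n) \<le> (\<gamma> n * \<beta>) * norm (x n - p n)"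
proof -
  have "norm (x (Suc n) - p n) = \<gamma> n * norm (B (x n) - B (p n))"
    unfolding x_step using \<gamma>_pos[of n] by simp
  also have "\<dots> \<le> \<gamma> n * (\<beta> * norm (x n - p n))"
    using \<gamma>_pos[of n] by (intro mult_left_mono B_Lipschitz x_mem p_mem) auto
  finally show ?thesis by (simp add: mult.assoc)
qed

text \<open>
  Polarization expresses the inner product by squared distances; the Lipschitz step
  \<open>\<gamma> n * \<beta> \<le> 1 - \<epsilon>\<close> makes the correction smaller than \<open>\<parallel>x n - p n\<parallel>\<close>. Nothing is assumed of \<open>q\<close>, so that
  the same inequality serves zeros of \<open>A + B\<close> and arbitrary comparison points.
\<close>

lemma energy:
  "2 * \<gamma> n * inner (residual n) (p n - q) + (norm (x (Suc n) - q))\<^sup>2 + \<epsilon> * (norm (x n - p n))\<^sup>2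
    \<le> (norm (x n - q))\<^sup>2"
proof -
  have g: "\<gamma> n *\<^sub>R residual n = x n - x (Suc n)" unfolding residual_def using \<gamma>_pos[of n] by simp
  have "2 * \<gamma> n * inner (residual n) (p n - q) = 2 * inner (\<gamma> n *\<^sub>R residual n) (p n - q)"
    by simp
  also have "\<dots> = (norm (x n - q))\<^sup>2 - (norm (x (Suc n) - q))\<^sup>2
      - (norm (x n - p n))\<^sup>2 + (norm (x (Suc n) - p n))\<^sup>2"
    unfolding g power2_norm_eq_inner by (simp add: inner_simps inner_commute)
  finally have 1: "2 * \<gamma> n * inner (residual n) (p n - q) = (norm (x n - q))\<^sup>2 - (norm (x (Suc n) - q))\<^sup>2
      - (norm (x n - p n))\<^sup>2 + (norm (x (Suc n) - p n))\<^sup>2" .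
  have nn: "0 \<le> \<gamma> n * \<beta>" using \<gamma>_pos[of n] \<beta> by simp
  have "(norm (x (Suc n) - p n))\<^sup>2 \<le> ((\<gamma> n * \<beta>) * norm (x n - p n))\<^sup>2"
    by (intro power_mono correction_le) simp
  also have "\<dots> = (\<gamma> n * \<beta>)\<^sup>2 * (norm (x n - p n))\<^sup>2" by (simp add: power_mult_distrib)
  also have "\<dots> \<le> (1 - \<epsilon>) * (norm (x n - p n))\<^sup>2"
  proof (rule mult_right_mono)
    have "(\<gamma> n * \<beta>)\<^sup>2 \<le> 1 * (\<gamma> n * \<beta>)"
      unfolding power2_eq_square using nn \<gamma>(2)[of n] \<epsilon> by (intro mult_right_mono) auto
    then show "(\<gamma> n * \<beta>)\<^sup>2 \<le> 1 - \<epsilon>" using \<gamma>(2)[of n] by simp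
  qed simp
  finally have "(norm (x (Suc n) - p n))\<^sup>2 \<le> (norm (x n - p n))\<^sup>2 - \<epsilon> * (norm (x n - p n))\<^sup>2"
    by (simp add: algebra_simps)
  with 1 show ?thesis by linarith
qed

text \<open>
  Since the step sizes are nondecreasing, the weights \<open>1 / \<gamma> n\<close> are nonincreasing and summation by parts keeps only
  the initial term.
\<close>

lemma sum_residuals_le:
  assumes "incseq \<gamma>"
  shows "(\<Sum>n<N. inner (residual n) (p n - q)) \<le> (norm (x 0 - q))\<^sup>2 / (2 * \<gamma> 0)"
proof -
  have "(\<Sum>n<N. inner (residual n) (p n - q)) + (norm (x N - q))\<^sup>2 / (2 * \<gamma> N) \<le> (norm (x 0 - q))\<^sup>2 / (2 * \<gamma> 0)"
  proof (induction N)
    case (Suc N)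
    have "0 \<le> \<epsilon> * (norm (x N - p N))\<^sup>2" using \<epsilon> by simp
    then have "2 * \<gamma> N * inner (residual N) (p N - q) + (norm (x (Suc N) - q))\<^sup>2 \<le> (norm (x N - q))\<^sup>2"
      using energy[of N q] by linarith
    then have "(2 * \<gamma> N * inner (residual N) (p N - q) + (norm (x (Suc N) - q))\<^sup>2) / (2 * \<gamma> N)
        \<le> (norm (x N - q))\<^sup>2 / (2 * \<gamma> N)"
      using \<gamma>_pos[of N] by (intro divide_right_mono) auto
    then have "inner (residual N) (p N - q) + (norm (x (Suc N) - q))\<^sup>2 / (2 * \<gamma> N) \<le> (norm (x N - q))\<^sup>2 / (2 * \<gamma> N)"
      using \<gamma>_pos[of N] by (simp add: add_divide_distrib)
    moreover have "(norm (x (Suc N) - q))\<^sup>2 / (2 * \<gamma> (Suc N)) \<le> (norm (x (Suc N) - q))\<^sup>2 / (2 * \<gamma> N)"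
      using \<gamma>_pos[of N] incseq_SucD[OF assms, of N] by (intro divide_left_mono) auto
    ultimately show ?case using Suc by simp
  qed simp
  moreover have "0 \<le> (norm (x N - q))\<^sup>2 / (2 * \<gamma> N)" using \<gamma>_pos[of N] by simp
  ultimately show ?thesis by linarith
qed

text \<open>
  Maximality of \<open>A + B\<close> (Minty's trick): testing monotonicity at the solution \<open>q\<close> of
  \<open>c \<in> q + t (A q + B q)\<close> forces \<open>q = c\<close>. That solution is a fixed point of
  \<open>q \<mapsto> (I + t A)\<^sup>-\<^sup>1 (c - t B q)\<close>, a contraction for \<open>t = 1 / (2 \<beta>)\<close>.
\<close>

lemma zero_if_monotonically_related:
  assumes c: "c \<in> S" and rel: "\<And>q a. a \<in> A q \<Longrightarrow> inner (c - q) (a + B q) \<le> 0"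
  shows "- B c \<in> A c"
proof -
  define t where "t = 1 / (2 * \<beta>)"
  have t: "0 < t" using \<beta> by (simp add: t_def)
  obtain J where J: "\<And>w. w \<in> S \<Longrightarrow> (1 / t) *\<^sub>R (w - J w) \<in> A (J w)"
    using A_resolvent[OF t] by metis
  have J_le: "norm (J w - J w') \<le> norm (w - w')" if "w \<in> S" "w' \<in> S" for w w'
  proof -
    define d where "d = J w - J w'"
    have "0 \<le> inner ((1 / t) *\<^sub>R (w - J w) - (1 / t) *\<^sub>R (w' - J w')) d"
      unfolding d_def by (rule A_mono[OF J[OF that(1)] J[OF that(2)]])
    also have "\<dots> = (1 / t) * (inner (w - w') d - (norm d)\<^sup>2)"
      unfolding d_def power2_norm_eq_inner using t by (simp add: inner_simps field_simps)
    finally have "(norm d)\<^sup>2 \<le> inner (w - w') d" using t by (simp add: zero_le_divide_iff)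
    also have "\<dots> \<le> norm (w - w') * norm d" by (rule norm_cauchy_schwarz)
    finally show ?thesis
      unfolding d_def[symmetric] by (cases "d = 0") (auto simp: power2_eq_square)
  qed
  define \<Phi> where "\<Phi> q = J (c - t *\<^sub>R B q)" for q
  have arg: "c - t *\<^sub>R B q \<in> S" if "q \<in> S" for q
    using sub c B_mem[OF that] by (simp add: subspace_diff subspace_scale)
  have "\<exists>!q\<in>S. \<Phi> q = q"
  proof (rule Banach_fix[OF cpl, where c="1/2"])
    show "S \<noteq> {}" using c by blast
    show "\<Phi> ` S \<subseteq> S" unfolding \<Phi>_def using A_mem J arg by blast
    show "dist (\<Phi> q) (\<Phi> w) \<le> 1 / 2 * dist q w" if "q \<in> S" "w \<in> S" for q w
    proof -
      have "norm (\<Phi> q - \<Phi> w) \<le> norm ((c - t *\<^sub>R B q) - (c - t *\<^sub>R B w))"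
        unfolding \<Phi>_def by (rule J_le[OF arg arg]) (fact that)+
      also have "(c - t *\<^sub>R B q) - (c - t *\<^sub>R B w) = - (t *\<^sub>R (B q - B w))" by (simp add: algebra_simps)
      also have "norm \<dots> = t * norm (B q - B w)" using t by simp
      also have "\<dots> \<le> t * (\<beta> * norm (q - w))" using t that by (intro mult_left_mono B_Lipschitz) auto
      also have "\<dots> = 1 / 2 * norm (q - w)" using \<beta> by (simp add: t_def)
      finally show ?thesis by (simp add: dist_norm)
    qed
  qed auto
  then obtain q where q: "q \<in> S" "J (c - t *\<^sub>R B q) = q" unfolding \<Phi>_def by blast
  have "(1 / t) *\<^sub>R (c - t *\<^sub>R B q - q) = (1 / t) *\<^sub>R (c - q) - B q"
    using t by (simp add: algebra_simps)
  then have qA: "(1 / t) *\<^sub>R (c - q) - B q \<in> A q" using J[OF arg[OF q(1)]] q(2) by simp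
  from rel[OF this] have "(1 / t) * inner (c - q) (c - q) \<le> 0" by simp
  then have "inner (c - q) (c - q) \<le> 0" using t by (simp add: divide_le_0_iff)
  then have "c = q" by (metis inner_ge_zero antisym inner_eq_zero_iff eq_iff_diff_eq_0)
  with qA show ?thesis by simp
qed

lemma residual_dominates:
  assumes "a \<in> A q"
  shows "inner (a + B q) (p n - q) \<le> inner (residual n) (p n - q)"
proof -
  have "0 \<le> inner ((residual n - B (p n)) - a) (p n - q)" by (rule A_mono[OF residual_in_A assms])
  moreover have "0 \<le> inner (B (p n) - B q) (p n - q)"
    using A_mem[OF assms] by (intro B_mono p_mem) auto
  ultimately show ?thesis by (simp add: inner_simps)
qed

lemma Fejer:
  assumes "- B w \<in> A w"
  shows "(norm (x (Suc n) - w))\<^sup>2 + \<epsilon> * (norm (x n - p n))\<^sup>2 \<le> (norm (x n - w))\<^sup>2"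
proof -
  have "0 \<le> inner (residual n) (p n - w)" using residual_dominates[OF assms, of n] by simp
  then have "0 \<le> 2 * \<gamma> n * inner (residual n) (p n - w)" using \<gamma>_pos[of n] by simp
  with energy[of n w] show ?thesis by linarith
qed

lemma convergent_dist_zero:
  assumes w: "- B w \<in> A w"
  shows "convergent (\<lambda>n. (norm (x n - w))\<^sup>2)"
proof -
  have "decseq (\<lambda>n. (norm (x n - w))\<^sup>2)"
  proof (rule decseq_SucI)
    fix n
    have "0 \<le> \<epsilon> * (norm (x n - p n))\<^sup>2" using \<epsilon> by simp
    then show "(norm (x (Suc n) - w))\<^sup>2 \<le> (norm (x n - w))\<^sup>2" using Fejer[OF w, of n] by linarith
  qed
  then show ?thesis by (rule decseq_convergent[where B=0]) (auto simp: convergent_def)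
qed

lemma x_minus_p_tendsto_0:
  assumes w: "- B w \<in> A w"
  shows "(\<lambda>n. x n - p n) \<longlonglongrightarrow> 0"
proof -
  obtain L where L: "(\<lambda>n. (norm (x n - w))\<^sup>2) \<longlonglongrightarrow> L"
    using convergent_dist_zero[OF w] by (auto simp: convergent_def)
  have lim: "(\<lambda>n. ((norm (x n - w))\<^sup>2 - (norm (x (Suc n) - w))\<^sup>2) / \<epsilon>) \<longlonglongrightarrow> (L - L) / \<epsilon>"
    using \<epsilon> by (intro tendsto_intros L LIMSEQ_Suc[OF L]) auto
  have "(\<lambda>n. (norm (x n - p n))\<^sup>2) \<longlonglongrightarrow> 0"
  proof (rule tendsto_sandwich[OF _ _ tendsto_const])
    show "\<forall>\<^sub>F n in sequentially. (norm (x n - p n))\<^sup>2 \<le> ((norm (x n - w))\<^sup>2 - (norm (x (Suc n) - w))\<^sup>2) / \<epsilon>"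
      using Fejer[OF w] \<epsilon> by (intro always_eventually allI) (simp add: field_simps)
  qed (use lim in auto)
  then have "(\<lambda>n. norm (x n - p n)) \<longlonglongrightarrow> 0" by simp
  then show ?thesis by (rule tendsto_norm_zero_cancel)
qed

lemma residual_tendsto_0:
  assumes w: "- B w \<in> A w"
  shows "residual \<longlonglongrightarrow> 0"
proof (rule Lim_null_comparison)
  show "\<forall>\<^sub>F n in sequentially. norm (residual n) \<le> 2 / \<epsilon> * norm (x n - p n)"
  proof (intro always_eventually allI)
    fix n
    have "norm (x n - x (Suc n)) \<le> norm (x n - p n) + norm (x (Suc n) - p n)"
      using norm_triangle_ineq4[of "x n - p n" "x (Suc n) - p n"] by simp
    also have "norm (x (Suc n) - p n) \<le> 1 * norm (x n - p n)"
      using \<gamma>(2)[of n] \<epsilon> by (intro order_trans[OF correction_le] mult_right_mono) auto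
    finally have "norm (x n - x (Suc n)) \<le> 2 * norm (x n - p n)" by simp
    then have "1 / \<gamma> n * norm (x n - x (Suc n)) \<le> 1 / \<epsilon> * (2 * norm (x n - p n))"
      using \<gamma>(1)[of n] \<gamma>_pos[of n] \<epsilon> by (intro mult_mono divide_left_mono) auto
    then show "norm (residual n) \<le> 2 / \<epsilon> * norm (x n - p n)"
      unfolding residual_def using \<gamma>_pos[of n] by simp
  qed
  have "(\<lambda>n. 2 / \<epsilon> * norm (x n - p n)) \<longlonglongrightarrow> 2 / \<epsilon> * norm (0::'a)"
    by (intro tendsto_intros x_minus_p_tendsto_0[OF w])
  then show "(\<lambda>n. 2 / \<epsilon> * norm (x n - p n)) \<longlonglongrightarrow> 0" by simp
qed

lemma bounded_p:
  assumes w: "- B w \<in> A w"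
  shows "bounded (range p)"
proof -
  have "bounded (range (\<lambda>n. (norm (x n - w))\<^sup>2))"
    using convergent_dist_zero[OF w] convergent_imp_bounded by (auto simp: convergent_def)
  then obtain M where M: "\<And>n. (norm (x n - w))\<^sup>2 \<le> M" by (auto simp: bounded_iff)
  have "norm (x n - w) \<le> sqrt M" for n using M by (rule real_le_rsqrt)
  moreover have "norm (x n) \<le> norm (x n - w) + norm w" for n using norm_triangle_sub[of "x n" w] by simp
  ultimately have "norm (x n) \<le> sqrt M + norm w" for n by (meson add_right_mono order_trans)
  then have "bounded (range x)" unfolding bounded_iff by blast
  moreover have "bounded (range (\<lambda>n. x n - p n))"
    by (rule convergent_imp_bounded[OF x_minus_p_tendsto_0[OF w]])
  ultimately have "bounded ((\<lambda>n. x n - (x n - p n)) ` UNIV)"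
    by (rule bounded_minus_comp)
  then show ?thesis by simp
qed

text \<open>
  Demiclosedness. For each \<open>a \<in> A q\<close> the inequality \<open>(p n - q) \<bullet> (a + B q) \<le> \<delta>\<close> holds eventually and
  describes a closed half space, so it is inherited by \<open>c\<close>.
\<close>

lemma zero_if_asymptotic_point:
  assumes w: "- B w \<in> A w" and \<sigma>: "strict_mono \<sigma>" and c: "c \<in> S"
    and hull: "\<And>D. closed D \<Longrightarrow> convex D \<Longrightarrow> \<forall>\<^sub>F n in sequentially. p (\<sigma> n) \<in> D \<Longrightarrow> c \<in> D"
  shows "- B c \<in> A c"
proof (rule zero_if_monotonically_related[OF c])
  fix q a assume a: "a \<in> A q"
  obtain M where M: "\<And>n. norm (p n - q) \<le> M"
    using bounded_minus_comp[OF bounded_p[OF w], of "\<lambda>_. q"] by (auto simp: bounded_iff)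
  have "(\<lambda>n. inner (residual n) (p n - q)) \<longlonglongrightarrow> 0"
  proof (rule Lim_null_comparison)
    show "\<forall>\<^sub>F n in sequentially. norm (inner (residual n) (p n - q)) \<le> norm (residual n) * M"
    proof (intro always_eventually allI)
      fix n
      have "\<bar>inner (residual n) (p n - q)\<bar> \<le> norm (residual n) * norm (p n - q)" by (rule Cauchy_Schwarz_ineq2)
      also have "\<dots> \<le> norm (residual n) * M" using M by (rule mult_left_mono) simp
      finally show "norm (inner (residual n) (p n - q)) \<le> norm (residual n) * M" by simp
    qed
    have "(\<lambda>n. norm (residual n) * M) \<longlonglongrightarrow> norm (0::'a) * M" by (intro tendsto_intros residual_tendsto_0[OF w])
    then show "(\<lambda>n. norm (residual n) * M) \<longlonglongrightarrow> 0" by simp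
  qed
  from LIMSEQ_subseq_LIMSEQ[OF this \<sigma>]
  have lim: "(\<lambda>n. inner (residual (\<sigma> n)) (p (\<sigma> n) - q)) \<longlonglongrightarrow> 0" by (simp add: comp_def)
  show "inner (c - q) (a + B q) \<le> 0"
  proof (rule field_le_epsilon)
    fix \<delta> :: real assume \<delta>: "0 < \<delta>"
    define D where "D = {y. inner (a + B q) y \<le> \<delta> + inner (a + B q) q}"
    have "c \<in> D"
    proof (rule hull)
      show "closed D" "convex D" unfolding D_def by (rule closed_halfspace_le convex_halfspace_le)+
      show "\<forall>\<^sub>F n in sequentially. p (\<sigma> n) \<in> D"
        using order_tendstoD(2)[OF lim \<delta>]
      proof (rule eventually_mono)
        fix n assume "inner (residual (\<sigma> n)) (p (\<sigma> n) - q) < \<delta>"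
        with residual_dominates[OF a, of "\<sigma> n"] show "p (\<sigma> n) \<in> D" by (simp add: D_def inner_simps)
      qed
    qed
    then show "inner (c - q) (a + B q) \<le> 0 + \<delta>" by (simp add: D_def inner_simps inner_commute)
  qed
qed

text \<open>
  Distances to zeros converge, hence so do the inner products with differences of zeros (Opial).
  If \<open>p\<close> failed to converge weakly to the asymptotic point \<open>c\<close>, a subsequence would stay in a half
  space away from \<open>c\<close>; its own asymptotic point \<open>c'\<close> is also a zero, and the common limit of
  \<open>p n \<bullet> (c - c')\<close> gives \<open>c \<bullet> (c - c') = c' \<bullet> (c - c')\<close>.
\<close>

theorem weak_convergence:
  assumes w: "- B w \<in> A w"
  obtains c where "- B c \<in> A c" "weakly_converges_to p c"
    "\<And>D. closed D \<Longrightarrow> convex D \<Longrightarrow> range p \<subseteq> D \<Longrightarrow> c \<in> D"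
proof -
  obtain c where c: "c \<in> S" and
    hull: "\<And>D. closed D \<Longrightarrow> convex D \<Longrightarrow> \<forall>\<^sub>F n in sequentially. p n \<in> D \<Longrightarrow> c \<in> D"
    using bounded_sequence_asymptotic_point[OF S p_mem bounded_p[OF w]] by blast
  have zc: "- B c \<in> A c"
    by (rule zero_if_asymptotic_point[OF w strict_mono_id c]) (use hull in simp)
  have less: "\<forall>\<^sub>F n in sequentially. inner u (p n) < inner u c + \<delta>" if \<delta>: "0 < \<delta>" for u \<delta>
  proof (rule ccontr)
    assume "\<not> ?thesis"
    then have "infinite {n. inner u c + \<delta> \<le> inner u (p n)}"
      by (simp add: not_eventually not_less frequently_cofinite cofinite_eq_sequentially[symmetric])
    then obtain \<sigma> :: "nat \<Rightarrow> nat" where \<sigma>: "strict_mono \<sigma>" "\<And>n. inner u c + \<delta> \<le> inner u (p (\<sigma> n))"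
      using infinite_enumerate by blast
    have "bounded (range (\<lambda>n. p (\<sigma> n)))"
      by (rule bounded_subset[OF bounded_p[OF w]]) auto
    then obtain c' where c': "c' \<in> S" and
      hull': "\<And>D. closed D \<Longrightarrow> convex D \<Longrightarrow> \<forall>\<^sub>F n in sequentially. p (\<sigma> n) \<in> D \<Longrightarrow> c' \<in> D"
      using bounded_sequence_asymptotic_point[OF S p_mem, of \<sigma>] by blast
    have zc': "- B c' \<in> A c'" by (rule zero_if_asymptotic_point[OF w \<sigma>(1) c' hull'])
    define d where "d = c - c'"
    obtain L1 L2 where L: "(\<lambda>n. (norm (x n - c))\<^sup>2) \<longlonglongrightarrow> L1" "(\<lambda>n. (norm (x n - c'))\<^sup>2) \<longlonglongrightarrow> L2"
      using convergent_dist_zero[OF zc] convergent_dist_zero[OF zc'] by (auto simp: convergent_def)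
    define \<kappa> where "\<kappa> = (L2 - L1 + (norm c)\<^sup>2 - (norm c')\<^sup>2) / 2 - inner d 0"
    have "inner d (p n) = ((norm (x n - c'))\<^sup>2 - (norm (x n - c))\<^sup>2 + (norm c)\<^sup>2 - (norm c')\<^sup>2) / 2
        - inner d (x n - p n)" for n
      unfolding d_def power2_norm_eq_inner by (simp add: inner_simps inner_commute field_simps)
    then have lim: "(\<lambda>n. inner d (p n)) \<longlonglongrightarrow> \<kappa>"
      unfolding \<kappa>_def by (simp only:) (intro tendsto_intros L x_minus_p_tendsto_0[OF w]; simp)
    have lim': "(\<lambda>n. inner d (p (\<sigma> n))) \<longlonglongrightarrow> \<kappa>"
      using LIMSEQ_subseq_LIMSEQ[OF lim \<sigma>(1)] by (simp add: comp_def)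
    have "\<bar>inner d c - inner d c'\<bar> \<le> 0"
    proof (rule field_le_epsilon)
      fix \<eta> :: real assume \<eta>: "0 < \<eta>"
      define D where "D = {y. inner d y \<le> \<kappa> + \<eta> / 2} \<inter> {y. inner d y \<ge> \<kappa> - \<eta> / 2}"
      have D: "closed D" "convex D"
        unfolding D_def by (intro closed_Int convex_Int closed_halfspace_le convex_halfspace_le
            closed_halfspace_ge convex_halfspace_ge)+
      have inD: "y \<in> D" if "dist (inner d y) \<kappa> < \<eta> / 2" for y
      proof -
        have "inner d y \<le> \<kappa> + \<eta> / 2" "inner d y \<ge> \<kappa> - \<eta> / 2"
          using that unfolding dist_real_def by linarith+
        then show ?thesis by (simp add: D_def)
      qed
      have "\<forall>\<^sub>F n in sequentially. p n \<in> D" "\<forall>\<^sub>F n in sequentially. p (\<sigma> n) \<in> D"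
        by (rule eventually_mono[OF tendstoD[OF lim half_gt_zero[OF \<eta>]] inD]
          eventually_mono[OF tendstoD[OF lim' half_gt_zero[OF \<eta>]] inD], assumption)+
      with D have "c \<in> D" "c' \<in> D" using hull hull' by blast+
      then show "\<bar>inner d c - inner d c'\<bar> \<le> 0 + \<eta>" by (auto simp: D_def)
    qed
    then have "inner d d = 0" by (simp add: d_def inner_simps)
    then have "c' = c" by (simp add: d_def)
    moreover have "c' \<in> {y. inner u y \<ge> inner u c + \<delta>}"
      using \<sigma>(2) by (intro hull' closed_halfspace_ge convex_halfspace_ge) auto
    ultimately show False using \<delta> by simp
  qed
  have "weakly_converges_to p c"
    unfolding weakly_converges_to_def
  proof (intro allI tendstoI)
    fix u and \<delta> :: real assume "0 < \<delta>"
    from less[OF this, of u] less[OF this, of "- u"]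
    show "\<forall>\<^sub>F n in sequentially. dist (inner (p n) u) (inner c u) < \<delta>"
      by eventually_elim (auto simp: dist_real_def inner_commute abs_less_iff)
  qed
  with zc show thesis
  proof (rule that)
    show "c \<in> D" if "closed D" "convex D" "range p \<subseteq> D" for D
      using that by (intro hull always_eventually allI) auto
  qed
qed

end

section \<open>Finite direct sums\<close>

text \<open>
  The Hilbert space \<open>\<G>\<^sub>1 \<oplus> \<dots> \<oplus> \<G>\<^sub>m\<close> has to be a subspace of an inner product space that is a type.
  Since \<open>m\<close> is a variable, the carrier consists of the finitely supported sequences of vectors.
\<close>

typedef (overloaded) 'a finsupp_seq = "{w :: nat \<Rightarrow> 'a::zero. finite {i. w i \<noteq> 0}}"
  morphisms entry Finsupp
  by (rule exI[of _ "\<lambda>_. 0"]) simp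

lemma finite_entry_support [simp]: "finite {i. entry w i \<noteq> 0}"
  using entry[of w] by simp

lemma entry_Finsupp: "finite {i. w i \<noteq> 0} \<Longrightarrow> entry (Finsupp w) = w"
  by (simp add: Finsupp_inverse)

lemma finsupp_seq_eqI: "(\<And>i. entry v i = entry w i) \<Longrightarrow> v = w"
  by (simp add: entry_inject[symmetric] fun_eq_iff)

instantiation finsupp_seq :: (real_vector) real_vector
begin

definition "0 = Finsupp (\<lambda>_. 0)"
definition "v + w = Finsupp (\<lambda>i. entry v i + entry w i)"
definition "v - w = Finsupp (\<lambda>i. entry v i - entry w i)"
definition "- v = Finsupp (\<lambda>i. - entry v i)"
definition "c *\<^sub>R v = Finsupp (\<lambda>i. c *\<^sub>R entry v i)"

lemma entry_zero [simp]: "entry 0 i = 0"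
  by (simp add: zero_finsupp_seq_def entry_Finsupp)

lemma entry_add [simp]: "entry (v + w) i = entry v i + entry w i"
proof -
  have "finite {i. entry v i + entry w i \<noteq> 0}"
    by (rule finite_subset[of _ "{i. entry v i \<noteq> 0} \<union> {i. entry w i \<noteq> 0}"]) auto
  then show ?thesis by (simp add: plus_finsupp_seq_def entry_Finsupp)
qed

lemma entry_diff [simp]: "entry (v - w) i = entry v i - entry w i"
proof -
  have "finite {i. entry v i - entry w i \<noteq> 0}"
    by (rule finite_subset[of _ "{i. entry v i \<noteq> 0} \<union> {i. entry w i \<noteq> 0}"]) auto
  then show ?thesis by (simp add: minus_finsupp_seq_def entry_Finsupp)
qed

lemma entry_minus [simp]: "entry (- v) i = - entry v i"
  by (simp add: uminus_finsupp_seq_def entry_Finsupp)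

lemma entry_scaleR [simp]: "entry (c *\<^sub>R v) i = c *\<^sub>R entry v i"
proof -
  have "finite {i. c *\<^sub>R entry v i \<noteq> 0}"
    by (rule finite_subset[of _ "{i. entry v i \<noteq> 0}"]) auto
  then show ?thesis by (simp add: scaleR_finsupp_seq_def entry_Finsupp)
qed

instance
  by standard (auto intro!: finsupp_seq_eqI simp: scaleR_add_right scaleR_add_left)

end

instantiation finsupp_seq :: (real_inner) real_inner
begin

definition "inner v w = (\<Sum>i | entry v i \<noteq> 0. inner (entry v i) (entry w i))"
definition "norm (v :: 'a finsupp_seq) = sqrt (inner v v)"
definition "sgn (v :: 'a finsupp_seq) = inverse (norm v) *\<^sub>R v"
definition "dist v w = norm (v - w :: 'a finsupp_seq)"
definition "uniformity = (INF e\<in>{0<..}. principal {(x, y :: 'a finsupp_seq). dist x y < e})"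
definition "open U = (\<forall>x\<in>U. eventually (\<lambda>(x', y). x' = x \<longrightarrow> y \<in> U)
  (uniformity :: ('a finsupp_seq \<times> 'a finsupp_seq) filter))"

lemma inner_finsupp_seq:
  assumes "finite I" "\<And>i. i \<notin> I \<Longrightarrow> entry v i = 0 \<or> entry w i = 0"
  shows "inner v w = (\<Sum>i\<in>I. inner (entry v i) (entry w i))"
proof -
  have "inner v w = (\<Sum>i\<in>I \<union> {i. entry v i \<noteq> 0}. inner (entry v i) (entry w i))"
    unfolding inner_finsupp_seq_def using assms(1) by (intro sum.mono_neutral_left) auto
  also have "\<dots> = (\<Sum>i\<in>I. inner (entry v i) (entry w i))"
    using assms(1) by (intro sum.mono_neutral_right) (auto dest: assms(2))
  finally show ?thesis .
qed

instance
proof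
  fix u v w :: "'a finsupp_seq" and r :: real
  define I where "I = {i. entry u i \<noteq> 0} \<union> {i. entry v i \<noteq> 0} \<union> {i. entry w i \<noteq> 0}"
  have "inner u v = (\<Sum>i\<in>I. inner (entry u i) (entry v i))"
    "inner v u = (\<Sum>i\<in>I. inner (entry v i) (entry u i))"
    "inner (u + v) w = (\<Sum>i\<in>I. inner (entry (u + v) i) (entry w i))"
    "inner u w = (\<Sum>i\<in>I. inner (entry u i) (entry w i))"
    "inner v w = (\<Sum>i\<in>I. inner (entry v i) (entry w i))"
    "inner (r *\<^sub>R u) v = (\<Sum>i\<in>I. inner (entry (r *\<^sub>R u) i) (entry v i))"
    by (rule inner_finsupp_seq; auto simp: I_def)+
  then show "inner (u + v) w = inner u w + inner v w" "inner (r *\<^sub>R u) v = r * inner u v"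
    "inner u v = inner v u"
    by (simp_all add: inner_add_left sum.distrib sum_distrib_left) (simp add: inner_commute)
  show "0 \<le> inner u u" unfolding inner_finsupp_seq_def by (intro sum_nonneg) simp
  show "inner u u = 0 \<longleftrightarrow> u = 0"
  proof
    assume "inner u u = 0"
    then have "\<forall>i\<in>{i. entry u i \<noteq> 0}. inner (entry u i) (entry u i) = 0"
      unfolding inner_finsupp_seq_def by (subst (asm) sum_nonneg_eq_0_iff) auto
    then show "u = 0" by (intro finsupp_seq_eqI) auto
  qed (simp add: inner_finsupp_seq_def)
qed (fact norm_finsupp_seq_def sgn_finsupp_seq_def dist_finsupp_seq_def
    uniformity_finsupp_seq_def open_finsupp_seq_def)+

end

definition direct_sum :: "nat set \<Rightarrow> (nat \<Rightarrow> 'a::real_inner set) \<Rightarrow> 'a finsupp_seq set" where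
  "direct_sum I \<G> = {w. (\<forall>i\<in>I. entry w i \<in> \<G> i) \<and> (\<forall>i. i \<notin> I \<longrightarrow> entry w i = 0)}"

lemma inner_direct_sum:
  assumes "finite I" "w \<in> direct_sum I \<G>"
  shows "inner v w = (\<Sum>i\<in>I. inner (entry v i) (entry w i))"
  using assms by (intro inner_finsupp_seq) (auto simp: direct_sum_def)

lemma norm_direct_sum:
  assumes "finite I" "w \<in> direct_sum I \<G>"
  shows "(norm w)\<^sup>2 = (\<Sum>i\<in>I. (norm (entry w i))\<^sup>2)"
  unfolding power2_norm_eq_inner using inner_direct_sum[OF assms] .

lemma norm_entry_le:
  assumes "finite I" "w \<in> direct_sum I \<G>" "i \<in> I"
  shows "norm (entry w i) \<le> norm w"
proof (rule power2_le_imp_le)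
  show "(norm (entry w i))\<^sup>2 \<le> (norm w)\<^sup>2"
    unfolding norm_direct_sum[OF assms(1,2)] by (rule member_le_sum[OF assms(3) _ assms(1)]) simp
qed simp

definition pack :: "nat set \<Rightarrow> (nat \<Rightarrow> 'a::zero) \<Rightarrow> 'a finsupp_seq" where
  "pack I w = Finsupp (\<lambda>i. if i \<in> I then w i else 0)"

lemma entry_pack:
  assumes "finite I"
  shows "entry (pack I w) i = (if i \<in> I then w i else 0)"
proof -
  have "finite {i. (if i \<in> I then w i else 0) \<noteq> 0}"
    by (rule finite_subset[OF _ assms]) auto
  then show ?thesis by (simp add: pack_def entry_Finsupp)
qed

lemma pack_in_direct_sum_iff:
  "finite I \<Longrightarrow> pack I w \<in> direct_sum I \<G> \<longleftrightarrow> (\<forall>i\<in>I. w i \<in> \<G> i)"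
  by (auto simp: direct_sum_def entry_pack)

lemma hilbert_subspace_direct_sum:
  assumes fin: "finite I" and \<G>: "\<And>i. i \<in> I \<Longrightarrow> hilbert_subspace (\<G> i)"
  shows "hilbert_subspace (direct_sum I \<G>)"
  unfolding hilbert_subspace_def
proof
  have sub: "subspace (\<G> i)" if "i \<in> I" for i using \<G>[OF that] by (simp add: hilbert_subspace_def)
  show S: "subspace (direct_sum I \<G>)"
    using sub unfolding direct_sum_def
    by (auto simp: subspace_def[of "Collect _"] subspace_0 subspace_add subspace_scale)
  show "complete (direct_sum I \<G>)"
    unfolding complete_def
  proof (intro allI impI)
    fix X :: "nat \<Rightarrow> _" assume X: "(\<forall>n. X n \<in> direct_sum I \<G>) \<and> Cauchy X"
    have "\<exists>l\<in>\<G> i. (\<lambda>n. entry (X n) i) \<longlonglongrightarrow> l" if i: "i \<in> I" for i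
    proof -
      have le: "dist (entry (X n) i) (entry (X k) i) \<le> dist (X n) (X k)" for n k
        using norm_entry_le[OF fin subspace_diff[OF S] i, of "X n" "X k"] X by (simp add: dist_norm)
      have "Cauchy (\<lambda>n. entry (X n) i)"
        using X le unfolding Cauchy_def by (meson le_less_trans)
      moreover have "entry (X n) i \<in> \<G> i" for n using X i by (auto simp: direct_sum_def)
      ultimately show ?thesis
        using \<G>[OF i] unfolding hilbert_subspace_def complete_def
        by (elim conjE allE[of _ "\<lambda>n. entry (X n) i"]) blast
    qed
    then obtain l where l: "\<And>i. i \<in> I \<Longrightarrow> l i \<in> \<G> i" "\<And>i. i \<in> I \<Longrightarrow> (\<lambda>n. entry (X n) i) \<longlonglongrightarrow> l i"
      by metis
    define w where "w = pack I l"
    have w: "entry w i = (if i \<in> I then l i else 0)" for i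
      unfolding w_def by (rule entry_pack[OF fin])
    have wS: "w \<in> direct_sum I \<G>" using l by (auto simp: direct_sum_def w)
    have "(\<lambda>n. \<Sum>i\<in>I. (norm (entry (X n) i - l i))\<^sup>2) \<longlonglongrightarrow> (\<Sum>i\<in>I. (norm (l i - l i))\<^sup>2)"
      by (intro tendsto_intros l)
    moreover have "(norm (X n - w))\<^sup>2 = (\<Sum>i\<in>I. (norm (entry (X n) i - l i))\<^sup>2)" for n
      using norm_direct_sum[OF fin subspace_diff[OF S _ wS], of "X n"] X by (simp add: w)
    ultimately have "(\<lambda>n. (norm (X n - w))\<^sup>2) \<longlonglongrightarrow> 0" by simp
    then have "X \<longlonglongrightarrow> w" by (simp add: LIM_zero_iff tendsto_norm_zero_iff)
    then show "\<exists>l\<in>direct_sum I \<G>. X \<longlonglongrightarrow> l" using wS by blast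
  qed
qed

lemma hilbert_subspace_Times:
  assumes "hilbert_subspace S" "hilbert_subspace T"
  shows "hilbert_subspace (S \<times> T)"
  unfolding hilbert_subspace_def
proof
  show "subspace (S \<times> T)" using assms by (intro subspace_Times) (auto simp: hilbert_subspace_def)
  show "complete (S \<times> T)"
    unfolding complete_def
  proof (intro allI impI)
    fix X assume X: "(\<forall>n. X n \<in> S \<times> T) \<and> Cauchy X"
    have "Cauchy (\<lambda>n. fst (X n))" "Cauchy (\<lambda>n. snd (X n))"
      using X by (auto intro: Cauchy_fst Cauchy_snd)
    moreover have "fst (X n) \<in> S" "snd (X n) \<in> T" for n using X by (auto simp: mem_Times_iff)
    ultimately obtain a b where ab: "a \<in> S" "(\<lambda>n. fst (X n)) \<longlonglongrightarrow> a" "b \<in> T" "(\<lambda>n. snd (X n)) \<longlonglongrightarrow> b"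
      using assms unfolding hilbert_subspace_def complete_def by metis
    then show "\<exists>l\<in>S \<times> T. X \<longlonglongrightarrow> l"
      using tendsto_Pair[OF ab(2,4)] by (intro bexI[of _ "(a, b)"]) auto
  qed
qed

section \<open>The primal-dual inclusion\<close>

lemma adjoint_diff:
  fixes A :: "'a::{real_inner, complete_space} \<Rightarrow> 'b::real_inner"
  assumes "bounded_linear A"
  shows "adjoint A (a - b) = adjoint A a - adjoint A b"
  by (rule vector_eq_ldot[THEN iffD1]) (simp add: inner_diff_right inner_adjoint[OF assms])

lemma norm_sum_adjoint_le:
  fixes L :: "nat \<Rightarrow> 'a::{real_inner, complete_space} \<Rightarrow> 'b::real_inner"
  assumes lin: "\<And>i. i \<in> I \<Longrightarrow> bounded_linear (L i)"
  shows "(norm (\<Sum>i\<in>I. adjoint (L i) (w i)))\<^sup>2 \<le> (\<Sum>i\<in>I. (onorm (L i))\<^sup>2) * (\<Sum>i\<in>I. (norm (w i))\<^sup>2)"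
proof -
  define s where "s = (\<Sum>i\<in>I. adjoint (L i) (w i))"
  define \<Lambda> where "\<Lambda> = L2_set (\<lambda>i. onorm (L i)) I"
  define W where "W = L2_set (\<lambda>i. norm (w i)) I"
  have "norm s * norm s = inner s s" by (simp add: power2_norm_eq_inner[symmetric] power2_eq_square)
  also have "\<dots> = (\<Sum>i\<in>I. inner (L i s) (w i))"
    by (subst (2) s_def) (simp add: inner_sum_right inner_adjoint lin)
  also have "\<dots> \<le> (\<Sum>i\<in>I. norm s * (\<bar>onorm (L i)\<bar> * \<bar>norm (w i)\<bar>))"
  proof (rule sum_mono)
    fix i assume i: "i \<in> I"
    have "inner (L i s) (w i) \<le> norm (L i s) * norm (w i)" by (rule norm_cauchy_schwarz)
    also have "\<dots> \<le> (onorm (L i) * norm s) * norm (w i)"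
      by (intro mult_right_mono onorm lin i) simp
    finally show "inner (L i s) (w i) \<le> norm s * (\<bar>onorm (L i)\<bar> * \<bar>norm (w i)\<bar>)"
      using onorm_pos_le[OF lin[OF i]] by (simp add: ac_simps)
  qed
  also have "\<dots> = norm s * (\<Sum>i\<in>I. \<bar>onorm (L i)\<bar> * \<bar>norm (w i)\<bar>)" by (simp add: sum_distrib_left)
  also have "\<dots> \<le> norm s * (\<Lambda> * W)"
    unfolding \<Lambda>_def W_def by (intro mult_left_mono L2_set_mult_ineq) simp
  finally have "norm s \<le> \<Lambda> * W"
    by (cases "s = 0") (auto simp: \<Lambda>_def W_def)
  then have "(norm s)\<^sup>2 \<le> (\<Lambda> * W)\<^sup>2" by (rule power_mono) simp
  also have "\<dots> = (\<Sum>i\<in>I. (onorm (L i))\<^sup>2) * (\<Sum>i\<in>I. (norm (w i))\<^sup>2)"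
    unfolding power_mult_distrib \<Lambda>_def W_def L2_set_def by (simp add: sum_nonneg)
  finally show ?thesis by (simp add: s_def)
qed

locale primal_dual_problem =
  fixes m :: nat
    and \<G> :: "nat \<Rightarrow> 'g::real_inner set"
    and f :: "'h::{real_inner, complete_space} \<Rightarrow> ereal"
    and h :: "'h \<Rightarrow> real"
    and \<mu> :: real
    and z :: 'h
    and r :: "nat \<Rightarrow> 'g"
    and g l :: "nat \<Rightarrow> 'g \<Rightarrow> ereal"
    and \<nu> :: "nat \<Rightarrow> real"
    and L :: "nat \<Rightarrow> 'h \<Rightarrow> 'g"
  assumes G_hilbert: "\<And>i. i \<in> {1..m} \<Longrightarrow> hilbert_subspace (\<G> i)"
    and f_Gamma: "f \<in> Gamma_on UNIV"
    and h_convex: "convex_on UNIV h"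
    and h_diff: "\<And>y. h differentiable (at y)"
    and h_grad: "\<mu>-lipschitz_on UNIV (gradient_on UNIV h)"
    and r_mem: "\<And>i. i \<in> {1..m} \<Longrightarrow> r i \<in> \<G> i"
    and g_Gamma: "\<And>i. i \<in> {1..m} \<Longrightarrow> g i \<in> Gamma_on (\<G> i)"
    and l_Gamma: "\<And>i. i \<in> {1..m} \<Longrightarrow> l i \<in> Gamma_on (\<G> i)"
    and nu_pos: "\<And>i. i \<in> {1..m} \<Longrightarrow> \<nu> i > 0"
    and l_strong: "\<And>i. i \<in> {1..m} \<Longrightarrow> strongly_convex_on (\<G> i) (inverse (\<nu> i)) (l i)"
    and L_lin: "\<And>i. i \<in> {1..m} \<Longrightarrow> bounded_linear (L i)"
    and L_range: "\<And>i. i \<in> {1..m} \<Longrightarrow> range (L i) \<subseteq> \<G> i"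
    and z_ran: "z \<in> op_ran (\<lambda>y. subdiff_on UNIV f y
          + (\<Sum>i\<in>{1..m}. adjoint (L i) `
               parallel_sum (subdiff_on (\<G> i) (g i)) (subdiff_on (\<G> i) (l i)) (L i y - r i))
          + {gradient_on UNIV h y})"
    and g_Lip: "\<And>i. i \<in> {1..m} \<Longrightarrow> elipschitz_on (\<G> i) (g i)"
begin

abbreviation "gradh \<equiv> gradient_on UNIV h"
abbreviation "gconj i \<equiv> conjugate_on (\<G> i) (g i)"
abbreviation "lconj i \<equiv> conjugate_on (\<G> i) (l i)"
abbreviation "gradl i \<equiv> gradient_on (\<G> i) (\<lambda>w. real_of_ereal (lconj i w))"

lemma G_sub: "i \<in> {1..m} \<Longrightarrow> subspace (\<G> i)"
  using G_hilbert by (simp add: hilbert_subspace_def)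

lemma L_mem: "i \<in> {1..m} \<Longrightarrow> L i y \<in> \<G> i"
  using L_range by blast

lemma proper_g: "i \<in> {1..m} \<Longrightarrow> proper_on (\<G> i) (g i)" and proper_l: "i \<in> {1..m} \<Longrightarrow> proper_on (\<G> i) (l i)"
  using g_Gamma l_Gamma by (auto simp: Gamma_on_def)

lemma qualified_point:
  obtains xh vh y1 y2 where
    "z - gradh xh - (\<Sum>i\<in>{1..m}. adjoint (L i) (vh i)) \<in> subdiff_on UNIV f xh"
    "\<And>i. i \<in> {1..m} \<Longrightarrow> vh i \<in> subdiff_on (\<G> i) (g i) (y1 i)"
    "\<And>i. i \<in> {1..m} \<Longrightarrow> vh i \<in> subdiff_on (\<G> i) (l i) (y2 i)"
    "\<And>i. i \<in> {1..m} \<Longrightarrow> y1 i + y2 i = L i xh - r i"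
proof -
  obtain xh where "z \<in> subdiff_on UNIV f xh
          + (\<Sum>i\<in>{1..m}. adjoint (L i) `
               parallel_sum (subdiff_on (\<G> i) (g i)) (subdiff_on (\<G> i) (l i)) (L i xh - r i))
          + {gradh xh}"
    using z_ran by (auto simp: op_ran_def)
  then obtain a s where a: "a \<in> subdiff_on UNIV f xh" and
    s: "s \<in> (\<Sum>i\<in>{1..m}. adjoint (L i) `
               parallel_sum (subdiff_on (\<G> i) (g i)) (subdiff_on (\<G> i) (l i)) (L i xh - r i))" and
    z: "z = a + s + gradh xh"
    by (auto simp: set_plus_def)
  obtain t where st: "s = (\<Sum>i\<in>{1..m}. t i)" and
    t: "\<And>i. i \<in> {1..m} \<Longrightarrow> t i \<in> adjoint (L i) `
               parallel_sum (subdiff_on (\<G> i) (g i)) (subdiff_on (\<G> i) (l i)) (L i xh - r i)"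
    using s by (auto simp: set_sum_alt)
  have "\<exists>v y1 y2. t i = adjoint (L i) v \<and> v \<in> subdiff_on (\<G> i) (g i) y1
      \<and> v \<in> subdiff_on (\<G> i) (l i) y2 \<and> y1 + y2 = L i xh - r i" if "i \<in> {1..m}" for i
    using t[OF that] unfolding parallel_sum_def op_inv_def set_plus_def by fastforce
  then obtain vh y1 y2 where v: "\<And>i. i \<in> {1..m} \<Longrightarrow> t i = adjoint (L i) (vh i)
      \<and> vh i \<in> subdiff_on (\<G> i) (g i) (y1 i) \<and> vh i \<in> subdiff_on (\<G> i) (l i) (y2 i)
      \<and> y1 i + y2 i = L i xh - r i"
    by metis
  have "s = (\<Sum>i\<in>{1..m}. adjoint (L i) (vh i))" unfolding st using v by (intro sum.cong) auto
  then have "z - gradh xh - (\<Sum>i\<in>{1..m}. adjoint (L i) (vh i)) = a" using z by simp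
  then show thesis using a v by (intro that[of xh vh y1 y2]) auto
qed

lemma common_subgradient:
  assumes "i \<in> {1..m}"
  obtains u y1 y2 where "u \<in> subdiff_on (\<G> i) (g i) y1" "u \<in> subdiff_on (\<G> i) (l i) y2"
  using qualified_point assms by (metis (no_types, lifting))

lemma f_minorized: "norm_minorized_on UNIV f"
  using qualified_point subdiff_on_imp_norm_minorized by (metis (no_types, lifting))

lemma gconj:
  assumes i: "i \<in> {1..m}"
  shows gconj_Gamma: "gconj i \<in> Gamma_on (\<G> i)" and gconj_minorized: "norm_minorized_on (\<G> i) (gconj i)"
proof -
  obtain u y where u: "u \<in> subdiff_on (\<G> i) (g i) y" using common_subgradient[OF i] by metis
  show "gconj i \<in> Gamma_on (\<G> i)" by (rule conjugate_on_Gamma[OF proper_g[OF i] u])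
  show "norm_minorized_on (\<G> i) (gconj i)"
    by (rule subdiff_on_imp_norm_minorized[OF subdiff_on_conjugate[OF u]])
qed

lemma gradl:
  assumes i: "i \<in> {1..m}"
  shows gradl_subdiff: "v \<in> \<G> i \<Longrightarrow> v \<in> subdiff_on (\<G> i) (l i) (gradl i v)"
    and gradl_eqI: "v \<in> subdiff_on (\<G> i) (l i) y \<Longrightarrow> gradl i v = y"
    and gradl_Lipschitz: "v \<in> \<G> i \<Longrightarrow> w \<in> \<G> i \<Longrightarrow> norm (gradl i v - gradl i w) \<le> \<nu> i * norm (v - w)"
proof -
  obtain u y0 where u: "u \<in> subdiff_on (\<G> i) (l i) y0" using common_subgradient[OF i] by metis
  have c: "0 < inverse (\<nu> i)" using nu_pos[OF i] by simp
  note * = gradient_conjugate_strongly_convex[OF G_hilbert[OF i] l_Gamma[OF i] c l_strong[OF i] u]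
  show "v \<in> \<G> i \<Longrightarrow> v \<in> subdiff_on (\<G> i) (l i) (gradl i v)" by (rule *)
  show "v \<in> subdiff_on (\<G> i) (l i) y \<Longrightarrow> gradl i v = y" by (rule *)
  show "v \<in> \<G> i \<Longrightarrow> w \<in> \<G> i \<Longrightarrow> norm (gradl i v - gradl i w) \<le> \<nu> i * norm (v - w)"
    using *(3)[of v w] nu_pos[OF i] by (simp add: divide_inverse mult.commute)
qed

lemma gradl_mem: "i \<in> {1..m} \<Longrightarrow> v \<in> \<G> i \<Longrightarrow> gradl i v \<in> \<G> i"
  using gradl_subdiff subdiff_on_memD(1) by blast

text \<open>
  The optimality system reads \<open>0 \<in> A q + B q\<close> with \<open>A\<close> the subdifferential part and \<open>B\<close> the
  Lipschitz part, which contains the skew coupling \<open>(x, v) \<mapsto> (\<Sum> L\<^sub>i\<^sup>* v\<^sub>i, - L\<^sub>i x)\<close>. In this splitting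
  the algorithm is Tseng's iteration.
\<close>

definition S :: "('h \<times> 'g finsupp_seq) set" where
  "S = UNIV \<times> direct_sum {1..m} \<G>"

definition A :: "'h \<times> 'g finsupp_seq \<Rightarrow> ('h \<times> 'g finsupp_seq) set" where
  "A q = {a. q \<in> S \<and> a \<in> S \<and> fst a + z \<in> subdiff_on UNIV f (fst q)
    \<and> (\<forall>i\<in>{1..m}. entry (snd a) i - r i \<in> subdiff_on (\<G> i) (gconj i) (entry (snd q) i))}"

definition B :: "'h \<times> 'g finsupp_seq \<Rightarrow> 'h \<times> 'g finsupp_seq" where
  "B q = (gradh (fst q) + (\<Sum>i\<in>{1..m}. adjoint (L i) (entry (snd q) i)),
          pack {1..m} (\<lambda>i. gradl i (entry (snd q) i) - L i (fst q)))"

lemma B_pack: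
  "B (y, pack {1..m} w) = (gradh y + (\<Sum>i\<in>{1..m}. adjoint (L i) (w i)),
    pack {1..m} (\<lambda>i. gradl i (w i) - L i y))"
proof -
  have "(\<Sum>i\<in>{1..m}. adjoint (L i) (entry (pack {1..m} w) i)) = (\<Sum>i\<in>{1..m}. adjoint (L i) (w i))"
    by (intro sum.cong refl) (simp add: entry_pack)
  moreover have "pack {1..m} (\<lambda>i. gradl i (entry (pack {1..m} w) i) - L i y)
      = pack {1..m} (\<lambda>i. gradl i (w i) - L i y)"
    by (rule finsupp_seq_eqI) (simp add: entry_pack)
  ultimately show ?thesis by (simp add: B_def)
qed

lemma S_hilbert: "hilbert_subspace S"
  unfolding S_def
  by (intro hilbert_subspace_Times hilbert_subspace_direct_sum G_hilbert)
    (auto simp: hilbert_subspace_def complete_UNIV)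

lemma S_sub: "subspace S" using S_hilbert by (simp add: hilbert_subspace_def)

lemma entry_mem: "q \<in> S \<Longrightarrow> i \<in> {1..m} \<Longrightarrow> entry (snd q) i \<in> \<G> i"
  by (auto simp: S_def direct_sum_def)

lemma pack_mem: "(y, pack {1..m} w) \<in> S \<longleftrightarrow> (\<forall>i\<in>{1..m}. w i \<in> \<G> i)"
  by (simp add: S_def pack_in_direct_sum_iff)

lemma inner_S:
  assumes "q \<in> S"
  shows "inner p q = inner (fst p) (fst q) + (\<Sum>i\<in>{1..m}. inner (entry (snd p) i) (entry (snd q) i))"
  using assms inner_direct_sum[of "{1..m}" "snd q" \<G> "snd p"]
  by (auto simp: S_def inner_prod_def)

lemma norm_S:
  assumes "q \<in> S"
  shows "(norm q)\<^sup>2 = (norm (fst q))\<^sup>2 + (\<Sum>i\<in>{1..m}. (norm (entry (snd q) i))\<^sup>2)"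
  unfolding power2_norm_eq_inner inner_S[OF assms] ..

lemma B_mem: "q \<in> S \<Longrightarrow> B q \<in> S"
  unfolding B_def pack_mem by (auto intro!: subspace_diff G_sub gradl_mem L_mem entry_mem)

lemma gradh_mono: "0 \<le> inner (gradh a - gradh b) (a - b)"
  using convex_above_gradient[OF h_convex h_diff, of a b]
    convex_above_gradient[OF h_convex h_diff, of b a]
  by (simp add: inner_simps)

text \<open>The coupling terms cancel because \<open>L\<^sub>i\<^sup>*\<close> and \<open>- L\<^sub>i\<close> enter as a skew pair.\<close>

lemma B_mono:
  assumes q: "q \<in> S" and w: "w \<in> S"
  shows "0 \<le> inner (B q - B w) (q - w)"
proof -
  define d where "d = q - w"
  have d: "d \<in> S" unfolding d_def using S_sub q w by (rule subspace_diff)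
  have 1: "inner (adjoint (L i) (entry (snd q) i) - adjoint (L i) (entry (snd w) i)) (fst d)
     = inner (L i (fst q) - L i (fst w)) (entry (snd d) i)" if "i \<in> {1..m}" for i
  proof -
    have "inner (adjoint (L i) (entry (snd q) i) - adjoint (L i) (entry (snd w) i)) (fst d)
        = inner (fst d) (adjoint (L i) (entry (snd d) i))"
      by (simp add: d_def adjoint_diff[OF L_lin[OF that]] inner_commute)
    also have "\<dots> = inner (L i (fst d)) (entry (snd d) i)" by (rule inner_adjoint[OF L_lin[OF that]])
    finally show ?thesis
      by (simp add: d_def linear_diff[OF bounded_linear.linear[OF L_lin[OF that]]])
  qed
  have 2: "(\<Sum>i\<in>{1..m}. inner (adjoint (L i) (entry (snd q) i) - adjoint (L i) (entry (snd w) i)) (fst d))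
     = (\<Sum>i\<in>{1..m}. inner (L i (fst q) - L i (fst w)) (entry (snd d) i))"
    by (rule sum.cong[OF refl 1])
  have "inner (B q - B w) d = inner (gradh (fst q) - gradh (fst w)) (fst d)
     + (\<Sum>i\<in>{1..m}. inner (adjoint (L i) (entry (snd q) i) - adjoint (L i) (entry (snd w) i)) (fst d))
     + (\<Sum>i\<in>{1..m}. inner (gradl i (entry (snd q) i) - gradl i (entry (snd w) i)
          - (L i (fst q) - L i (fst w))) (entry (snd d) i))"
    unfolding inner_S[OF d]
    by (simp add: B_def entry_pack inner_add_left inner_diff_left inner_sum_left sum_subtractf)
  also have "\<dots> = inner (gradh (fst q) - gradh (fst w)) (fst d)
     + (\<Sum>i\<in>{1..m}. inner (gradl i (entry (snd q) i) - gradl i (entry (snd w) i)) (entry (snd d) i))"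
    unfolding 2 by (simp add: inner_diff_left sum_subtractf)
  also have "\<dots> \<ge> 0"
  proof (intro add_nonneg_nonneg sum_nonneg)
    show "0 \<le> inner (gradh (fst q) - gradh (fst w)) (fst d)" unfolding d_def using gradh_mono by simp
    show "0 \<le> inner (gradl i (entry (snd q) i) - gradl i (entry (snd w) i)) (entry (snd d) i)"
      if "i \<in> {1..m}" for i
      using subdiff_on_monotone[OF gradl_subdiff gradl_subdiff, OF that entry_mem[OF q that] that entry_mem[OF w that]]
      by (simp add: d_def inner_commute)
  qed
  finally show ?thesis by (simp add: d_def)
qed

text \<open>
  The gradient part acts componentwise, with the largest of the constants \<open>\<mu>, \<nu>\<^sub>i\<close>. The coupling part
  has norm at most \<open>(\<Sum> \<parallel>L\<^sub>i\<parallel>\<^sup>2)\<^sup>1\<^sup>/\<^sup>2\<close>.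
\<close>

lemma B_Lipschitz:
  assumes q: "q \<in> S" and w: "w \<in> S"
  shows "norm (B q - B w) \<le> (Max (insert \<mu> (\<nu> ` {1..m})) + sqrt (\<Sum>i\<in>{1..m}. (onorm (L i))\<^sup>2)) * norm (q - w)"
proof -
  define M where "M = Max (insert \<mu> (\<nu> ` {1..m}))"
  define \<Lambda> where "\<Lambda> = (\<Sum>i\<in>{1..m}. (onorm (L i))\<^sup>2)"
  define d where "d = q - w"
  have d: "d \<in> S" unfolding d_def using S_sub q w by (rule subspace_diff)
  have \<mu>: "0 \<le> \<mu>" using h_grad by (rule lipschitz_on_nonneg)
  have M: "\<mu> \<le> M" unfolding M_def by (rule Max_ge) auto
  have M': "\<nu> i \<le> M" if "i \<in> {1..m}" for i unfolding M_def using that by (intro Max_ge) auto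
  define D where "D = (gradh (fst q) - gradh (fst w),
    pack {1..m} (\<lambda>i. gradl i (entry (snd q) i) - gradl i (entry (snd w) i)))"
  define K where "K = (\<Sum>i\<in>{1..m}. adjoint (L i) (entry (snd d) i), pack {1..m} (\<lambda>i. - L i (fst d)))"
  have DS: "D \<in> S" unfolding D_def pack_mem
    by (auto intro!: subspace_diff G_sub gradl_mem entry_mem q w)
  have KS: "K \<in> S" unfolding K_def pack_mem
    by (auto intro!: subspace_neg G_sub L_mem)
  have split: "B q - B w = D + K"
  proof (rule prod_eqI)
    have "(\<Sum>i\<in>{1..m}. adjoint (L i) (entry (snd d) i))
        = (\<Sum>i\<in>{1..m}. adjoint (L i) (entry (snd q) i) - adjoint (L i) (entry (snd w) i))"
      unfolding d_def by (intro sum.cong refl) (simp add: adjoint_diff[OF L_lin])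
    then show "fst (B q - B w) = fst (D + K)"
      by (simp add: B_def D_def K_def sum_subtractf)
    have "L i (fst d) = L i (fst q) - L i (fst w)" if "i \<in> {1..m}" for i
      unfolding d_def using linear_diff[OF bounded_linear.linear[OF L_lin[OF that]]] by simp
    then show "snd (B q - B w) = snd (D + K)"
      by (intro finsupp_seq_eqI) (simp add: B_def D_def K_def entry_pack)
  qed
  have "(norm D)\<^sup>2 \<le> M\<^sup>2 * (norm (fst d))\<^sup>2 + (\<Sum>i\<in>{1..m}. M\<^sup>2 * (norm (entry (snd d) i))\<^sup>2)"
    unfolding norm_S[OF DS]
  proof (intro add_mono sum_mono)
    have "norm (fst D) \<le> \<mu> * norm (fst d)"
      using lipschitz_onD[OF h_grad, of "fst q" "fst w"] by (simp add: D_def d_def dist_norm)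
    also have "\<dots> \<le> M * norm (fst d)" using M by (intro mult_right_mono) auto
    finally show "(norm (fst D))\<^sup>2 \<le> M\<^sup>2 * (norm (fst d))\<^sup>2"
      unfolding power_mult_distrib[symmetric] by (rule power_mono) simp
    fix i assume i: "i \<in> {1..m}"
    have "norm (entry (snd D) i) \<le> \<nu> i * norm (entry (snd d) i)"
      using gradl_Lipschitz[OF i entry_mem[OF q i] entry_mem[OF w i]] i
      by (simp add: D_def d_def entry_pack)
    also have "\<dots> \<le> M * norm (entry (snd d) i)" using M'[OF i] by (rule mult_right_mono) simp
    finally show "(norm (entry (snd D) i))\<^sup>2 \<le> M\<^sup>2 * (norm (entry (snd d) i))\<^sup>2"
      unfolding power_mult_distrib[symmetric] by (rule power_mono) simp
  qed
  also have "\<dots> = (M * norm d)\<^sup>2"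
    by (simp add: norm_S[OF d] power_mult_distrib distrib_left sum_distrib_left)
  finally have D: "norm D \<le> M * norm d"
    by (rule power2_le_imp_le) (use M \<mu> in auto)
  have "(norm K)\<^sup>2 \<le> \<Lambda> * (\<Sum>i\<in>{1..m}. (norm (entry (snd d) i))\<^sup>2) + (\<Sum>i\<in>{1..m}. (onorm (L i))\<^sup>2 * (norm (fst d))\<^sup>2)"
    unfolding norm_S[OF KS]
  proof (intro add_mono sum_mono)
    show "(norm (fst K))\<^sup>2 \<le> \<Lambda> * (\<Sum>i\<in>{1..m}. (norm (entry (snd d) i))\<^sup>2)"
      unfolding K_def \<Lambda>_def fst_conv by (rule norm_sum_adjoint_le[OF L_lin])
    fix i assume i: "i \<in> {1..m}"
    have "norm (entry (snd K) i) \<le> onorm (L i) * norm (fst d)"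
      using onorm[OF L_lin[OF i]] i by (simp add: K_def entry_pack)
    then show "(norm (entry (snd K) i))\<^sup>2 \<le> (onorm (L i))\<^sup>2 * (norm (fst d))\<^sup>2"
      unfolding power_mult_distrib[symmetric] by (rule power_mono) simp
  qed
  also have "\<dots> = \<Lambda> * (norm d)\<^sup>2"
    by (simp add: norm_S[OF d] \<Lambda>_def distrib_left sum_distrib_right)
  also have "\<dots> = (sqrt \<Lambda> * norm d)\<^sup>2"
    by (simp add: power_mult_distrib \<Lambda>_def sum_nonneg)
  finally have K: "norm K \<le> sqrt \<Lambda> * norm d"
    by (rule power2_le_imp_le) (simp add: \<Lambda>_def sum_nonneg)
  have "norm (B q - B w) \<le> norm D + norm K" unfolding split by (rule norm_triangle_ineq)
  also have "\<dots> \<le> (M + sqrt \<Lambda>) * norm d" using D K by (simp add: distrib_right)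
  finally show ?thesis unfolding M_def \<Lambda>_def d_def .
qed

lemma A_mem: "a \<in> A q \<Longrightarrow> q \<in> S \<and> a \<in> S"
  by (simp add: A_def)

lemma A_mono:
  assumes a: "a \<in> A q" and b: "b \<in> A w"
  shows "0 \<le> inner (a - b) (q - w)"
proof -
  have d: "q - w \<in> S" using S_sub A_mem[OF a] A_mem[OF b] by (simp add: subspace_diff)
  have 1: "0 \<le> inner (fst a - fst b) (fst q - fst w)"
    using subdiff_on_monotone[of "fst a + z" UNIV f "fst q" "fst b + z" "fst w"] a b by (simp add: A_def)
  have 2: "0 \<le> inner (entry (snd a) i - entry (snd b) i) (entry (snd q) i - entry (snd w) i)"
    if "i \<in> {1..m}" for i
    using subdiff_on_monotone[of "entry (snd a) i - r i" "\<G> i" "gconj i" "entry (snd q) i"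
        "entry (snd b) i - r i" "entry (snd w) i"] a b that by (simp add: A_def)
  show ?thesis unfolding inner_S[OF d] using 1 2 by (auto intro!: add_nonneg_nonneg sum_nonneg)
qed

lemma prox_f_subdiff:
  "0 < t \<Longrightarrow> (1 / t) *\<^sub>R (y - prox_on UNIV t f y) \<in> subdiff_on UNIV f (prox_on UNIV t f y)"
  by (rule prox_on_subdiff[OF _ f_Gamma f_minorized]) (auto simp: hilbert_subspace_def complete_UNIV)

lemma prox_gconj_subdiff:
  "i \<in> {1..m} \<Longrightarrow> 0 < t \<Longrightarrow> y \<in> \<G> i \<Longrightarrow>
    (1 / t) *\<^sub>R (y - prox_on (\<G> i) t (gconj i) y) \<in> subdiff_on (\<G> i) (gconj i) (prox_on (\<G> i) t (gconj i) y)"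
  by (rule prox_on_subdiff[OF G_hilbert gconj_Gamma gconj_minorized])

text \<open>
  The shifts by \<open>z\<close> and \<open>r\<^sub>i\<close> inside the proximal maps account for the linear terms of \<open>A\<close>. With
  \<open>b = B w\<close> this is the forward-backward step, with \<open>b = 0\<close> the resolvent of \<open>A\<close>.
\<close>

lemma resolvent_in_A:
  assumes t: "0 < t" and b: "b \<in> S" and w: "w \<in> S"
    and q1: "fst q = prox_on UNIV t f (fst w - t *\<^sub>R (fst b - z))"
    and q2: "\<And>i. i \<in> {1..m} \<Longrightarrow>
      entry (snd q) i = prox_on (\<G> i) t (gconj i) (entry (snd w) i - t *\<^sub>R (entry (snd b) i + r i))"
    and q: "\<And>i. i \<notin> {1..m} \<Longrightarrow> entry (snd q) i = 0"
  shows "(1 / t) *\<^sub>R (w - q) - b \<in> A q"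
proof -
  have sh: "(1 / t) *\<^sub>R (y - t *\<^sub>R c - k) = (1 / t) *\<^sub>R (y - k) - c" for y c k :: "'k::real_vector"
    using t by (simp add: algebra_simps)
  have f: "fst ((1 / t) *\<^sub>R (w - q) - b) + z \<in> subdiff_on UNIV f (fst q)"
    using prox_f_subdiff[OF t, of "fst w - t *\<^sub>R (fst b - z)"]
    unfolding q1[symmetric] sh by (simp add: algebra_simps)
  have g: "entry (snd ((1 / t) *\<^sub>R (w - q) - b)) i - r i \<in> subdiff_on (\<G> i) (gconj i) (entry (snd q) i)"
    if i: "i \<in> {1..m}" for i
  proof -
    have "entry (snd w) i - t *\<^sub>R (entry (snd b) i + r i) \<in> \<G> i"
      using G_sub[OF i] entry_mem[OF w i] entry_mem[OF b i] r_mem[OF i]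
      by (intro subspace_diff subspace_scale subspace_add)
    from prox_gconj_subdiff[OF i t this] show ?thesis
      unfolding q2[OF i, symmetric] sh by (simp add: algebra_simps)
  qed
  have qS: "q \<in> S"
    using subdiff_on_memD(1)[OF g] q by (cases q) (auto simp: S_def direct_sum_def)
  have "(1 / t) *\<^sub>R (w - q) - b \<in> S"
    using S_sub w qS b by (intro subspace_diff subspace_scale)
  then show ?thesis unfolding A_def using qS f g by blast
qed

lemma A_resolvent:
  assumes t: "0 < t" and w: "w \<in> S"
  shows "\<exists>q. (1 / t) *\<^sub>R (w - q) \<in> A q"
proof -
  have "(1 / t) *\<^sub>R (w - q) - 0 \<in> A q"
    if "q = (prox_on UNIV t f (fst w - t *\<^sub>R (fst 0 - z)),
      pack {1..m} (\<lambda>i. prox_on (\<G> i) t (gconj i) (entry (snd w) i - t *\<^sub>R (0 + r i))))" for q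
    by (rule resolvent_in_A[OF t subspace_0[OF S_sub] w]) (auto simp: that entry_pack)
  then show ?thesis by auto
qed

text \<open>
  The assumption on \<open>z\<close> provides \<open>L\<^sub>i x - r\<^sub>i = y1\<^sub>i + y2\<^sub>i\<close> with a common subgradient \<open>v\<^sub>i\<close>. Inverting the two
  subdifferentials gives \<open>y1\<^sub>i \<in> \<partial>g\<^sub>i\<^sup>*(v\<^sub>i)\<close> and \<open>y2\<^sub>i = \<nabla>l\<^sub>i\<^sup>*(v\<^sub>i)\<close>, hence a zero \<open>(x, v)\<close>.
\<close>

lemma zero_exists: "\<exists>q. - B q \<in> A q"
proof -
  obtain xh vh y1 y2 where xh: "z - gradh xh - (\<Sum>i\<in>{1..m}. adjoint (L i) (vh i)) \<in> subdiff_on UNIV f xh"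
    and y1: "\<And>i. i \<in> {1..m} \<Longrightarrow> vh i \<in> subdiff_on (\<G> i) (g i) (y1 i)"
    and y2: "\<And>i. i \<in> {1..m} \<Longrightarrow> vh i \<in> subdiff_on (\<G> i) (l i) (y2 i)"
    and y: "\<And>i. i \<in> {1..m} \<Longrightarrow> y1 i + y2 i = L i xh - r i"
    using qualified_point by blast
  define q where "q = (xh, pack {1..m} vh)"
  have q: "q \<in> S" unfolding q_def pack_mem using subdiff_on_memD(2)[OF y1] by simp
  have "entry (snd (- B q)) i - r i = y1 i" if "i \<in> {1..m}" for i
    using gradl_eqI[OF that y2[OF that]] y[OF that] that
    by (simp add: B_def q_def entry_pack algebra_simps)
  then have "entry (snd (- B q)) i - r i \<in> subdiff_on (\<G> i) (gconj i) (entry (snd q) i)" if "i \<in> {1..m}" for i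
    using subdiff_on_conjugate[OF y1[OF that]] that by (simp add: q_def entry_pack)
  moreover have "fst (- B q) + z \<in> subdiff_on UNIV f (fst q)"
    using xh by (simp add: B_def q_def entry_pack algebra_simps)
  ultimately have "- B q \<in> A q"
    unfolding A_def using q B_mem[OF q] S_sub by (auto intro: subspace_neg)
  then show ?thesis ..
qed

end

section \<open>The duality gap\<close>

context primal_dual_problem
begin

text \<open>
  Real-valued versions, so that sums and differences can be handled without infinities. They agree with
  the extended functions only where these are finite, and are \<open>0\<close> elsewhere.
\<close>

definition real_f :: "'h \<Rightarrow> real" where "real_f y = real_of_ereal (f y)"
definition real_gconj :: "nat \<Rightarrow> 'g \<Rightarrow> real" where "real_gconj i w = real_of_ereal (gconj i w)"
definition real_lconj :: "nat \<Rightarrow> 'g \<Rightarrow> real" where "real_lconj i w = real_of_ereal (lconj i w)"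
definition real_infconv :: "nat \<Rightarrow> 'g \<Rightarrow> real" where "real_infconv i y = real_of_ereal (infconv_on (\<G> i) (g i) (l i) y)"

definition objective :: "'h \<Rightarrow> real" where
  "objective y = real_f y + h y - inner y z + (\<Sum>i\<in>{1..m}. real_infconv i (L i y - r i))"

definition lagrangian :: "'h \<Rightarrow> (nat \<Rightarrow> 'g) \<Rightarrow> real" where
  "lagrangian y w = real_f y + h y - inner y z
    + (\<Sum>i\<in>{1..m}. inner (L i y - r i) (w i) - real_gconj i (w i) - real_lconj i (w i))"

definition dual_dom :: "(nat \<Rightarrow> 'g) set" where
  "dual_dom = (\<Pi> i\<in>{1..m}. dom_on (\<G> i) (gconj i))"

lemma f_not_MInf: "f y \<noteq> -\<infinity>"
  using f_Gamma by (auto simp: Gamma_on_def proper_on_def)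

lemma f_eq_real_f: "f y < \<infinity> \<Longrightarrow> f y = ereal (real_f y)"
  using f_not_MInf[of y] by (cases "f y") (auto simp: real_f_def)

lemma shifted_image_mem: "i \<in> {1..m} \<Longrightarrow> L i y - r i \<in> \<G> i"
  by (intro subspace_diff G_sub L_mem r_mem)

lemma infconv_eq_real_infconv:
  assumes i: "i \<in> {1..m}" and y: "y \<in> \<G> i"
  shows "infconv_on (\<G> i) (g i) (l i) y = ereal (real_infconv i y)"
proof -
  obtain u y1 y2 where u: "u \<in> subdiff_on (\<G> i) (g i) y1" "u \<in> subdiff_on (\<G> i) (l i) y2"
    using common_subgradient[OF i] by metis
  show ?thesis
    using infconv_on_finite[OF G_hilbert[OF i] g_Gamma[OF i] l_Gamma[OF i] g_Lip[OF i] u y]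
    by (simp add: real_infconv_def ereal_real)
qed

lemma gconj_eq_real_gconj:
  assumes i: "i \<in> {1..m}" and w: "w \<in> dom_on (\<G> i) (gconj i)"
  shows "gconj i w = ereal (real_gconj i w)"
proof -
  have "gconj i w \<noteq> -\<infinity>" "gconj i w \<noteq> \<infinity>"
    using gconj_Gamma[OF i] w by (auto simp: Gamma_on_def proper_on_def dom_on_def)
  then show ?thesis by (cases "gconj i w") (auto simp: real_gconj_def)
qed

lemma lconj_eq_real_lconj:
  assumes i: "i \<in> {1..m}" and w: "w \<in> \<G> i"
  shows "lconj i w = ereal (real_lconj i w)"
  using subdiff_on_memD(3)[OF subdiff_on_conjugate[OF gradl_subdiff[OF i w]]]
  by (simp add: real_lconj_def ereal_real)

lemma real_lconj_above_gradl:
  assumes i: "i \<in> {1..m}" and v: "v \<in> \<G> i" and w: "w \<in> \<G> i"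
  shows "real_lconj i v + inner (gradl i v) (w - v) \<le> real_lconj i w"
  using subdiff_on_conjugate[OF gradl_subdiff[OF i v]] w
  by (simp add: subdiff_on_def lconj_eq_real_lconj[OF i] v)

lemma lagrangian_le_objective:
  assumes w: "w \<in> dual_dom"
  shows "lagrangian y w \<le> objective y"
  unfolding lagrangian_def objective_def
proof (intro add_left_mono sum_mono)
  fix i assume i: "i \<in> {1..m}"
  have wi: "w i \<in> dom_on (\<G> i) (gconj i)" using w i by (auto simp: dual_dom_def)
  then have "w i \<in> \<G> i" by (simp add: dom_on_def)
  from fenchel_young_infconv[OF G_sub[OF i] proper_g[OF i] proper_l[OF i] shifted_image_mem[OF i]
      gconj_eq_real_gconj[OF i wi] lconj_eq_real_lconj[OF i this], of y]
  show "inner (L i y - r i) (w i) - real_gconj i (w i) - real_lconj i (w i) \<le> real_infconv i (L i y - r i)"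
    by (simp add: infconv_eq_real_infconv[OF i shifted_image_mem[OF i]])
qed

lemma objective_le_lagrangian_approx:
  assumes \<delta>: "0 < \<delta>"
  shows "\<exists>w\<in>(\<Pi>\<^sub>E i\<in>{1..m}. dom_on (\<G> i) (gconj i)). objective y \<le> lagrangian y w + \<delta>"
proof -
  (* the m summands share the error; m may be 0 *)
  define \<eta> where "\<eta> = \<delta> / (real m + 1)"
  have \<eta>: "0 < \<eta>" "real m * \<eta> \<le> \<delta>" using \<delta> by (auto simp: \<eta>_def field_simps)
  have "\<exists>v\<in>dom_on (\<G> i) (gconj i). real_infconv i (L i y - r i) \<le> inner (L i y - r i) v - real_gconj i v - real_lconj i v + \<eta>"
    if i: "i \<in> {1..m}" for i
  proof -
    obtain u y1 y2 where u: "u \<in> subdiff_on (\<G> i) (g i) y1" "u \<in> subdiff_on (\<G> i) (l i) y2"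
      using common_subgradient[OF i] by metis
    obtain v a b where v: "v \<in> \<G> i" "gconj i v = ereal a" "lconj i v = ereal b"
      "infconv_on (\<G> i) (g i) (l i) (L i y - r i) \<le> ereal (inner (L i y - r i) v - a - b + \<eta>)"
      using infconv_on_approx_dual(2)[OF G_hilbert[OF i] g_Gamma[OF i] l_Gamma[OF i] g_Lip[OF i] u
          shifted_image_mem[OF i] \<eta>(1)] by blast
    then show ?thesis
      by (intro bexI[of _ v])
        (simp_all add: infconv_eq_real_infconv[OF i shifted_image_mem[OF i]] real_gconj_def real_lconj_def dom_on_def)
  qed
  then obtain v where v: "\<And>i. i \<in> {1..m} \<Longrightarrow> v i \<in> dom_on (\<G> i) (gconj i)"
    "\<And>i. i \<in> {1..m} \<Longrightarrow> real_infconv i (L i y - r i) \<le> inner (L i y - r i) (v i) - real_gconj i (v i) - real_lconj i (v i) + \<eta>"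
    by metis
  define w where "w = restrict v {1..m}"
  have "(\<Sum>i\<in>{1..m}. real_infconv i (L i y - r i))
      \<le> (\<Sum>i\<in>{1..m}. (inner (L i y - r i) (w i) - real_gconj i (w i) - real_lconj i (w i)) + \<eta>)"
    using v(2) by (intro sum_mono) (auto simp: w_def)
  also have "\<dots> = (\<Sum>i\<in>{1..m}. inner (L i y - r i) (w i) - real_gconj i (w i) - real_lconj i (w i)) + real m * \<eta>"
    by (simp add: sum.distrib)
  finally have "objective y \<le> lagrangian y w + \<delta>"
    using \<eta>(2) unfolding objective_def lagrangian_def by linarith
  moreover have "w \<in> (\<Pi>\<^sub>E i\<in>{1..m}. dom_on (\<G> i) (gconj i))" using v(1) by (auto simp: w_def)
  ultimately show ?thesis by blast
qed

lemma A_dom: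
  assumes "a \<in> A q"
  shows "f (fst q) < \<infinity>" "entry (snd q) \<in> dual_dom"
proof -
  have "fst a + z \<in> subdiff_on UNIV f (fst q)" using assms by (simp add: A_def)
  from subdiff_on_memD(3)[OF this] show "f (fst q) < \<infinity>" by auto
  have "entry (snd q) i \<in> dom_on (\<G> i) (gconj i)" if "i \<in> {1..m}" for i
    using subdiff_on_memD(1,3)[of "entry (snd a) i - r i" "\<G> i" "gconj i" "entry (snd q) i"] assms that
    by (auto simp: A_def dom_on_def)
  then show "entry (snd q) \<in> dual_dom" by (simp add: dual_dom_def)
qed

text \<open>
  Adding the subgradient inequalities of the four functions at \<open>q\<close>; the bilinear terms that the
  skew part of \<open>B\<close> produces cancel.
\<close>

lemma gap_le_residual:
  assumes e: "e - B q \<in> A q" and y: "f y < \<infinity>" and w: "w \<in> dual_dom"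
  shows "lagrangian (fst q) w - lagrangian y (entry (snd q)) \<le> inner e (q - (y, pack {1..m} w))"
proof -
  define p where "p = fst q"
  define v where "v = entry (snd q)"
  define e1 where "e1 = fst e"
  define e2 where "e2 = entry (snd e)"
  have q: "q \<in> S" using A_mem[OF e] by simp
  have dom: "f p < \<infinity>" "v \<in> dual_dom" using A_dom[OF e] by (auto simp: p_def v_def)
  have wdom: "w i \<in> dom_on (\<G> i) (gconj i)" "v i \<in> dom_on (\<G> i) (gconj i)" if "i \<in> {1..m}" for i
    using w dom(2) that by (auto simp: dual_dom_def)
  then have wG: "w i \<in> \<G> i" "v i \<in> \<G> i" if "i \<in> {1..m}" for i using that by (auto simp: dom_on_def)
  define s where "s = (\<Sum>i\<in>{1..m}. adjoint (L i) (v i))"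
  have "e1 - gradh p - s + z \<in> subdiff_on UNIV f p"
    using e by (simp add: A_def B_def p_def e1_def v_def s_def algebra_simps)
  then have "f p + ereal (inner (e1 - gradh p - s + z) (y - p)) \<le> f y"
    by (simp add: subdiff_on_def)
  then have 1: "real_f p + inner (e1 - gradh p - s + z) (y - p) \<le> real_f y"
    using f_eq_real_f[OF dom(1)] f_eq_real_f[OF y] by simp
  have 2: "h p + inner (gradh p) (y - p) \<le> h y" by (rule convex_above_gradient[OF h_convex h_diff])
  have sum: "inner s (y - p) = (\<Sum>i\<in>{1..m}. inner (L i y - L i p) (v i))"
  proof -
    have "inner s (y - p) = (\<Sum>i\<in>{1..m}. inner (y - p) (adjoint (L i) (v i)))"
      by (subst inner_commute) (simp add: s_def inner_sum_right)
    also have "\<dots> = (\<Sum>i\<in>{1..m}. inner (L i y - L i p) (v i))"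
      by (intro sum.cong refl) (simp add: inner_adjoint[OF L_lin] linear_diff[OF bounded_linear.linear[OF L_lin]])
    finally show ?thesis .
  qed
  have 3: "real_gconj i (v i) + real_lconj i (v i) + inner (e2 i + L i p - r i) (w i - v i) \<le> real_gconj i (w i) + real_lconj i (w i)"
    if i: "i \<in> {1..m}" for i
  proof -
    have "entry (snd (e - B q)) i - r i \<in> subdiff_on (\<G> i) (gconj i) (v i)"
      using e i by (simp add: A_def v_def)
    then have "e2 i - (gradl i (v i) - L i p) - r i \<in> subdiff_on (\<G> i) (gconj i) (v i)"
      using i by (simp add: B_def entry_pack e2_def p_def v_def)
    then have "gconj i (v i) + ereal (inner (e2 i - (gradl i (v i) - L i p) - r i) (w i - v i)) \<le> gconj i (w i)"
      using wG[OF i] by (simp add: subdiff_on_def)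
    then have "real_gconj i (v i) + inner (e2 i - (gradl i (v i) - L i p) - r i) (w i - v i) \<le> real_gconj i (w i)"
      using gconj_eq_real_gconj[OF i] wdom[OF i] by simp
    with real_lconj_above_gradl[OF i wG(2)[OF i] wG(1)[OF i]] show ?thesis by (simp add: inner_simps)
  qed
  have pk: "(y, pack {1..m} w) \<in> S" unfolding pack_mem using wG by blast
  have "inner e (q - (y, pack {1..m} w)) = inner e1 (p - y) + (\<Sum>i\<in>{1..m}. inner (e2 i) (v i - w i))"
    unfolding inner_S[OF subspace_diff[OF S_sub q pk]]
    by (simp add: e1_def e2_def p_def v_def entry_pack)
  moreover have "lagrangian p w - lagrangian y v = (real_f p + h p - inner p z) - (real_f y + h y - inner y z)
      + (\<Sum>i\<in>{1..m}. (inner (L i p - r i) (w i) - real_gconj i (w i) - real_lconj i (w i))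
          - (inner (L i y - r i) (v i) - real_gconj i (v i) - real_lconj i (v i)))"
    by (simp add: lagrangian_def sum_subtractf)
  moreover have "(real_f p + h p - inner p z) - (real_f y + h y - inner y z) \<le> inner e1 (p - y) + inner s (y - p)"
    using 1 2 by (simp add: inner_simps inner_commute)
  moreover have "(\<Sum>i\<in>{1..m}. (inner (L i p - r i) (w i) - real_gconj i (w i) - real_lconj i (w i))
          - (inner (L i y - r i) (v i) - real_gconj i (v i) - real_lconj i (v i)))
      \<le> (\<Sum>i\<in>{1..m}. inner (e2 i) (v i - w i) - inner (L i y - L i p) (v i))"
  proof (rule sum_mono)
    fix i assume i: "i \<in> {1..m}"
    show "(inner (L i p - r i) (w i) - real_gconj i (w i) - real_lconj i (w i))
          - (inner (L i y - r i) (v i) - real_gconj i (v i) - real_lconj i (v i))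
      \<le> inner (e2 i) (v i - w i) - inner (L i y - L i p) (v i)"
      using 3[OF i] by (simp add: inner_simps)
  qed
  ultimately show ?thesis
    unfolding sum by (simp add: sum_subtractf p_def[symmetric] v_def[symmetric])
qed

text \<open>
  The gap estimate with residual \<open>0\<close> is the saddle point inequality.
\<close>

lemma zero_minimizes_objective:
  assumes c: "- B c \<in> A c" and y: "f y < \<infinity>"
  shows "objective (fst c) \<le> objective y"
proof (rule field_le_epsilon)
  fix \<delta> :: real assume "0 < \<delta>"
  then obtain w where w: "w \<in> (\<Pi>\<^sub>E i\<in>{1..m}. dom_on (\<G> i) (gconj i))"
    "objective (fst c) \<le> lagrangian (fst c) w + \<delta>"
    using objective_le_lagrangian_approx by blast
  have "w \<in> dual_dom" using w(1) by (auto simp: dual_dom_def)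
  from gap_le_residual[of 0 c, OF _ y this] c
  have "lagrangian (fst c) w \<le> lagrangian y (entry (snd c))" by simp
  also have "\<dots> \<le> objective y" by (rule lagrangian_le_objective) (rule A_dom[OF c])
  finally show "objective (fst c) \<le> objective y + \<delta>" using w(2) by simp
qed

lemma convex_dom_f: "convex (dom_on UNIV f)"
  and convex_on_lagrangian: "convex_on (dom_on UNIV f) (\<lambda>y. lagrangian y w)"
proof -
  have fle: "f ((1 - t) *\<^sub>R a + t *\<^sub>R b) \<le> ereal ((1 - t) * real_f a + t * real_f b)"
    if ab: "f a < \<infinity>" "f b < \<infinity>" and t: "0 < t" "t < 1" for a b and t :: real
  proof -
    have "econvex_on UNIV f" using f_Gamma by (simp add: Gamma_on_def)
    then have "f ((1 - t) *\<^sub>R a + (1 - (1 - t)) *\<^sub>R b) \<le> ereal (1 - t) * f a + ereal (1 - (1 - t)) * f b"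
      unfolding econvex_on_def using t by (elim ballE allE[of _ "1 - t"]) auto
    then show ?thesis using f_eq_real_f[OF ab(1)] f_eq_real_f[OF ab(2)] by simp
  qed
  have dom: "f ((1 - t) *\<^sub>R a + t *\<^sub>R b) < \<infinity>"
    if "f a < \<infinity>" "f b < \<infinity>" "0 < t" "t < 1" for a b and t :: real
    using fle[OF that] by (auto intro: le_less_trans)
  show cd: "convex (dom_on UNIV f)"
    unfolding convex_alt
  proof (intro ballI allI impI)
    fix a b and t :: real assume "a \<in> dom_on UNIV f" "b \<in> dom_on UNIV f" "0 \<le> t \<and> t \<le> 1"
    then show "(1 - t) *\<^sub>R a + t *\<^sub>R b \<in> dom_on UNIV f"
      using dom[of a b t] by (cases "t = 0"; cases "t = 1") (auto simp: dom_on_def)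
  qed
  show "convex_on (dom_on UNIV f) (\<lambda>y. lagrangian y w)"
  proof (rule convex_onI[OF _ cd])
    fix t :: real and a b assume t: "0 < t" "t < 1" and "a \<in> dom_on UNIV f" "b \<in> dom_on UNIV f"
    then have ab: "f a < \<infinity>" "f b < \<infinity>" by (auto simp: dom_on_def)
    define c where "c = (1 - t) *\<^sub>R a + t *\<^sub>R b"
    have "real_f c \<le> (1 - t) * real_f a + t * real_f b"
      using fle[OF ab t] f_eq_real_f[OF dom[OF ab t]] by (simp add: c_def)
    moreover have "h c \<le> (1 - t) * h a + t * h b"
      unfolding c_def using convex_onD[OF h_convex] t by simp
    moreover have "inner c z = (1 - t) * inner a z + t * inner b z" by (simp add: c_def inner_simps)
    moreover define \<sigma> where "\<sigma> y = (\<Sum>i\<in>{1..m}. inner (L i y - r i) (w i) - real_gconj i (w i) - real_lconj i (w i))" for y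
    have "\<sigma> c = (\<Sum>i\<in>{1..m}. (1 - t) * (inner (L i a - r i) (w i) - real_gconj i (w i) - real_lconj i (w i))
          + t * (inner (L i b - r i) (w i) - real_gconj i (w i) - real_lconj i (w i)))"
      unfolding \<sigma>_def
    proof (rule sum.cong[OF refl])
      fix i assume "i \<in> {1..m}"
      then have "linear (L i)" using L_lin bounded_linear.linear by blast
      then have "L i c = (1 - t) *\<^sub>R L i a + t *\<^sub>R L i b" by (simp add: c_def linear_add linear_scale)
      then show "inner (L i c - r i) (w i) - real_gconj i (w i) - real_lconj i (w i)
        = (1 - t) * (inner (L i a - r i) (w i) - real_gconj i (w i) - real_lconj i (w i))
          + t * (inner (L i b - r i) (w i) - real_gconj i (w i) - real_lconj i (w i))"
        by (simp only:) (simp add: inner_simps algebra_simps)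
    qed
    then have "\<sigma> c = (1 - t) * \<sigma> a + t * \<sigma> b"
      by (simp only: \<sigma>_def sum.distrib sum_distrib_left)
    ultimately have "lagrangian c w \<le> (1 - t) * lagrangian a w + t * lagrangian b w"
      unfolding lagrangian_def \<sigma>_def[symmetric] by (simp add: algebra_simps)
    then show "lagrangian ((1 - t) *\<^sub>R a + t *\<^sub>R b) w \<le> (1 - t) * lagrangian a w + t * lagrangian b w"
      by (simp add: c_def)
  qed
qed

lemma f_average_and_lagrangian_average:
  assumes p: "\<And>n. f (p n) < \<infinity>" and N: "1 \<le> N"
  defines "av \<equiv> (1 / real N) *\<^sub>R (\<Sum>n<N. p n)"
  shows f_average: "f av < \<infinity>"
    and lagrangian_average: "real N * lagrangian av w \<le> (\<Sum>n<N. lagrangian (p n) w)"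
proof -
  have ne: "{..<N} \<noteq> {}" using N by (simp add: lessThan_empty_iff)
  have av: "av = (\<Sum>n<N. (1 / real N) *\<^sub>R p n)" by (simp add: av_def scaleR_sum_right)
  have "av \<in> dom_on UNIV f"
    unfolding av using N p by (intro convex_sum convex_dom_f) (auto simp: dom_on_def)
  then show "f av < \<infinity>" by (simp add: dom_on_def)
  have "lagrangian av w \<le> (\<Sum>n<N. (1 / real N) * lagrangian (p n) w)"
    unfolding av using N p
    by (intro convex_on_sum[OF _ ne convex_on_lagrangian]) (auto simp: dom_on_def)
  also have "\<dots> = (\<Sum>n<N. lagrangian (p n) w) / real N"
    by (simp add: sum_divide_distrib)
  finally show "real N * lagrangian av w \<le> (\<Sum>n<N. lagrangian (p n) w)"
    using N by (simp add: field_simps)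
qed

end

theorem mainTheorem2:
  fixes m :: nat
    and \<G> :: "nat \<Rightarrow> 'g::real_inner set"
    and f :: "'h::{real_inner, complete_space} \<Rightarrow> ereal"
    and h :: "'h \<Rightarrow> real"
    and \<mu> :: real
    and z :: 'h
    and r :: "nat \<Rightarrow> 'g"
    and g l :: "nat \<Rightarrow> 'g \<Rightarrow> ereal"
    and \<nu> :: "nat \<Rightarrow> real"
    and L :: "nat \<Rightarrow> 'h \<Rightarrow> 'g"
    and \<beta> \<epsilon> :: real
    and \<gamma> :: "nat \<Rightarrow> real"
    and x p1 :: "nat \<Rightarrow> 'h"
    and v p2 :: "nat \<Rightarrow> nat \<Rightarrow> 'g"
    and F :: "'h \<Rightarrow> ereal"
    and G :: "(nat \<Rightarrow> 'g) \<Rightarrow> ereal"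
    and P :: "'h \<Rightarrow> ereal"
    and xavg :: "nat \<Rightarrow> 'h"
    and B2 :: "(nat \<Rightarrow> 'g) set"
    and C :: "'h set \<Rightarrow> (nat \<Rightarrow> 'g) set \<Rightarrow> ereal"
  assumes G_hilbert: "\<And>i. i \<in> {1..m} \<Longrightarrow> hilbert_subspace (\<G> i)"
    and f_Gamma: "f \<in> Gamma_on UNIV"
    and h_convex: "convex_on UNIV h"
    and h_diff: "\<And>y. h differentiable (at y)"
    and mu_pos: "\<mu> > 0"
    and h_grad: "\<mu>-lipschitz_on UNIV (gradient_on UNIV h)"
    and r_mem: "\<And>i. i \<in> {1..m} \<Longrightarrow> r i \<in> \<G> i"
    and g_Gamma: "\<And>i. i \<in> {1..m} \<Longrightarrow> g i \<in> Gamma_on (\<G> i)"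
    and l_Gamma: "\<And>i. i \<in> {1..m} \<Longrightarrow> l i \<in> Gamma_on (\<G> i)"
    and nu_pos: "\<And>i. i \<in> {1..m} \<Longrightarrow> \<nu> i > 0"
    and l_strong: "\<And>i. i \<in> {1..m} \<Longrightarrow> strongly_convex_on (\<G> i) (inverse (\<nu> i)) (l i)"
    and L_lin: "\<And>i. i \<in> {1..m} \<Longrightarrow> bounded_linear (L i)"
    and L_range: "\<And>i. i \<in> {1..m} \<Longrightarrow> range (L i) \<subseteq> \<G> i"
    and L_nonzero: "\<And>i. i \<in> {1..m} \<Longrightarrow> \<exists>y. L i y \<noteq> 0"
    and z_ran: "z \<in> op_ran (\<lambda>y. subdiff_on UNIV f y
          + (\<Sum>i\<in>{1..m}. adjoint (L i) `
               parallel_sum (subdiff_on (\<G> i) (g i)) (subdiff_on (\<G> i) (l i)) (L i y - r i))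
          + {gradient_on UNIV h y})"
    and g_Lip: "\<And>i. i \<in> {1..m} \<Longrightarrow> elipschitz_on (\<G> i) (g i)"
    and v0_mem: "\<And>i. i \<in> {1..m} \<Longrightarrow> v i 0 \<in> \<G> i"
    and beta_def: "\<beta> = Max (insert \<mu> (\<nu> ` {1..m})) + sqrt (\<Sum>i\<in>{1..m}. (onorm (L i))\<^sup>2)"
    and eps: "\<epsilon> \<in> {0<..<1 / (\<beta> + 1)}"
    and gamma_mono: "incseq \<gamma>"
    and gamma_range: "\<And>n. \<gamma> n \<in> {\<epsilon>..(1 - \<epsilon>) / \<beta>}"
    and p1_def: "\<And>n. p1 n = prox_on UNIV (\<gamma> n) f
          (x n - \<gamma> n *\<^sub>R (gradient_on UNIV h (x n) + (\<Sum>i\<in>{1..m}. adjoint (L i) (v i n)) - z))"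
    and p2_def: "\<And>i n. i \<in> {1..m} \<Longrightarrow> p2 i n = prox_on (\<G> i) (\<gamma> n) (conjugate_on (\<G> i) (g i))
          (v i n + \<gamma> n *\<^sub>R (L i (x n)
             - gradient_on (\<G> i) (\<lambda>w. real_of_ereal (conjugate_on (\<G> i) (l i) w)) (v i n) - r i))"
    and v_Suc: "\<And>i n. i \<in> {1..m} \<Longrightarrow> v i (Suc n) = \<gamma> n *\<^sub>R L i (p1 n - x n)
          + \<gamma> n *\<^sub>R (gradient_on (\<G> i) (\<lambda>w. real_of_ereal (conjugate_on (\<G> i) (l i) w)) (v i n)
                    - gradient_on (\<G> i) (\<lambda>w. real_of_ereal (conjugate_on (\<G> i) (l i) w)) (p2 i n))
          + p2 i n"
    and x_Suc: "\<And>n. x (Suc n) = \<gamma> n *\<^sub>R (\<Sum>i\<in>{1..m}. adjoint (L i) (v i n - p2 i n))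
          + \<gamma> n *\<^sub>R (gradient_on UNIV h (x n) - gradient_on UNIV h (p1 n)) + p1 n"
    and F_def: "\<And>y. F y = f y + ereal (h y) - ereal (inner y z)"
    and G_def: "\<And>w. G w = (\<Sum>i\<in>{1..m}. infconv_on (\<G> i) (g i) (l i) (w i))"
    and P_def: "\<And>y. P y = f y + (\<Sum>i\<in>{1..m}. infconv_on (\<G> i) (g i) (l i) (L i y - r i))
          + ereal (h y) - ereal (inner y z)"
    and xavg_def: "\<And>N. xavg N = (1 / real N) *\<^sub>R (\<Sum>n<N. p1 n)"
    and B2_def: "B2 = (\<Pi>\<^sub>E i\<in>{1..m}. dom_on (\<G> i) (conjugate_on (\<G> i) (g i)))"
    and C_def: "\<And>A B. C A B = (SUP (y, w) \<in> A \<times> B.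
          ereal ((norm (x 0 - y))\<^sup>2 / (2 * \<gamma> 0)
            + (\<Sum>i\<in>{1..m}. (norm (v i 0 - w i))\<^sup>2 / (2 * \<gamma> 0))))"
  shows "\<exists>xbar. is_arg_min P (\<lambda>y. True) xbar
      \<and> weakly_converges_to p1 xbar
      \<and> bounded (range p1)
      \<and> (\<exists>K. \<forall>w\<in>B2. L2_set (\<lambda>i. norm (w i)) {1..m} \<le> K)
      \<and> (\<forall>B1. bounded B1 \<and> convex B1 \<and> closed B1 \<and> range p1 \<subseteq> B1 \<longrightarrow>
           (\<forall>N\<ge>1. F (xavg N) + G (\<lambda>i. L i (xavg N) - r i) - F xbar - G (\<lambda>i. L i xbar - r i)
              \<le> C B1 B2 / ereal (real N)))
      \<and> \<bar>P xbar\<bar> \<noteq> \<infinity> \<and> (\<forall>N\<ge>1. \<bar>P (xavg N)\<bar> \<noteq> \<infinity>)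
      \<and> (\<lambda>N. real_of_ereal (P (xavg N)) - real_of_ereal (P xbar)) \<in> O(\<lambda>N. 1 / real N)"
proof -
  interpret pd: primal_dual_problem m \<G> f h \<mu> z r g l \<nu> L
    by (rule primal_dual_problem.intro) (fact G_hilbert f_Gamma h_convex h_diff h_grad r_mem g_Gamma l_Gamma nu_pos
      l_strong L_lin L_range z_ran g_Lip)+
  define X where "X n = (x n, pack {1..m} (\<lambda>i. v i n))" for n
  define Q where "Q n = (p1 n, pack {1..m} (\<lambda>i. p2 i n))" for n
  have "\<mu> \<le> Max (insert \<mu> (\<nu> ` {1..m}))" by (rule Max_ge) auto
  with mu_pos have "0 < Max (insert \<mu> (\<nu> ` {1..m}))" by (rule less_le_trans)
  then have \<beta>: "0 < \<beta>"
    unfolding beta_def by (rule add_pos_nonneg) (simp add: sum_nonneg)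
  have \<gamma>: "\<epsilon> \<le> \<gamma> n" "\<gamma> n * \<beta> \<le> 1 - \<epsilon>" for n
    using gamma_range[of n] \<beta> by (auto simp: pos_le_divide_eq)
  have \<epsilon>: "0 < \<epsilon>" using eps by simp
  have \<gamma>_pos: "0 < \<gamma> n" for n using \<epsilon> \<gamma>(1)[of n] by simp
  interpret T: tseng_iteration pd.S pd.A pd.B \<beta> \<epsilon> \<gamma> X Q
  proof unfold_locales
    show "norm (pd.B q - pd.B w) \<le> \<beta> * norm (q - w)" if "q \<in> pd.S" "w \<in> pd.S" for q w
      unfolding beta_def by (rule pd.B_Lipschitz[OF that])
    show "X 0 \<in> pd.S" unfolding X_def pd.pack_mem using v0_mem by blast
    show "(1 / \<gamma> n) *\<^sub>R (X n - Q n) - pd.B (X n) \<in> pd.A (Q n)" if X: "X n \<in> pd.S" for n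
    proof (rule pd.resolvent_in_A[OF \<gamma>_pos pd.B_mem[OF X] X])
      show "fst (Q n) = prox_on UNIV (\<gamma> n) f (fst (X n) - \<gamma> n *\<^sub>R (fst (pd.B (X n)) - z))"
        by (simp add: Q_def X_def pd.B_pack p1_def del: One_nat_def)
      fix i assume i: "i \<in> {1..m}"
      show "entry (snd (Q n)) i = prox_on (\<G> i) (\<gamma> n) (conjugate_on (\<G> i) (g i))
          (entry (snd (X n)) i - \<gamma> n *\<^sub>R (entry (snd (pd.B (X n))) i + r i))"
        using i by (simp add: Q_def X_def pd.B_pack p2_def entry_pack algebra_simps del: One_nat_def)
    qed (auto simp: Q_def entry_pack)
    show "X (Suc n) = Q n + \<gamma> n *\<^sub>R (pd.B (X n) - pd.B (Q n))" for n
    proof (rule prod_eqI)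
      have "(\<Sum>i\<in>{1..m}. adjoint (L i) (v i n - p2 i n))
          = (\<Sum>i\<in>{1..m}. adjoint (L i) (v i n)) - (\<Sum>i\<in>{1..m}. adjoint (L i) (p2 i n))"
        unfolding sum_subtractf[symmetric] by (intro sum.cong refl adjoint_diff L_lin)
      then show "fst (X (Suc n)) = fst (Q n + \<gamma> n *\<^sub>R (pd.B (X n) - pd.B (Q n)))"
        by (simp add: X_def Q_def pd.B_pack x_Suc del: One_nat_def) (simp add: algebra_simps)
      have "entry (snd (X (Suc n))) i = entry (snd (Q n + \<gamma> n *\<^sub>R (pd.B (X n) - pd.B (Q n)))) i" for i
      proof (cases "i \<in> {1..m}")
        case True
        then show ?thesis
          using linear_diff[OF bounded_linear.linear[OF L_lin[OF True]]]
          by (simp add: X_def Q_def pd.B_pack entry_pack v_Suc del: One_nat_def) (simp add: algebra_simps)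
      next
        case False
        then show ?thesis
          by (simp add: X_def Q_def pd.B_pack entry_pack del: One_nat_def atLeastAtMost_iff)
      qed
      then show "snd (X (Suc n)) = snd (Q n + \<gamma> n *\<^sub>R (pd.B (X n) - pd.B (Q n)))"
        by (rule finsupp_seq_eqI)
    qed
  qed (fact pd.S_hilbert pd.A_mem pd.A_mono pd.A_resolvent pd.B_mem pd.B_mono \<beta> \<epsilon> \<gamma>)+
  obtain w0 where w0: "- pd.B w0 \<in> pd.A w0" using pd.zero_exists by blast
  obtain c where c: "- pd.B c \<in> pd.A c" and weak: "weakly_converges_to Q c" and
    hull: "\<And>D. closed D \<Longrightarrow> convex D \<Longrightarrow> range Q \<subseteq> D \<Longrightarrow> c \<in> D"
    using T.weak_convergence[OF w0] by blast
  define xbar where "xbar = fst c"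
  have weak_p1: "weakly_converges_to p1 xbar"
    unfolding weakly_converges_to_def
  proof
    fix u
    have "(\<lambda>n. inner (Q n) (u, 0)) \<longlonglongrightarrow> inner c (u, 0)"
      using weak unfolding weakly_converges_to_def by blast
    then show "(\<lambda>n. inner (p1 n) u) \<longlonglongrightarrow> inner xbar u"
      by (simp add: Q_def xbar_def inner_prod_def)
  qed
  have "bounded (fst ` range Q)" by (rule bounded_fst[OF T.bounded_p[OF w0]])
  then have bdd_p1: "bounded (range p1)" by (simp add: image_image Q_def)
  have xbar_B1: "xbar \<in> B1" if "convex B1" "closed B1" "range p1 \<subseteq> B1" for B1
  proof -
    have "c \<in> B1 \<times> UNIV"
      using that by (intro hull closed_Times convex_Times) (auto simp: Q_def)
    then show ?thesis by (auto simp: xbar_def)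
  qed
  have f_p1: "f (p1 n) < \<infinity>" for n
    using pd.A_dom(1)[OF T.residual_in_A] by (simp add: Q_def)
  have f_xbar: "f xbar < \<infinity>" using pd.A_dom(1)[OF c] by (simp add: xbar_def)
  have f_xavg: "f (xavg N) < \<infinity>" if "1 \<le> N" for N
    unfolding xavg_def by (rule pd.f_average[OF f_p1 that])

  have G_real: "(\<Sum>i\<in>{1..m}. infconv_on (\<G> i) (g i) (l i) (L i y - r i))
      = ereal (\<Sum>i\<in>{1..m}. pd.real_infconv i (L i y - r i))" for y
    unfolding sum_ereal[symmetric] by (intro sum.cong refl pd.infconv_eq_real_infconv pd.shifted_image_mem)
  have P_real: "P y = ereal (pd.objective y)" if "f y < \<infinity>" for y
    unfolding P_def G_real pd.f_eq_real_f[OF that] by (simp add: pd.objective_def)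
  have P_inf: "P y = \<infinity>" if "f y = \<infinity>" for y
    unfolding P_def G_real that by simp
  have F_real: "F y = ereal (pd.real_f y + h y - inner y z)" if "f y < \<infinity>" for y
    unfolding F_def pd.f_eq_real_f[OF that] by simp
  have xbar_min: "P xbar \<le> P y" for y
  proof (cases "f y = \<infinity>")
    case False
    then have y: "f y < \<infinity>" by simp
    show ?thesis
      using pd.zero_minimizes_objective[OF c y] by (simp add: P_real[OF f_xbar] P_real[OF y] xbar_def[symmetric])
  qed (simp add: P_inf)
  then have arg_min: "is_arg_min P (\<lambda>y. True) xbar"
    unfolding is_arg_min_def by (auto simp: not_less)

  define R where "R w = (norm (x 0 - xbar))\<^sup>2 / (2 * \<gamma> 0) + (\<Sum>i\<in>{1..m}. (norm (v i 0 - w i))\<^sup>2 / (2 * \<gamma> 0))" for w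
  have rate: "\<exists>w\<in>B2. pd.objective (xavg N) - pd.objective xbar \<le> \<delta> + R w / real N"
    if N: "1 \<le> N" and \<delta>: "0 < \<delta>" for N \<delta>
  proof -
    obtain w where w: "w \<in> B2" "pd.objective (xavg N) \<le> pd.lagrangian (xavg N) w + \<delta>"
      using pd.objective_le_lagrangian_approx[OF \<delta>, of "xavg N"] unfolding B2_def by blast
    have wd: "w \<in> pd.dual_dom" using w(1) by (auto simp: B2_def pd.dual_dom_def)
    define q where "q = (xbar, pack {1..m} w)"
    have q: "q \<in> pd.S" unfolding q_def pd.pack_mem using wd by (auto simp: pd.dual_dom_def dom_on_def)
    have gap: "pd.lagrangian (p1 n) w - pd.objective xbar \<le> inner (T.residual n) (Q n - q)" for n
    proof -
      note res = T.residual_in_A[of n]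
      have "pd.lagrangian (p1 n) w - pd.lagrangian xbar (entry (snd (Q n))) \<le> inner (T.residual n) (Q n - q)"
        using pd.gap_le_residual[OF res f_xbar wd] by (simp add: q_def Q_def)
      moreover have "pd.lagrangian xbar (entry (snd (Q n))) \<le> pd.objective xbar"
        by (rule pd.lagrangian_le_objective[OF pd.A_dom(2)[OF res]])
      ultimately show ?thesis by linarith
    qed
    have "real N * (pd.lagrangian (xavg N) w - pd.objective xbar)
        \<le> (\<Sum>n<N. pd.lagrangian (p1 n) w - pd.objective xbar)"
      using pd.lagrangian_average[OF f_p1 N, where w=w]
      by (simp add: xavg_def sum_subtractf right_diff_distrib)
    also have "\<dots> \<le> (\<Sum>n<N. inner (T.residual n) (Q n - q))" by (rule sum_mono) (rule gap)
    (* the constant C(B1, B2) arises here, from the initial distance to (xbar, w) *)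
    also have "\<dots> \<le> (norm (X 0 - q))\<^sup>2 / (2 * \<gamma> 0)" by (rule T.sum_residuals_le[OF gamma_mono])
    also have "(norm (X 0 - q))\<^sup>2 = (norm (x 0 - xbar))\<^sup>2 + (\<Sum>i\<in>{1..m}. (norm (v i 0 - w i))\<^sup>2)"
      unfolding pd.norm_S[OF subspace_diff[OF pd.S_sub T.x0 q]] by (simp add: X_def q_def entry_pack)
    also have "\<dots> / (2 * \<gamma> 0) = R w" by (simp add: R_def add_divide_distrib sum_divide_distrib)
    finally have "pd.lagrangian (xavg N) w - pd.objective xbar \<le> R w / real N"
      using N by (simp add: field_simps)
    then show ?thesis using w by (intro bexI[of _ w]) linarith+
  qed

  (* a bound on the dual domain that is uniform in N, for the O(1/N) rate *)
  have "\<exists>K. \<forall>w\<in>dom_on (\<G> i) (conjugate_on (\<G> i) (g i)). norm w \<le> K" if i: "i \<in> {1..m}" for i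
  proof -
    obtain K where fin: "\<And>y. y \<in> \<G> i \<Longrightarrow> \<bar>g i y\<bar> \<noteq> \<infinity>"
      and K: "K-lipschitz_on (\<G> i) (\<lambda>y. real_of_ereal (g i y))"
      using g_Lip[OF i] by (auto simp: elipschitz_on_def)
    show ?thesis
      by (intro exI[of _ K] ballI norm_le_Lipschitz_const_if_dom_conjugate[OF pd.G_sub[OF i] K fin])
  qed
  then obtain K where K: "\<And>i w. i \<in> {1..m} \<Longrightarrow> w \<in> dom_on (\<G> i) (conjugate_on (\<G> i) (g i)) \<Longrightarrow> norm w \<le> K i"
    by metis
  have B2_K: "norm (w i) \<le> K i" if "w \<in> B2" "i \<in> {1..m}" for w i
    using that unfolding B2_def by (intro K) auto
  have "L2_set (\<lambda>i. norm (w i)) {1..m} \<le> (\<Sum>i\<in>{1..m}. K i)" if "w \<in> B2" for w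
    using L2_set_le_sum[of "{1..m}" "\<lambda>i. norm (w i)"] sum_mono[of "{1..m}" "\<lambda>i. norm (w i)" K] B2_K[OF that]
    by fastforce
  then have B2_bdd: "\<exists>K. \<forall>w\<in>B2. L2_set (\<lambda>i. norm (w i)) {1..m} \<le> K" by blast

  have bound: "F (xavg N) + G (\<lambda>i. L i (xavg N) - r i) - F xbar - G (\<lambda>i. L i xbar - r i)
      \<le> C B1 B2 / ereal (real N)"
    if B1: "convex B1" "closed B1" "range p1 \<subseteq> B1" and N: "1 \<le> N" for B1 N
  proof -
    have R_le: "ereal (R w) \<le> C B1 B2" if "w \<in> B2" for w
      using SUP_upper[of "(xbar, w)" "B1 \<times> B2" "\<lambda>(y, w). ereal ((norm (x 0 - y))\<^sup>2 / (2 * \<gamma> 0)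
            + (\<Sum>i\<in>{1..m}. (norm (v i 0 - w i))\<^sup>2 / (2 * \<gamma> 0)))"] xbar_B1[OF B1] that
      unfolding C_def R_def by simp
    have "F (xavg N) + G (\<lambda>i. L i (xavg N) - r i) - F xbar - G (\<lambda>i. L i xbar - r i)
        = ereal (pd.objective (xavg N) - pd.objective xbar)"
      unfolding G_def G_real F_real[OF f_xavg[OF N]] F_real[OF f_xbar] by (simp add: pd.objective_def)
    also have "\<dots> \<le> C B1 B2 / ereal (real N)"
    proof (cases "C B1 B2")
      case (real C')
      have "pd.objective (xavg N) - pd.objective xbar \<le> C' / real N"
      proof (rule field_le_epsilon)
        fix \<delta> :: real assume "0 < \<delta>"
        then obtain w where w: "w \<in> B2" "pd.objective (xavg N) - pd.objective xbar \<le> \<delta> + R w / real N"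
          using rate[OF N] by blast
        have "R w / real N \<le> C' / real N" using R_le[OF w(1)] N by (simp add: real divide_right_mono)
        then show "pd.objective (xavg N) - pd.objective xbar \<le> C' / real N + \<delta>" using w(2) by simp
      qed
      then show ?thesis using N by (simp add: real)
    next
      case PInf
      then show ?thesis using N by simp
    next
      case MInf
      obtain w where "w \<in> B2" using rate[OF N zero_less_one] by blast
      then show ?thesis using R_le MInf by fastforce
    qed
    finally show ?thesis .
  qed

  define C0 where "C0 = (norm (x 0 - xbar))\<^sup>2 / (2 * \<gamma> 0) + (\<Sum>i\<in>{1..m}. (norm (v i 0) + K i)\<^sup>2 / (2 * \<gamma> 0))"
  have R_C0: "R w \<le> C0" if "w \<in> B2" for w
    unfolding R_def C0_def
  proof (intro add_left_mono sum_mono divide_right_mono power_mono)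
    fix i assume "i \<in> {1..m}"
    then show "norm (v i 0 - w i) \<le> norm (v i 0) + K i"
      using norm_triangle_ineq4[of "v i 0" "w i"] B2_K[OF that] by fastforce
  qed (use \<gamma>_pos[of 0] in auto)
  have bigO: "(\<lambda>N. real_of_ereal (P (xavg N)) - real_of_ereal (P xbar)) \<in> O(\<lambda>N. 1 / real N)"
  proof (rule bigoI[where c=C0])
    show "\<forall>\<^sub>F N in sequentially. norm (real_of_ereal (P (xavg N)) - real_of_ereal (P xbar))
        \<le> C0 * norm (1 / real N)"
      using eventually_ge_at_top[of 1]
    proof (rule eventually_mono)
      fix N :: nat assume N: "1 \<le> N"
      have "pd.objective (xavg N) - pd.objective xbar \<le> C0 / real N"
      proof (rule field_le_epsilon)
        fix \<delta> :: real assume "0 < \<delta>"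
        then obtain w where w: "w \<in> B2" "pd.objective (xavg N) - pd.objective xbar \<le> \<delta> + R w / real N"
          using rate[OF N] by blast
        have "R w / real N \<le> C0 / real N" using R_C0[OF w(1)] by (rule divide_right_mono) simp
        then show "pd.objective (xavg N) - pd.objective xbar \<le> C0 / real N + \<delta>" using w(2) by simp
      qed
      moreover have "pd.objective xbar \<le> pd.objective (xavg N)"
        using xbar_min[of "xavg N"] by (simp add: P_real[OF f_xbar] P_real[OF f_xavg[OF N]])
      ultimately show "norm (real_of_ereal (P (xavg N)) - real_of_ereal (P xbar)) \<le> C0 * norm (1 / real N)"
        by (simp add: P_real[OF f_xbar] P_real[OF f_xavg[OF N]])
    qed
  qed
  have fin: "\<bar>P xbar\<bar> \<noteq> \<infinity>" "\<forall>N\<ge>1. \<bar>P (xavg N)\<bar> \<noteq> \<infinity>"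
    using P_real[OF f_xbar] P_real[OF f_xavg] by auto
  show ?thesis
    by (intro exI[of _ xbar] conjI allI impI arg_min weak_p1 bdd_p1 B2_bdd bound fin bigO) auto
qed

end
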